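(* Let $\hat P_\varepsilon=-\frac{\hbar^2}{2}\Delta+V_\varepsilon(x)$ on $L^2(\mathbb{R}^n)$, where $V_\varepsilon$ satisfies the standing assumptions listed in the context. Then, for $|\varepsilon|$ small enough, there exist $C^\infty$ functions $\varepsilon\mapsto\omega_{j,\varepsilon}>0$, $j=1,\dots,n$, whose squares are the smooth approximate eigenvalues (modulo $\mathcal{O}(\varepsilon^\infty)$) of the Hessian of $V_\varepsilon$ at its minimum point, and a unitary operator $U_\varepsilon=\Lambda_\varepsilon g_\varepsilon\tau_\varepsilon$ on $L^2(\mathbb{R}^n)$, composed of a translation $\tau_\varepsilon$, an orthogonal change of variables $g_\varepsilon$, and a scaling $\Lambda_\varepsilon$, all in the position variable $x$, such that the differential operator $U_\varepsilon\hat P_\varepsilon U_\varepsilon^*$ has Weyl symbol $$\sigma_W(U_\varepsilon\hat P_\varepsilon U_\varepsilon^* )=\min_{\mathbb{R}^n}V_\varepsilon+H_{2,0}+\varepsilon L_2+L'_\varepsilon=\min_{\mathbb{R}^n}V_\varepsilon+H_{2,0}+L_\varepsilon,$$ where, writing $\omega_{j,\varepsilon}=\omega_{j,0}+\varepsilon\,\omega_{j,1}+\varepsilon^2\tilde\omega_{j,2}(\varepsilon)$ with $\tilde\omega_{j,2}$ smooth, $$H_{2,0}=\sum_{j=1}^n\frac{\omega_{j,0}}{2}(\xi_j^2+x_j^2),\qquad L_2=\sum_{j=1}^n\frac{\omega_{j,1}}{2}(\xi_j^2+x_j^2)\in\mathcal{D}_2,$$ $$M_{2,\varepsilon}=\sum_{j=1}^n\frac{\tilde\omega_{j,2}(\varepsilon)}{2}(\xi_j^2+x_j^2),$$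 $$L'_\varepsilon=\varepsilon^2M_{2,\varepsilon}+R_\varepsilon(x)+\mathcal{O}(\varepsilon^\infty\|x\|^2)\in\mathcal{O}_3,\qquad L_\varepsilon=\varepsilon L_2+L'_\varepsilon\in\mathcal{O}_3,$$ and $R_\varepsilon(x)$ is a smooth function which is $\mathcal{O}(x^3)$ at the origin, uniformly with respect to $\varepsilon$.
   Context: Standing assumptions on $V_\varepsilon$: $V_\varepsilon:\mathbb{R}^n\to\mathbb{R}$ is smooth and depends smoothly on the real parameter $\varepsilon$; $\hbar>0$ is a parameter. There are $E_\infty>0$ and $\varepsilon_0>0$ such that for all $E<E_\infty$ the set $\bigcup_{|\varepsilon|\le\varepsilon_0}V_\varepsilon^{-1}((-\infty,E))$ is bounded. There is $m$ such that for every $N$ there is $C_N$ with $|\partial^\alpha V_\varepsilon(x)|\le C_N(1+\|x\|^2)^{m/2}$ for all $|\varepsilon|\le\varepsilon_0$, $|\alpha|\le N$, $x\in\mathbb{R}^n$. The minimum of $V_\varepsilon$ is attained at a unique point $x_\varepsilon$ and is non-degenerate; at $\varepsilon=0$: $x_0=0$, $V_0(0)=0$, $V_0'(0)=0$, and $V_0''(0)$ is positive definite. The operators: $(\tau_\varepsilon f)(x)=f(x+x_\varepsilon)$. There is a smooth family of orthogonal matrices $Q_\varepsilon$ with $Q_\varepsilon^{-1}V_\varepsilon''(x_\varepsilon)Q_\varepsilon=\mathrm{diag}(\omega_{1,\varepsilon}^2,\dots,\omega_{n,\varepsilon}^2)+\mathcal{O}(\varepsilon^\infty)$, and $(g_\varepsilon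 f)(y)=f(Q_\varepsilon y)$. Finally $(\Lambda_\varepsilon f)(y)=(\omega_{1,\varepsilon}\cdots\omega_{n,\varepsilon})^{-1/4}f\big(y_1/\sqrt{\omega_{1,\varepsilon}},\dots,y_n/\sqrt{\omega_{n,\varepsilon}}\big)$. The Weyl quantization of a symbol $a$ is $(Op^W_\hbar(a)u)(x)=\frac{1}{(2\pi\hbar)^n}\int e^{\frac{i}{\hbar}\langle x-y,\xi\rangle}a(\tfrac{x+y}{2},\xi,\hbar)u(y)\,dy\,d\xi$, and $a$ is the Weyl symbol $\sigma_W$ of that operator. Formal series: $\mathcal{E}=\mathbb{C}[[x_1,\dots,x_n,\xi_1,\dots,\xi_n,\varepsilon,\hbar]]$, where the monomial $x^\alpha\xi^\beta\varepsilon^m\hbar^\ell$ has degree $|\alpha|+|\beta|+m+2\ell$. $\mathcal{D}_N$ is the span of monomials of degree $N$, and $\mathcal{O}_N$ the set of series with no term of degree $<N$. A smooth function of $(x,\xi,\varepsilon,\hbar)$ is said to belong to a subspace of $\mathcal{E}$ if its Taylor series at the origin does. $\mathcal{O}(\varepsilon^\infty\|x\|^2)$ denotes a function which is $\mathcal{O}(\varepsilon^N\|x\|^2)$ for every $N$. *)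

theory Defs
  imports "HOL-Analysis.Analysis"
begin

section \<open>Smooth functions\<close>

text \<open>The differential operator \<open>\<partial>\<^sup>\<alpha>\<close> is encoded by a list in which each basis vector
  \<open>b\<close> occurs as often as the multi-index prescribes, so \<open>|\<alpha>|\<close> is the length of the list.\<close>

fun pderivs :: "'a::euclidean_space list \<Rightarrow> ('a \<Rightarrow> 'b::real_normed_vector) \<Rightarrow> 'a \<Rightarrow> 'b" where
  "pderivs [] f = f"
| "pderivs (v # vs) f = (\<lambda>x. frechet_derivative (pderivs vs f) (at x) v)"

text \<open>Meant for open \<open>S\<close>: if all iterated partial derivatives are differentiable, they are in
  particular continuous, so this is \<open>C\<^sup>\<infinity>\<close>.\<close>

definition smooth_on :: "'a::euclidean_space set \<Rightarrow> ('a \<Rightarrow> 'b::real_normed_vector) \<Rightarrow> bool" where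
  "smooth_on S f \<longleftrightarrow>
     (\<forall>vs. set vs \<subseteq> Basis \<longrightarrow> (\<forall>x\<in>S. pderivs vs f differentiable (at x)))"

definition hessian :: "(real^'n \<Rightarrow> real) \<Rightarrow> real^'n \<Rightarrow> real^'n^'n" where
  "hessian f x = (\<chi> i j. pderivs [axis i 1, axis j 1] f x)"

definition laplacian :: "(real^'n \<Rightarrow> complex) \<Rightarrow> real^'n \<Rightarrow> complex" where
  "laplacian u x = (\<Sum>i\<in>UNIV. pderivs [axis i 1, axis i 1] u x)"

definition diag :: "('n \<Rightarrow> real) \<Rightarrow> real^'n^'n" where
  "diag d = (\<chi> i j. if i = j then d i else 0)"

definition schwartz :: "(real^'n \<Rightarrow> complex) set" where
  "schwartz = {u. smooth_on UNIV u \<and>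
     (\<forall>vs k. set vs \<subseteq> Basis \<longrightarrow> (\<exists>C. \<forall>x. (1 + norm x) ^ k * norm (pderivs vs u x) \<le> C))}"

section \<open>Operators on \<open>L\<^sup>2\<close>\<close>

text \<open>Elements of \<open>L\<^sup>2\<close> are given by Borel representatives; equality in \<open>L\<^sup>2\<close> is equality almost
  everywhere.\<close>

definition L2 :: "(real^'n \<Rightarrow> complex) set" where
  "L2 = {f. f \<in> borel_measurable lborel \<and> integrable lborel (\<lambda>x. (norm (f x))\<^sup>2)}"

definition L2_inner :: "(real^'n \<Rightarrow> complex) \<Rightarrow> (real^'n \<Rightarrow> complex) \<Rightarrow> complex" where
  "L2_inner f g = (LINT x|lborel. cnj (f x) * g x)"

definition unitary_L2 :: "((real^'n \<Rightarrow> complex) \<Rightarrow> real^'n \<Rightarrow> complex) \<Rightarrow> bool" where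
  "unitary_L2 U \<longleftrightarrow>
     (\<forall>f\<in>L2. U f \<in> L2) \<and>
     (\<forall>f\<in>L2. \<forall>g\<in>L2. (AE x in lborel. f x = g x) \<longrightarrow> (AE x in lborel. U f x = U g x)) \<and>
     (\<forall>f\<in>L2. \<forall>g\<in>L2. \<forall>a b. AE x in lborel. U (\<lambda>y. a * f y + b * g y) x = a * U f x + b * U g x) \<and>
     (\<forall>f\<in>L2. \<forall>g\<in>L2. L2_inner (U f) (U g) = L2_inner f g) \<and>
     (\<forall>g\<in>L2. \<exists>f\<in>L2. AE x in lborel. U f x = g x)"

definition adjoint_L2 ::
    "((real^'n \<Rightarrow> complex) \<Rightarrow> real^'n \<Rightarrow> complex) \<Rightarrow> ((real^'n \<Rightarrow> complex) \<Rightarrow> real^'n \<Rightarrow> complex) \<Rightarrow> bool"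
  where
  "adjoint_L2 U W \<longleftrightarrow>
     (\<forall>g\<in>L2. W g \<in> L2) \<and> (\<forall>f\<in>L2. \<forall>g\<in>L2. L2_inner (U f) g = L2_inner f (W g))"

definition translation :: "real^'n \<Rightarrow> (real^'n \<Rightarrow> complex) \<Rightarrow> real^'n \<Rightarrow> complex" where
  "translation a f = (\<lambda>x. f (x + a))"

definition change_of_variables :: "real^'n^'n \<Rightarrow> (real^'n \<Rightarrow> complex) \<Rightarrow> real^'n \<Rightarrow> complex" where
  "change_of_variables Q f = (\<lambda>y. f (Q *v y))"

definition scaling :: "('n::finite \<Rightarrow> real) \<Rightarrow> (real^'n \<Rightarrow> complex) \<Rightarrow> real^'n \<Rightarrow> complex" where
  "scaling w f = (\<lambda>y. complex_of_real ((\<Prod>j\<in>UNIV. w j) powr (-1/4)) * f (\<chi> j. y $ j / sqrt (w j)))"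

definition schroedinger :: "real \<Rightarrow> (real^'n \<Rightarrow> real) \<Rightarrow> (real^'n \<Rightarrow> complex) \<Rightarrow> real^'n \<Rightarrow> complex" where
  "schroedinger h V u = (\<lambda>x. - complex_of_real (h\<^sup>2 / 2) * laplacian u x + complex_of_real (V x) * u x)"

section \<open>Weyl quantization\<close>

text \<open>A symbol is a function of \<open>(x, \<xi>, h)\<close>. The double integral is the iterated one, first over
  \<open>y\<close>, then over \<open>\<xi>\<close>. For smooth symbols of at most polynomial growth, with all their derivatives,
  and a Schwartz function \<open>u\<close>, both integrals converge absolutely (the double integral need not).\<close>

definition weyl_integrand ::
    "real \<Rightarrow> (real^'n \<Rightarrow> real^'n \<Rightarrow> real \<Rightarrow> complex) \<Rightarrow> (real^'n \<Rightarrow> complex)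
     \<Rightarrow> real^'n \<Rightarrow> real^'n \<Rightarrow> real^'n \<Rightarrow> complex" where
  "weyl_integrand h a u x \<xi> y =
     exp (\<i> / complex_of_real h * complex_of_real ((x - y) \<bullet> \<xi>)) * a ((1/2) *\<^sub>R (x + y)) \<xi> h * u y"

definition Op_W ::
    "real \<Rightarrow> (real^'n \<Rightarrow> real^'n \<Rightarrow> real \<Rightarrow> complex) \<Rightarrow> (real^'n \<Rightarrow> complex) \<Rightarrow> real^'n \<Rightarrow> complex" where
  "Op_W h a u x = 1 / complex_of_real ((2 * pi * h) ^ CARD('n)) *
     (LINT \<xi>|lborel. (LINT y|lborel. weyl_integrand h a u x \<xi> y))"

text \<open>The integrability requirements exclude the default value of a divergent integral.\<close>

definition has_weyl_symbol ::
    "real \<Rightarrow> ((real^'n \<Rightarrow> complex) \<Rightarrow> real^'n \<Rightarrow> complex) \<Rightarrow> (real^'n \<Rightarrow> real^'n \<Rightarrow> real \<Rightarrow> complex) \<Rightarrow> bool"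
  where
  "has_weyl_symbol h A a \<longleftrightarrow> (\<forall>u\<in>schwartz. \<forall>x.
     (\<forall>\<xi>. integrable lborel (\<lambda>y. weyl_integrand h a u x \<xi> y)) \<and>
     integrable lborel (\<lambda>\<xi>. LINT y|lborel. weyl_integrand h a u x \<xi> y) \<and>
     A u x = Op_W h a u x)"

section \<open>Formal series in \<open>(x, \<xi>, \<epsilon>, h)\<close>\<close>

text \<open>The exponent \<open>(\<alpha>, \<beta>, m, l)\<close> stands for the monomial
  \<open>x\<^sup>\<alpha> \<xi>\<^sup>\<beta> \<epsilon>\<^sup>m h\<^sup>l\<close>; a formal series is its family of coefficients.\<close>

type_synonym 'n exponent = "('n \<Rightarrow> nat) \<times> ('n \<Rightarrow> nat) \<times> nat \<times> nat"
type_synonym 'n series = "'n exponent \<Rightarrow> complex"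
type_synonym 'n point = "(real^'n) \<times> (real^'n) \<times> real \<times> real"

definition deg :: "'n::finite exponent \<Rightarrow> nat" where
  "deg = (\<lambda>(\<alpha>, \<beta>, m, l). (\<Sum>i\<in>UNIV. \<alpha> i) + (\<Sum>i\<in>UNIV. \<beta> i) + m + 2 * l)"

text \<open>There are only finitely many monomials of degree \<open>N\<close>, so their span is the set of all series
  supported in degree \<open>N\<close>.\<close>

definition D_space :: "nat \<Rightarrow> 'n::finite series set" where
  "D_space N = {s. \<forall>e. deg e \<noteq> N \<longrightarrow> s e = 0}"

definition O_space :: "nat \<Rightarrow> 'n::finite series set" where
  "O_space N = {s. \<forall>e. deg e < N \<longrightarrow> s e = 0}"

text \<open>A list of basis vectors encoding the differential operator with the given exponents. The order
  of the list is arbitrary, which is immaterial for smooth functions.\<close>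

definition directions :: "'n::finite exponent \<Rightarrow> 'n point list" where
  "directions = (\<lambda>(\<alpha>, \<beta>, m, l). SOME vs. set vs \<subseteq> Basis \<and>
     (\<forall>i. count_list vs (axis i 1, 0, 0, 0) = \<alpha> i) \<and>
     (\<forall>i. count_list vs (0, axis i 1, 0, 0) = \<beta> i) \<and>
     count_list vs (0, 0, 1, 0) = m \<and>
     count_list vs (0, 0, 0, 1) = l)"

definition taylor_series :: "('n::finite point \<Rightarrow> complex) \<Rightarrow> 'n series" where
  "taylor_series f = (\<lambda>(\<alpha>, \<beta>, m, l). pderivs (directions (\<alpha>, \<beta>, m, l)) f 0 /
     ((\<Prod>i\<in>UNIV. fact (\<alpha> i)) * (\<Prod>i\<in>UNIV. fact (\<beta> i)) * fact m * fact l))"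

text \<open>The functions of interest are defined for \<open>\<epsilon>\<close> near \<open>0\<close> only; smoothness near the origin
  determines the Taylor series.\<close>

definition belongs_to :: "('n::finite point \<Rightarrow> complex) \<Rightarrow> 'n series set \<Rightarrow> bool" where
  "belongs_to f W \<longleftrightarrow> (\<exists>S. open S \<and> 0 \<in> S \<and> smooth_on S f) \<and> taylor_series f \<in> W"

section \<open>Quadratic forms and remainders\<close>

definition oscillator :: "('n::finite \<Rightarrow> real) \<Rightarrow> real^'n \<Rightarrow> real^'n \<Rightarrow> real" where
  "oscillator c x \<xi> = (\<Sum>j\<in>UNIV. c j / 2 * ((\<xi> $ j)\<^sup>2 + (x $ j)\<^sup>2))"

definition O_eps_infinity :: "real \<Rightarrow> (real \<Rightarrow> 'b::real_normed_vector) \<Rightarrow> bool" where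
  "O_eps_infinity r F \<longleftrightarrow> (\<forall>N. \<exists>C. \<forall>\<epsilon>. \<bar>\<epsilon>\<bar> < r \<longrightarrow> norm (F \<epsilon>) \<le> C * \<bar>\<epsilon>\<bar> ^ N)"

definition O_eps_infinity_norm2 :: "real \<Rightarrow> (real \<Rightarrow> real^'n \<Rightarrow> real) \<Rightarrow> bool" where
  "O_eps_infinity_norm2 r F \<longleftrightarrow>
     (\<forall>N. \<exists>C. \<forall>\<epsilon> x. \<bar>\<epsilon>\<bar> < r \<longrightarrow> \<bar>F \<epsilon> x\<bar> \<le> C * \<bar>\<epsilon>\<bar> ^ N * (norm x)\<^sup>2)"

definition O_cubic_uniformly :: "real \<Rightarrow> (real \<Rightarrow> real^'n \<Rightarrow> real) \<Rightarrow> bool" where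
  "O_cubic_uniformly r F \<longleftrightarrow>
     (\<exists>C. \<exists>\<delta>>0. \<forall>\<epsilon> x. \<bar>\<epsilon>\<bar> < r \<and> norm x < \<delta> \<longrightarrow> \<bar>F \<epsilon> x\<bar> \<le> C * norm x ^ 3)"

end

theory Submission
  imports Defs "HOL-Probability.Characteristic_Functions" "HOL-Probability.Sinc_Integral"
begin

text \<open>The minimum point is smooth by the implicit function theorem, since \<open>xmin\<close> is continuous at \<open>0\<close>:
  the sublevel sets are uniformly bounded and the minimum of \<open>V\<^sub>0\<close> is unique.

  The Hessian is diagonalized up to flat terms without formal series or Borel summation. Among the
  smooth orthogonal families that block-diagonalize it, take one with the largest number of blocks.
  A block that is not scalar to all orders has the form \<open>a I + \<epsilon>\<^sup>k B\<close> with \<open>B(0)\<close> not scalar, and the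
  implicit function theorem splits it further along the eigenspaces of \<open>B(0)\<close>. So all blocks are
  scalar to all orders, that is, diagonal up to flat terms.

  Conjugation by the affine change of variables turns the operator into
  \<open>- h\<^sup>2/2 \<Sum> \<omega>\<^sub>j \<partial>\<^sub>j\<^sup>2 + W\<close>, where \<open>W\<close> is \<open>V\<^sub>\<epsilon>\<close> composed with that change of variables; its Weyl symbol is
  computed by Fourier inversion for Schwartz functions. Second-order Taylor expansion of \<open>W\<close> at \<open>0\<close>
  gives \<open>R\<close>, and the flat off-diagonal part of the Hessian gives \<open>\<rho>\<close>. Membership in \<open>\<O>\<^sub>3\<close> follows
  because a smooth function that is \<open>O(|p|\<^sup>3)\<close> at the origin has no Taylor coefficients of order at
  most \<open>2\<close>, and every monomial of weighted degree less than \<open>3\<close> has order at most \<open>2\<close>.\<close>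

section \<open>Calculus of iterated partial derivatives\<close>

text \<open>Rellich's example shows the obstacle: a smooth symmetric family whose eigenvalues touch
  to infinite order may have no continuous orthonormal eigenvectors. So exact diagonalization is out
  of reach, and eigenvalues can be separated only where they differ at some finite order in
  \<epsilon>. Once \<open>Q\<close> is fixed, the squared frequencies are by definition the exact
  diagonal entries of the rotated Hessian. The whole defect is then off-diagonal and goes into
  \<open>\<rho>\<close>, while the diagonal part becomes the position half of the oscillator. In
  \<open>\<rho>\<close> a power of \<epsilon> stands in front of a quadratic form in x, which is
  what brings it to order 3. The symbol is exact, without corrections in \<open>h\<close>, because
  it is a quadratic form in the momenta plus a function of the position, with no products of the
  two. The potential is evaluated at the midpoint of x and y; its growth bounds make it a multiplier
  of Schwartz functions, so Fourier inversion at y = x applies to the full inner integral.\<close>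

text \<open>Smooth functions, Schwartz functions and tempered multipliers are the instances of the following
  notion, for all \<open>k\<close>, where \<open>P\<close> is trivial, rapid decrease or polynomial growth. Each closure
  property then needs a single induction over \<open>k\<close>.\<close>

primrec hereditary ::
    "(('a::euclidean_space \<Rightarrow> 'b::real_normed_vector) \<Rightarrow> bool) \<Rightarrow> 'a set \<Rightarrow> nat \<Rightarrow> ('a \<Rightarrow> 'b) \<Rightarrow> bool" where
  "hereditary P S 0 f \<longleftrightarrow> P f"
| "hereditary P S (Suc k) f \<longleftrightarrow> P f \<and> (\<forall>x\<in>S. f differentiable (at x)) \<and>
     (\<forall>v\<in>Basis. hereditary P S k (\<lambda>x. frechet_derivative f (at x) v))"

lemma pderivs_append: "pderivs (vs @ ws) f = pderivs vs (pderivs ws f)"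
  by (induction vs) auto

lemma pderivs_snoc: "pderivs (vs @ [v]) f = pderivs vs (\<lambda>x. frechet_derivative f (at x) v)"
  by (simp add: pderivs_append)

lemma hereditary_imp: "hereditary P S k f \<Longrightarrow> P f"
  by (cases k) auto

lemma hereditary_Suc: "hereditary P S (Suc k) f \<Longrightarrow> hereditary P S k f"
proof (induction k arbitrary: f)
  case (Suc k)
  have "hereditary P S (Suc k) (\<lambda>x. frechet_derivative f (at x) v)" if "v \<in> Basis" for v
    using Suc.prems that unfolding hereditary.simps(2)[of P S "Suc k"] by blast
  with Suc.IH have "\<forall>v\<in>Basis. hereditary P S k (\<lambda>x. frechet_derivative f (at x) v)" by blast
  with Suc.prems show ?case unfolding hereditary.simps(2) by blast
qed simp

text \<open>\<open>pderivs\<close> applies the head of the list last, whereas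
  \<open>hereditary\<close> recurses on the derivative of the function itself. The induction over
  lists therefore runs from the right, where \<open>pderivs_snoc\<close> absorbs the derivative
  taken first into the function.\<close>

lemma all_hereditary_iff:
  "(\<forall>k. hereditary P S k f) \<longleftrightarrow>
   (\<forall>vs. set vs \<subseteq> Basis \<longrightarrow> P (pderivs vs f) \<and> (\<forall>x\<in>S. pderivs vs f differentiable (at x)))"
  (is "?L = ?R")
proof
  assume L: ?L
  have "hereditary P S (Suc (length vs + k)) f \<Longrightarrow> set vs \<subseteq> Basis \<Longrightarrow> hereditary P S (Suc k) (pderivs vs f)"
    for vs k f
  proof (induction vs arbitrary: f rule: rev_induct)
    case (snoc v vs)
    from snoc.prems have "hereditary P S (Suc (length vs + k)) (\<lambda>x. frechet_derivative f (at x) v)"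
      by auto
    from snoc.IH[OF this] snoc.prems show ?case by (simp add: pderivs_snoc del: hereditary.simps)
  qed simp
  then have "hereditary P S (Suc 0) (pderivs vs f)" if "set vs \<subseteq> Basis" for vs
    using that L by blast
  then show ?R by auto
next
  assume R: ?R
  have "hereditary P S k f" if "\<forall>vs. set vs \<subseteq> Basis \<longrightarrow> P (pderivs vs f) \<and> (\<forall>x\<in>S. pderivs vs f differentiable (at x))" for k f
    using that
  proof (induction k arbitrary: f)
    case 0
    then show ?case by (metis empty_subsetI hereditary.simps(1) list.set(1) pderivs.simps(1))
  next
    case (Suc k)
    have "hereditary P S k (\<lambda>x. frechet_derivative f (at x) v)" if "v \<in> Basis" for v
    proof (rule Suc.IH, intro allI impI)
      fix vs :: "'a list" assume "set vs \<subseteq> Basis"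
      with that Suc.prems[rule_format, of "vs @ [v]"]
      show "P (pderivs vs (\<lambda>x. frechet_derivative f (at x) v)) \<and> (\<forall>x\<in>S. pderivs vs (\<lambda>x. frechet_derivative f (at x) v) differentiable at x)"
        by (simp add: pderivs_snoc)
    qed
    with Suc.prems[rule_format, of "[]"] show ?case by simp
  qed
  with R show ?L by blast
qed

lemma smooth_on_iff_hereditary: "smooth_on S f \<longleftrightarrow> (\<forall>k. hereditary (\<lambda>_. True) S k f)"
  by (simp add: all_hereditary_iff smooth_on_def)

lemma has_frechet_derivative:
  "f differentiable at x \<Longrightarrow> (f has_derivative frechet_derivative f (at x)) (at x)"
  by (simp add: frechet_derivative_works)

lemma frechet_derivative_eqI: "(f has_derivative f') (at x) \<Longrightarrow> frechet_derivative f (at x) = f'"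
  by (metis frechet_derivative_at)

lemma frechet_derivative_linear: "f differentiable at x \<Longrightarrow> linear (frechet_derivative f (at x))"
  by (rule linear_frechet_derivative)

lemma has_derivative_cong_open:
  assumes "open S" "x \<in> S" "\<And>y. y \<in> S \<Longrightarrow> f y = g y"
  shows "(f has_derivative D) (at x) \<longleftrightarrow> (g has_derivative D) (at x)"
proof
  assume "(f has_derivative D) (at x)"
  then show "(g has_derivative D) (at x)"
    by (rule has_derivative_transform_within_open[OF _ assms(1,2)]) (rule assms(3))
next
  assume "(g has_derivative D) (at x)"
  then show "(f has_derivative D) (at x)"
    by (rule has_derivative_transform_within_open[OF _ assms(1,2)]) (rule assms(3)[symmetric])
qed

lemma differentiable_cong_open:
  assumes "open S" "x \<in> S" "\<And>y. y \<in> S \<Longrightarrow> f y = g y"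
  shows "f differentiable at x \<longleftrightarrow> g differentiable at x"
  unfolding differentiable_def by (simp add: has_derivative_cong_open[OF assms])

lemma frechet_derivative_cong_open:
  assumes "open S" "x \<in> S" "\<And>y. y \<in> S \<Longrightarrow> f y = g y"
  shows "frechet_derivative f (at x) = frechet_derivative g (at x)"
  unfolding frechet_derivative_def by (simp add: has_derivative_cong_open[OF assms])

text \<open>Only the values on the open set \<open>S\<close> may matter, because derivatives take arbitrary values at points
  where the function is not differentiable.\<close>

definition local_on :: "'a set \<Rightarrow> (('a \<Rightarrow> 'b) \<Rightarrow> bool) \<Rightarrow> bool" where
  "local_on S P \<longleftrightarrow> (\<forall>f g. (\<forall>x\<in>S. f x = g x) \<longrightarrow> P f \<longrightarrow> P g)"

lemma local_on_UNIV [simp]: "local_on UNIV P"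
  by (auto simp: local_on_def simp flip: fun_eq_iff)

lemma local_on_True [simp]: "local_on S (\<lambda>_. True)"
  by (auto simp: local_on_def)

lemma hereditary_cong:
  assumes "hereditary P S k f" "open S" "local_on S P" "\<And>x. x \<in> S \<Longrightarrow> f x = g x"
  shows "hereditary P S k g"
  using assms(1,4)
proof (induction k arbitrary: f g)
  case 0
  then have "P f" "\<forall>x\<in>S. f x = g x" by auto
  then show ?case using assms(3) unfolding local_on_def hereditary.simps by blast
next
  case (Suc k)
  have "P f" "\<forall>x\<in>S. f x = g x" using Suc.prems by auto
  then have "P g" using assms(3) unfolding local_on_def by blast
  moreover have "g differentiable at x" if "x \<in> S" for x
    using Suc.prems differentiable_cong_open[OF assms(2) that, of f g] that by auto
  moreover have "hereditary P S k (\<lambda>x. frechet_derivative g (at x) v)" if "v \<in> Basis" for v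
  proof (rule Suc.IH)
    show "hereditary P S k (\<lambda>x. frechet_derivative f (at x) v)" using Suc.prems that by auto
    show "frechet_derivative f (at x) v = frechet_derivative g (at x) v" if "x \<in> S" for x
      using frechet_derivative_cong_open[OF assms(2) that, of f g] Suc.prems by simp
  qed
  ultimately show ?case by simp
qed

text \<open>Locality lets any formula \<open>f'\<close> for the derivative stand in for
  \<open>frechet_derivative\<close>, with which it agrees on \<open>S\<close> only. All closure
  properties below go through this rule.\<close>

lemma hereditary_SucI:
  assumes "open S" "local_on S P" "P f"
    and D: "\<And>x. x \<in> S \<Longrightarrow> (f has_derivative f' x) (at x)"
    and k: "\<And>v. v \<in> Basis \<Longrightarrow> hereditary P S k (\<lambda>x. f' x v)"
  shows "hereditary P S (Suc k) f"
proof -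
  have "hereditary P S k (\<lambda>x. frechet_derivative f (at x) v)" if "v \<in> Basis" for v
    using hereditary_cong[OF k[OF that] assms(1,2), of "\<lambda>x. frechet_derivative f (at x) v"]
    by (simp add: frechet_derivative_eqI[OF D])
  then show ?thesis using assms(3) D by (auto simp: differentiable_def)
qed

lemma hereditary_SucD:
  assumes "hereditary P S (Suc k) f"
  shows "P f" "x \<in> S \<Longrightarrow> (f has_derivative frechet_derivative f (at x)) (at x)"
    "v \<in> Basis \<Longrightarrow> hereditary P S k (\<lambda>x. frechet_derivative f (at x) v)"
  using assms has_frechet_derivative by auto

lemma hereditary_linear:
  assumes "bounded_linear L" "open S" "local_on S Q" "\<And>f. P f \<Longrightarrow> Q (\<lambda>x. L (f x))"
    and "hereditary P S k f"
  shows "hereditary Q S k (\<lambda>x. L (f x))"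
  using assms(5)
proof (induction k arbitrary: f)
  case (Suc k)
  note D = hereditary_SucD[OF Suc.prems]
  show ?case
    by (rule hereditary_SucI[where f' = "\<lambda>x v. L (frechet_derivative f (at x) v)"])
       (use assms D Suc.IH in \<open>auto intro: bounded_linear.has_derivative\<close>)
qed (use assms in auto)

lemma hereditary_add:
  assumes "open S" "local_on S P" "\<And>f g. P f \<Longrightarrow> P g \<Longrightarrow> P (\<lambda>x. f x + g x)"
    and "hereditary P S k f" "hereditary P S k g"
  shows "hereditary P S k (\<lambda>x. f x + g x)"
  using assms(4,5)
proof (induction k arbitrary: f g)
  case (Suc k)
  note D = hereditary_SucD[OF Suc.prems(1)] and E = hereditary_SucD[OF Suc.prems(2)]
  show ?case
    by (rule hereditary_SucI[where f' = "\<lambda>x v. frechet_derivative f (at x) v + frechet_derivative g (at x) v"])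
       (use assms D E Suc.IH in \<open>auto intro: has_derivative_add\<close>)
qed (use assms in auto)

lemma hereditary_zero:
  assumes "open S" "local_on S P" "P (\<lambda>_. 0)"
  shows "hereditary P S k (\<lambda>_. 0)"
proof (induction k)
  case (Suc k)
  then show ?case
    by (intro hereditary_SucI[where f' = "\<lambda>x v. 0"]) (use assms in auto)
qed (use assms in auto)

lemma hereditary_sum:
  assumes "open S" "local_on S P" "\<And>f g. P f \<Longrightarrow> P g \<Longrightarrow> P (\<lambda>x. f x + g x)" "P (\<lambda>_. 0)"
    and "\<And>i. i \<in> I \<Longrightarrow> hereditary P S k (f i)"
  shows "hereditary P S k (\<lambda>x. \<Sum>i\<in>I. f i x)"
  using assms(5)
proof (induction I rule: infinite_finite_induct)
  case (insert i I)
  then show ?case by (simp add: hereditary_add[OF assms(1,2,3)])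
qed (auto simp: hereditary_zero assms)

text \<open>The three predicates are kept apart for the product of a polynomially bounded with a
  rapidly decreasing function. In the product rule the differentiated factor has order
  \<open>k\<close> by assumption and the other one by \<open>hereditary_Suc\<close>.\<close>

lemma hereditary_bilinear:
  assumes "bounded_bilinear p" "open S" "local_on S R"
    "\<And>f g. P f \<Longrightarrow> Q g \<Longrightarrow> R (\<lambda>x. p (f x) (g x))" "\<And>f g. R f \<Longrightarrow> R g \<Longrightarrow> R (\<lambda>x. f x + g x)"
    and "hereditary P S k f" "hereditary Q S k g"
  shows "hereditary R S k (\<lambda>x. p (f x) (g x))"
  using assms(6,7)
proof (induction k arbitrary: f g)
  case (Suc k)
  note D = hereditary_SucD[OF Suc.prems(1)] and E = hereditary_SucD[OF Suc.prems(2)]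
  show ?case
  proof (rule hereditary_SucI[where f' = "\<lambda>x v. p (f x) (frechet_derivative g (at x) v) + p (frechet_derivative f (at x) v) (g x)"])
    show "((\<lambda>x. p (f x) (g x)) has_derivative
             (\<lambda>v. p (f x) (frechet_derivative g (at x) v) + p (frechet_derivative f (at x) v) (g x))) (at x)"
      if "x \<in> S" for x
      by (rule bounded_bilinear.FDERIV[OF assms(1)]) (use D E that in auto)
    show "hereditary R S k (\<lambda>x. p (f x) (frechet_derivative g (at x) v) + p (frechet_derivative f (at x) v) (g x))"
      if "v \<in> Basis" for v
    proof (rule hereditary_add[OF assms(2,3,5)])
      show "hereditary R S k (\<lambda>x. p (f x) (frechet_derivative g (at x) v))"
        by (rule Suc.IH[OF hereditary_Suc[OF Suc.prems(1)] E(3)[OF that]])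
      show "hereditary R S k (\<lambda>x. p (frechet_derivative f (at x) v) (g x))"
        by (rule Suc.IH[OF D(3)[OF that] hereditary_Suc[OF Suc.prems(2)]])
    qed
  qed (use assms D E in auto)
qed (use assms in auto)

text \<open>The inner map has constant derivative, so the chain rule yields linear combinations,
  with constant coefficients, of partial derivatives of \<open>f\<close> composed with the same map.
  Hence \<open>P\<close> has to be closed under sums and real multiples only, which rapid decrease
  and polynomial growth both are.\<close>

lemma hereditary_comp_affine:
  assumes "linear L" and "\<And>f g. P f \<Longrightarrow> P g \<Longrightarrow> P (\<lambda>x. f x + g x)" "P (\<lambda>_. 0)"
    "\<And>f (c::real). P f \<Longrightarrow> P (\<lambda>x. c *\<^sub>R f x)" "\<And>f. P f \<Longrightarrow> Q (\<lambda>x. f (L x + a))"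
    and "hereditary P UNIV k f"
  shows "hereditary Q UNIV k (\<lambda>x. f (L x + a))"
  using assms(6)
proof (induction k arbitrary: f)
  case (Suc k)
  note D = hereditary_SucD[OF Suc.prems]
  let ?f' = "\<lambda>x v. \<Sum>b\<in>Basis. (L v \<bullet> b) *\<^sub>R frechet_derivative f (at x) b"
  have eq: "?f' x v = frechet_derivative f (at x) (L v)" for x v
  proof -
    have "linear (frechet_derivative f (at x))" using D(2)[of x] has_derivative_linear by auto
    then show ?thesis
      by (subst (2) euclidean_representation[symmetric, of "L v"]) (simp add: linear_sum linear_scale)
  qed
  show ?case
  proof (rule hereditary_SucI[where f' = "\<lambda>x v. ?f' (L x + a) v"])
    show "((\<lambda>x. f (L x + a)) has_derivative ?f' (L x + a)) (at x)" for x
    proof -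
      have "((\<lambda>x. L x + a) has_derivative L) (at x)"
        using assms(1) by (auto intro!: derivative_eq_intros bounded_linear_imp_has_derivative simp: linear_conv_bounded_linear)
      from diff_chain_at[OF this D(2)] show ?thesis
        by (simp add: o_def eq)
    qed
    show "hereditary Q UNIV k (\<lambda>x. ?f' (L x + a) v)" for v
    proof (rule Suc.IH)
      show "hereditary P UNIV k (\<lambda>x. ?f' x v)"
        by (rule hereditary_sum[OF _ _ assms(2,3)], simp, simp, assumption, assumption)
           (rule hereditary_linear[OF bounded_linear_scaleR_right, of _ _ P], use assms(4) D in auto)
    qed
  qed (use assms D in auto)
qed (use assms in auto)

text \<open>The chain rule gives products of derivatives of \<open>g\<close> with partial
  derivatives of \<open>f\<close> composed with the same \<open>g\<close>; so \<open>g\<close> stays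
  fixed in the induction and only \<open>f\<close> varies.\<close>

lemma hereditary_comp:
  assumes "open S" "hereditary (\<lambda>_. True) S k g" "g ` S \<subseteq> T" "hereditary (\<lambda>_. True) T k f"
  shows "hereditary (\<lambda>_. True) S k (\<lambda>x. f (g x))"
  using assms(2,4)
proof (induction k arbitrary: f)
  case (Suc k)
  note D = hereditary_SucD[OF Suc.prems(1)] and E = hereditary_SucD[OF Suc.prems(2)]
  let ?d = "\<lambda>x v. \<Sum>b\<in>Basis. (frechet_derivative g (at x) v \<bullet> b) *\<^sub>R frechet_derivative f (at (g x)) b"
  have eq: "?d x v = frechet_derivative f (at (g x)) (frechet_derivative g (at x) v)" if "x \<in> S" for x v
  proof -
    have "linear (frechet_derivative f (at (g x)))"
      using E(2)[of "g x"] that assms(3) has_derivative_linear by auto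
    then show ?thesis
      by (subst (2) euclidean_representation[symmetric, of "frechet_derivative g (at x) v"])
         (simp add: linear_sum linear_scale)
  qed
  show ?case
  proof (rule hereditary_SucI[where f' = ?d])
    show "((\<lambda>x. f (g x)) has_derivative ?d x) (at x)" if "x \<in> S" for x
    proof -
      have "g x \<in> T" using that assms(3) by auto
      from diff_chain_at[OF D(2)[OF that] E(2)[OF this]] show ?thesis
        using eq[OF that] by (simp add: o_def)
    qed
    show "hereditary (\<lambda>_. True) S k (\<lambda>x. ?d x v)" if "v \<in> Basis" for v
    proof (rule hereditary_sum[OF assms(1)])
      fix b :: 'b assume b: "b \<in> Basis"
      have "hereditary (\<lambda>_. True) S k (\<lambda>x. frechet_derivative g (at x) v \<bullet> b)"
        by (rule hereditary_linear[OF bounded_linear_inner_left assms(1), of _ "\<lambda>_. True"])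
           (use D that in auto)
      moreover have "hereditary (\<lambda>_. True) S k (\<lambda>x. frechet_derivative f (at (g x)) b)"
        by (rule Suc.IH) (rule hereditary_Suc[OF Suc.prems(1)], rule E(3)[OF b])
      ultimately show "hereditary (\<lambda>_. True) S k
          (\<lambda>x. (frechet_derivative g (at x) v \<bullet> b) *\<^sub>R frechet_derivative f (at (g x)) b)"
        by (intro hereditary_bilinear[OF bounded_bilinear_scaleR assms(1), of _ "\<lambda>_. True" "\<lambda>_. True"]) auto
    qed auto
  qed (use assms in auto)
qed auto

section \<open>Smooth functions\<close>

lemma smooth_onD:
  assumes "smooth_on S f" 
  shows "x \<in> S \<Longrightarrow> f differentiable at x"
    "x \<in> S \<Longrightarrow> (f has_derivative frechet_derivative f (at x)) (at x)"
    "v \<in> Basis \<Longrightarrow> smooth_on S (\<lambda>x. frechet_derivative f (at x) v)"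
proof -
  show "x \<in> S \<Longrightarrow> f differentiable at x"
    using assms unfolding smooth_on_def by (metis empty_subsetI list.set(1) pderivs.simps(1))
  then show "x \<in> S \<Longrightarrow> (f has_derivative frechet_derivative f (at x)) (at x)"
    by (rule has_frechet_derivative)
  show "v \<in> Basis \<Longrightarrow> smooth_on S (\<lambda>x. frechet_derivative f (at x) v)"
    using assms hereditary_SucD(3) unfolding smooth_on_iff_hereditary by blast
qed

lemma smooth_on_imp_continuous_on: "smooth_on S f \<Longrightarrow> continuous_on S f"
  by (meson continuous_at_imp_continuous_on differentiable_imp_continuous_within smooth_onD(1))

lemma smooth_on_pderivs: "smooth_on S f \<Longrightarrow> set vs \<subseteq> Basis \<Longrightarrow> smooth_on S (pderivs vs f)"
  by (induction vs) (auto intro: smooth_onD)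

lemma smooth_on_subset: "smooth_on S f \<Longrightarrow> T \<subseteq> S \<Longrightarrow> smooth_on T f"
  by (auto simp: smooth_on_def)

lemma smooth_on_cong:
  assumes "smooth_on S f" "open S" "\<And>x. x \<in> S \<Longrightarrow> f x = g x"
  shows "smooth_on S g"
  using assms unfolding smooth_on_iff_hereditary by (blast intro: hereditary_cong local_on_True)

lemma smooth_on_const [intro!, simp]: "smooth_on S (\<lambda>_. c)"
proof -
  have "hereditary (\<lambda>_. True) UNIV k (\<lambda>_. c)" for k
  proof (cases k)
    case (Suc l)
    then show ?thesis
      using hereditary_SucI[of UNIV "\<lambda>_. True" "\<lambda>_. c" "\<lambda>_ _. 0" l] hereditary_zero[of UNIV "\<lambda>_. True"]
      by auto
  qed auto
  then have "smooth_on UNIV (\<lambda>_. c)" unfolding smooth_on_iff_hereditary by blast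
  then show ?thesis by (rule smooth_on_subset) auto
qed

lemma smooth_on_bounded_linear:
  assumes "bounded_linear L" "smooth_on S f" "open S"
  shows "smooth_on S (\<lambda>x. L (f x))"
  using assms hereditary_linear[OF assms(1,3), of "\<lambda>_. True" "\<lambda>_. True"] unfolding smooth_on_iff_hereditary by auto

lemma smooth_on_id [intro!, simp]: "smooth_on S (\<lambda>x::'a::euclidean_space. x)"
proof -
  have "hereditary (\<lambda>_. True) UNIV k (\<lambda>x::'a. x)" for k
  proof (cases k)
    case (Suc l)
    have "hereditary (\<lambda>_. True) UNIV l (\<lambda>x::'a. v)" for v :: 'a
      using smooth_on_const[of UNIV v] unfolding smooth_on_iff_hereditary by blast
    then show ?thesis
      unfolding Suc by (intro hereditary_SucI[of UNIV "\<lambda>_. True" "\<lambda>x. x" "\<lambda>_ v. v" l]) auto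
  qed auto
  then have "smooth_on UNIV (\<lambda>x::'a. x)" unfolding smooth_on_iff_hereditary by blast
  then show ?thesis by (rule smooth_on_subset) auto
qed

lemma smooth_on_add: "smooth_on S f \<Longrightarrow> smooth_on S g \<Longrightarrow> open S \<Longrightarrow> smooth_on S (\<lambda>x. f x + g x)"
  unfolding smooth_on_iff_hereditary by (auto intro: hereditary_add)

lemma smooth_on_sum: "(\<And>i. i \<in> I \<Longrightarrow> smooth_on S (f i)) \<Longrightarrow> open S \<Longrightarrow> smooth_on S (\<lambda>x. \<Sum>i\<in>I. f i x)"
  unfolding smooth_on_iff_hereditary by (auto intro: hereditary_sum)

lemma smooth_on_bilinear:
  "bounded_bilinear p \<Longrightarrow> smooth_on S f \<Longrightarrow> smooth_on S g \<Longrightarrow> open S \<Longrightarrow> smooth_on S (\<lambda>x. p (f x) (g x))"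
  unfolding smooth_on_iff_hereditary
  using hereditary_bilinear[of p S "\<lambda>_. True" "\<lambda>_. True" "\<lambda>_. True"] by auto

lemmas smooth_on_scaleR = smooth_on_bilinear[OF bounded_bilinear_scaleR]
lemmas smooth_on_mult = smooth_on_bilinear[OF bounded_bilinear_mult]
lemmas smooth_on_inner = smooth_on_bilinear[OF bounded_bilinear_inner]
lemmas smooth_on_minus = smooth_on_bounded_linear[OF bounded_linear_minus[OF bounded_linear_ident]]
lemmas smooth_on_of_real = smooth_on_bounded_linear[OF bounded_linear_of_real]
lemmas smooth_on_fst = smooth_on_bounded_linear[OF bounded_linear_fst]
lemmas smooth_on_snd = smooth_on_bounded_linear[OF bounded_linear_snd]
lemmas smooth_on_nth = smooth_on_bounded_linear[OF bounded_linear_vec_nth]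

lemma smooth_on_diff:
  "smooth_on S f \<Longrightarrow> smooth_on S g \<Longrightarrow> open S \<Longrightarrow> smooth_on S (\<lambda>x. f x - g x)"
  using smooth_on_add[OF _ smooth_on_minus, of S f g] by simp

lemma smooth_on_prod:
  fixes f :: "'i \<Rightarrow> 'a::euclidean_space \<Rightarrow> 'b::real_normed_field"
  shows "(\<And>i. i \<in> I \<Longrightarrow> smooth_on S (f i)) \<Longrightarrow> open S \<Longrightarrow> smooth_on S (\<lambda>x. \<Prod>i\<in>I. f i x)"
  by (induction I rule: infinite_finite_induct) (auto intro: smooth_on_mult)

lemma smooth_on_power:
  fixes f :: "'a::euclidean_space \<Rightarrow> 'b::real_normed_field"
  shows "smooth_on S f \<Longrightarrow> open S \<Longrightarrow> smooth_on S (\<lambda>x. f x ^ n)"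
  by (induction n) (auto intro: smooth_on_mult)

lemma smooth_on_compose:
  assumes "smooth_on T f" "smooth_on S g" "open S" "g ` S \<subseteq> T"
  shows "smooth_on S (\<lambda>x. f (g x))"
  using assms hereditary_comp[OF assms(3) _ assms(4)] unfolding smooth_on_iff_hereditary by blast

lemma smooth_on_componentwise:
  assumes "\<And>b. b \<in> Basis \<Longrightarrow> smooth_on S (\<lambda>x. f x \<bullet> b)" "open S"
  shows "smooth_on S f"
proof -
  have "smooth_on S (\<lambda>x. \<Sum>b\<in>Basis. (f x \<bullet> b) *\<^sub>R b)"
    by (intro smooth_on_sum smooth_on_scaleR smooth_on_const assms)
  then show ?thesis by (simp add: euclidean_representation)
qed

lemma smooth_on_vec:
  fixes f :: "'a::euclidean_space \<Rightarrow> 'b::euclidean_space^'n"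
  assumes "\<And>i. smooth_on S (\<lambda>x. f x $ i)" "open S"
  shows "smooth_on S f"
proof (rule smooth_on_componentwise)
  fix b :: "'b^'n" assume "b \<in> Basis"
  then obtain i u where "b = axis i u" by (auto simp: Basis_vec_def)
  then show "smooth_on S (\<lambda>x. f x \<bullet> b)"
    by (simp add: inner_axis) (intro smooth_on_inner assms smooth_on_const)
qed (rule assms)

lemma smooth_on_Pair:
  fixes f :: "'a::euclidean_space \<Rightarrow> 'b::euclidean_space" and g :: "'a \<Rightarrow> 'c::euclidean_space"
  assumes "smooth_on S f" "smooth_on S g" "open S"
  shows "smooth_on S (\<lambda>x. (f x, g x))"
proof (rule smooth_on_componentwise)
  fix b :: "'b \<times> 'c"
  have "smooth_on S (\<lambda>x. f x \<bullet> fst b + g x \<bullet> snd b)"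
    by (intro smooth_on_add smooth_on_inner assms smooth_on_const)
  then show "smooth_on S (\<lambda>x. (f x, g x) \<bullet> b)"
    by (simp add: inner_prod_def)
qed (rule assms)

text \<open>In one variable an explicit sequence of successive derivatives certifies smoothness. It
  serves for functions with closed formulas and for the parameter integrals of Hadamard's
  lemma.\<close>

lemma smooth_onI_1d:
  fixes f :: "real \<Rightarrow> 'b::real_normed_vector"
  assumes "open S" "\<And>n x. x \<in> S \<Longrightarrow> (D n has_vector_derivative D (Suc n) x) (at x)" "D 0 = f"
  shows "smooth_on S f"
proof -
  have "hereditary (\<lambda>_. True) S k (D n)" for k n
  proof (induction k arbitrary: n)
    case (Suc k)
    have "hereditary (\<lambda>_. True) S k (\<lambda>x. v *\<^sub>R D (Suc n) x)" if "v \<in> Basis" for v :: real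
      using that Suc by simp
    then show ?case
      using assms(1,2)
      by (intro hereditary_SucI[where f' = "\<lambda>x v. v *\<^sub>R D (Suc n) x"]) (auto simp: has_vector_derivative_def)
  qed simp
  then show ?thesis using assms(3) unfolding smooth_on_iff_hereditary by blast
qed

lemma smooth_on_powr: "smooth_on {0<..} (\<lambda>x::real. x powr a)"
proof (rule smooth_onI_1d[where D = "\<lambda>n x. (\<Prod>i<n. a - of_nat i) * x powr (a - of_nat n)"])
  fix n :: nat and x :: real assume "x \<in> {0<..}"
  then show "((\<lambda>x. (\<Prod>i<n. a - of_nat i) * x powr (a - of_nat n)) has_vector_derivative
         (\<Prod>i<Suc n. a - of_nat i) * x powr (a - of_nat (Suc n))) (at x)"
    by (auto simp: has_real_derivative_iff_has_vector_derivative[symmetric] algebra_simps intro!: derivative_eq_intros)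
qed auto

lemma smooth_on_inverse_real: "smooth_on (- {0}) (\<lambda>x::real. inverse x)"
proof (rule smooth_onI_1d[where D = "\<lambda>n x. (-1)^n * fact n * inverse x ^ (Suc n)"])
  fix n :: nat and x :: real assume x: "x \<in> - {0}"
  have "((\<lambda>x. (-1)^n * fact n * inverse x ^ (Suc n)) has_real_derivative
      (-1)^n * fact n * (of_nat (Suc n) * inverse x ^ n * (- (inverse x ^ Suc (Suc 0))))) (at x)"
    using x by (auto intro!: derivative_eq_intros simp del: power_Suc) (simp add: algebra_simps)
  then show "((\<lambda>x. (-1)^n * fact n * inverse x ^ (Suc n)) has_vector_derivative
      (-1)^Suc n * fact (Suc n) * inverse x ^ (Suc (Suc n))) (at x)"
    unfolding has_real_derivative_iff_has_vector_derivative[symmetric]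
    by (rule DERIV_cong) (simp add: algebra_simps)
qed auto

lemma smooth_on_divide:
  fixes f g :: "'a::euclidean_space \<Rightarrow> real"
  assumes "smooth_on S f" "smooth_on S g" "open S" "\<And>x. x \<in> S \<Longrightarrow> g x \<noteq> 0"
  shows "smooth_on S (\<lambda>x. f x / g x)"
proof -
  have "smooth_on S (\<lambda>x. inverse (g x))"
    by (rule smooth_on_compose[OF smooth_on_inverse_real assms(2,3)]) (use assms in auto)
  then show ?thesis using smooth_on_mult[OF assms(1) _ assms(3)] by (simp add: divide_inverse)
qed

lemma smooth_on_sqrt:
  fixes f :: "'a::euclidean_space \<Rightarrow> real"
  assumes "smooth_on S f" "open S" "\<And>x. x \<in> S \<Longrightarrow> f x > 0"
  shows "smooth_on S (\<lambda>x. sqrt (f x))"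
proof -
  have "smooth_on S (\<lambda>x. f x powr (1/2))"
    by (rule smooth_on_compose[OF smooth_on_powr assms(1,2)]) (use assms in auto)
  then show ?thesis
    by (rule smooth_on_cong) (use assms in \<open>auto simp: powr_half_sqrt less_imp_le\<close>)
qed

lemma smooth_on_directional:
  assumes "smooth_on S f" "open S"
  shows "smooth_on S (\<lambda>x. frechet_derivative f (at x) v)"
proof -
  have "smooth_on S (\<lambda>x. \<Sum>b\<in>Basis. (v \<bullet> b) *\<^sub>R frechet_derivative f (at x) b)"
    by (intro smooth_on_sum smooth_on_scaleR smooth_onD(3) smooth_on_const assms)
  then show ?thesis
  proof (rule smooth_on_cong)
    fix x assume "x \<in> S"
    then have "linear (frechet_derivative f (at x))"
      using assms frechet_derivative_linear smooth_onD(1) by blast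
    then show "(\<Sum>b\<in>Basis. (v \<bullet> b) *\<^sub>R frechet_derivative f (at x) b) = frechet_derivative f (at x) v"
      by (subst (2) euclidean_representation[symmetric, of v]) (simp add: linear_sum linear_scale)
  qed (rule assms)
qed

section \<open>Symmetry of second derivatives\<close>

lemma has_derivative_along_line:
  assumes "f differentiable at (a + s *\<^sub>R u)"
  shows "((\<lambda>s. f (a + s *\<^sub>R u)) has_vector_derivative frechet_derivative f (at (a + s *\<^sub>R u)) u) (at s)"
proof -
  have "((\<lambda>s. a + s *\<^sub>R u) has_derivative (\<lambda>h. h *\<^sub>R u)) (at s)"
    by (auto intro!: derivative_eq_intros)
  from diff_chain_at[OF this has_frechet_derivative[OF assms]]
  have "((\<lambda>s. f (a + s *\<^sub>R u)) has_derivative (\<lambda>h. frechet_derivative f (at (a + s *\<^sub>R u)) (h *\<^sub>R u))) (at s)"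
    by (simp add: o_def)
  then show ?thesis
    by (simp add: has_vector_derivative_def linear_scale[OF frechet_derivative_linear[OF assms]])
qed

text \<open>The mean value theorem is applied along \<open>u\<close> to the increment over
  \<open>t v\<close>, then along \<open>v\<close> to the derivative in direction \<open>u\<close>.
  The second difference itself is symmetric in \<open>u\<close> and \<open>v\<close>, which is the
  point of the lemma.\<close>

lemma second_difference_mvt:
  fixes f :: "'a::euclidean_space \<Rightarrow> real"
  assumes "smooth_on S f" "open S" "ball x r \<subseteq> S" "0 < t" "t * (norm u + norm v) < r"
  shows "\<exists>p. dist p x \<le> t * (norm u + norm v) \<and>
    f (x + t *\<^sub>R u + t *\<^sub>R v) - f (x + t *\<^sub>R u) - f (x + t *\<^sub>R v) + f x =
      t\<^sup>2 * frechet_derivative (\<lambda>y. frechet_derivative f (at y) u) (at p) v"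
proof -
  have near: "dist (x + a *\<^sub>R u + b *\<^sub>R v) x \<le> t * (norm u + norm v)" if "0 \<le> a" "a \<le> t" "0 \<le> b" "b \<le> t" for a b
  proof -
    have "dist (x + a *\<^sub>R u + b *\<^sub>R v) x = norm (a *\<^sub>R u + b *\<^sub>R v)" by (simp add: dist_norm)
    also have "\<dots> \<le> norm (a *\<^sub>R u) + norm (b *\<^sub>R v)" by (rule norm_triangle_ineq)
    also have "\<dots> = a * norm u + b * norm v" using that by simp
    also have "\<dots> \<le> t * norm u + t * norm v" using that by (intro add_mono mult_right_mono) auto
    finally show ?thesis by (simp add: algebra_simps)
  qed
  have inS: "x + a *\<^sub>R u + b *\<^sub>R v \<in> S" if "0 \<le> a" "a \<le> t" "0 \<le> b" "b \<le> t" for a b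
    using near[OF that] assms(3,5) by (auto simp: dist_commute subset_eq)
  define g where "g s = f ((x + t *\<^sub>R v) + s *\<^sub>R u) - f (x + s *\<^sub>R u)" for s
  let ?Du = "\<lambda>y. frechet_derivative f (at y) u"
  have "(g has_real_derivative (?Du (x + t *\<^sub>R v + s *\<^sub>R u) - ?Du (x + s *\<^sub>R u))) (at s)" if "0 \<le> s" "s \<le> t" for s
    unfolding g_def has_real_derivative_iff_has_vector_derivative
    by (intro has_vector_derivative_diff has_derivative_along_line smooth_onD(1)[OF assms(1)])
       (use inS[of s t] inS[of s 0] that assms(4) in \<open>auto simp: algebra_simps\<close>)
  from MVT2[OF assms(4) this]
  obtain s where s: "0 < s" "s < t" "g t - g 0 = t * (?Du (x + t *\<^sub>R v + s *\<^sub>R u) - ?Du (x + s *\<^sub>R u))"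
    by auto
  have "((\<lambda>q. ?Du ((x + s *\<^sub>R u) + q *\<^sub>R v)) has_real_derivative
      frechet_derivative ?Du (at (x + s *\<^sub>R u + q *\<^sub>R v)) v) (at q)" if "0 \<le> q" "q \<le> t" for q
    unfolding has_real_derivative_iff_has_vector_derivative
    by (intro has_derivative_along_line smooth_onD(1)[OF smooth_on_directional[OF assms(1,2)]] inS)
       (use s that in auto)
  from MVT2[OF assms(4) this]
  obtain q where q: "0 < q" "q < t" "?Du (x + s *\<^sub>R u + t *\<^sub>R v) - ?Du (x + s *\<^sub>R u)
      = t * frechet_derivative ?Du (at (x + s *\<^sub>R u + q *\<^sub>R v)) v"
    by auto
  show ?thesis
  proof (intro exI conjI)
    show "dist (x + s *\<^sub>R u + q *\<^sub>R v) x \<le> t * (norm u + norm v)" by (rule near) (use s q in auto)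
    have "f (x + t *\<^sub>R u + t *\<^sub>R v) - f (x + t *\<^sub>R u) - f (x + t *\<^sub>R v) + f x = g t - g 0"
      by (simp add: g_def algebra_simps)
    also have "\<dots> = t * (t * frechet_derivative ?Du (at (x + s *\<^sub>R u + q *\<^sub>R v)) v)"
      using s(3) q(3) by (simp add: add_ac)
    finally show "f (x + t *\<^sub>R u + t *\<^sub>R v) - f (x + t *\<^sub>R u) - f (x + t *\<^sub>R v) + f x =
      t\<^sup>2 * frechet_derivative ?Du (at (x + s *\<^sub>R u + q *\<^sub>R v)) v" by (simp add: power2_eq_square)
  qed
qed

text \<open>Both mixed derivatives take the same value, the second difference divided by the square
  of \<open>t\<close>, at points \<open>p\<close> and \<open>q\<close> near \<open>x\<close>. As
  both are continuous, they cannot differ at \<open>x\<close>.\<close>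

lemma frechet_derivative_commute:
  fixes f :: "'a::euclidean_space \<Rightarrow> real"
  assumes f: "smooth_on S f" "open S" "x \<in> S"
  shows "frechet_derivative (\<lambda>y. frechet_derivative f (at y) u) (at x) v =
         frechet_derivative (\<lambda>y. frechet_derivative f (at y) v) (at x) u"
proof (rule ccontr)
  define A where "A = (\<lambda>p. frechet_derivative (\<lambda>y. frechet_derivative f (at y) u) (at p) v)"
  define B where "B = (\<lambda>p. frechet_derivative (\<lambda>y. frechet_derivative f (at y) v) (at p) u)"
  assume "\<not> ?thesis"
  then have e: "\<bar>A x - B x\<bar> / 2 > 0" by (simp add: A_def B_def)
  have "continuous_on S A" "continuous_on S B"
    unfolding A_def B_def by (intro smooth_on_imp_continuous_on smooth_on_directional f)+
  then have "isCont A x" "isCont B x" using f by (simp_all add: continuous_on_eq_continuous_at)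
  with e obtain d1 d2 where d: "d1 > 0" "\<And>y. dist y x < d1 \<Longrightarrow> dist (A y) (A x) < \<bar>A x - B x\<bar> / 2"
      "d2 > 0" "\<And>y. dist y x < d2 \<Longrightarrow> dist (B y) (B x) < \<bar>A x - B x\<bar> / 2"
    unfolding continuous_at_eps_delta by metis
  obtain r where r: "r > 0" "ball x r \<subseteq> S" using f open_contains_ball by blast
  \<comment> \<open>The summand 1 avoids division by 0 for \<open>u = v = 0\<close>, and the factor
    2 makes the distance bound strict.\<close>
  define t where "t = min r (min d1 d2) / (2 * (norm u + norm v + 1))"
  have t0: "t > 0" using r d by (simp add: t_def add_nonneg_pos)
  have "t * (norm u + norm v) \<le> t * (norm u + norm v + 1)" using t0 by simp
  also have "\<dots> = min r (min d1 d2) / 2"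
  proof -
    have "norm u + norm v + 1 \<noteq> 0" using norm_ge_zero[of u] norm_ge_zero[of v] by linarith
    then show ?thesis unfolding t_def by (metis (no_types) divide_divide_eq_left' mult.commute nonzero_mult_div_cancel_left times_divide_eq_right)
  qed
  also have "\<dots> < min r (min d1 d2)" using r(1) d(1,3) by linarith
  finally have t: "t * (norm u + norm v) < min r (min d1 d2)" .
  obtain p where p: "dist p x \<le> t * (norm u + norm v)"
     "f (x + t *\<^sub>R u + t *\<^sub>R v) - f (x + t *\<^sub>R u) - f (x + t *\<^sub>R v) + f x = t\<^sup>2 * A p"
    using second_difference_mvt[OF f(1,2) r(2) t0, of u v] t unfolding A_def by auto
  obtain q where q: "dist q x \<le> t * (norm u + norm v)"
     "f (x + t *\<^sub>R v + t *\<^sub>R u) - f (x + t *\<^sub>R v) - f (x + t *\<^sub>R u) + f x = t\<^sup>2 * B q"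
    using second_difference_mvt[OF f(1,2) r(2) t0, of v u] t unfolding B_def by (auto simp: add_ac)
  have "t\<^sup>2 * A p = t\<^sup>2 * B q" using p(2) q(2) by (simp add: algebra_simps)
  then have "A p = B q" using t0 by simp
  moreover have "dist (A p) (A x) < \<bar>A x - B x\<bar> / 2" "dist (B q) (B x) < \<bar>A x - B x\<bar> / 2"
    using d p q t by auto
  moreover from \<open>A p = B q\<close> have "\<bar>A x - B x\<bar> \<le> dist (A p) (A x) + dist (B q) (B x)"
    unfolding dist_real_def by linarith
  ultimately show False by argo
qed

section \<open>Hadamard's lemma in one variable\<close>

lemma smooth_on_1d_derivs:
  fixes f :: "real \<Rightarrow> 'b::real_normed_vector"
  assumes "smooth_on S f"
  obtains D where "D 0 = f" "\<And>n x. x \<in> S \<Longrightarrow> (D n has_vector_derivative D (Suc n) x) (at x)"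
    "\<And>n. continuous_on S (D n)"
proof
  let ?D = "\<lambda>n. pderivs (replicate n 1) f"
  show "?D 0 = f" by simp
  have sm: "smooth_on S (?D n)" for n by (intro smooth_on_pderivs assms) auto
  show "continuous_on S (?D n)" for n by (rule smooth_on_imp_continuous_on[OF sm])
  show "(?D n has_vector_derivative ?D (Suc n) x) (at x)" if "x \<in> S" for n x
    using has_derivative_along_line[of "?D n" 0 x 1] smooth_onD(1)[OF sm that] by simp
qed

text \<open>Hadamard's lemma: the quotient is the integral of the derivative of \<open>f\<close> at
  \<open>x * t\<close> over \<open>t\<close> from 0 to 1. Differentiating \<open>n\<close> times
  under the integral sign gives \<open>G n\<close>, so the quotient is smooth at 0 as well.\<close>

lemma smooth_divide_by_argument:
  fixes f :: "real \<Rightarrow> real"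
  assumes f: "smooth_on {-r<..<r} f" and f0: "f 0 = 0"
  obtains g where "smooth_on {-r<..<r} g" "\<And>x. \<bar>x\<bar> < r \<Longrightarrow> f x = x * g x"
proof -
  obtain D where D0: "D 0 = f" and D: "\<And>n x. x \<in> {-r<..<r} \<Longrightarrow> (D n has_vector_derivative D (Suc n) x) (at x)"
    and Dc: "\<And>n. continuous_on {-r<..<r} (D n)"
    by (rule smooth_on_1d_derivs[OF f]) blast
  let ?S = "{-r<..<r}"
  define G where "G n x = integral (cbox 0 1) (\<lambda>t. t ^ n * D (Suc n) (x * t))" for n :: nat and x :: real
  have in_S: "x * t \<in> ?S" if "x \<in> ?S" "t \<in> cbox 0 1" for x t :: real
  proof -
    have "\<bar>x * t\<bar> \<le> \<bar>x\<bar> * 1" unfolding abs_mult by (rule mult_left_mono) (use that in auto)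
    with that show ?thesis by auto
  qed
  have "(G n has_vector_derivative G (Suc n) x) (at x)" if x: "x \<in> ?S" for n x
  proof -
    have "(G n has_vector_derivative G (Suc n) x) (at x within ?S)"
      unfolding G_def
    proof (rule leibniz_rule_vector_derivative)
      show "((\<lambda>x. t ^ n * D (Suc n) (x * t)) has_vector_derivative t ^ Suc n * D (Suc (Suc n)) (x * t)) (at x within ?S)"
        if "x \<in> ?S" "t \<in> cbox 0 1" for x t
      proof -
        have "(D (Suc n) has_real_derivative D (Suc (Suc n)) (x * t)) (at (x * t))"
          using D[OF in_S[OF that]] by (simp add: has_real_derivative_iff_has_vector_derivative)
        then have "((\<lambda>x. D (Suc n) (x * t)) has_real_derivative D (Suc (Suc n)) (x * t) * t) (at x)"
          by (rule DERIV_chain2) (auto intro!: derivative_eq_intros)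
        then have "((\<lambda>x. t ^ n * D (Suc n) (x * t)) has_real_derivative t ^ n * (D (Suc (Suc n)) (x * t) * t)) (at x)"
          by (rule DERIV_cmult)
        then show ?thesis
          unfolding has_real_derivative_iff_has_vector_derivative[symmetric]
          by (rule DERIV_subset[OF DERIV_cong]) auto
      qed
      show "(\<lambda>t. t ^ n * D (Suc n) (x * t)) integrable_on cbox 0 1" if "x \<in> ?S" for x
        by (intro integrable_continuous continuous_intros continuous_on_compose2[OF Dc[of "Suc n"]])
           (use in_S that in auto)
      show "continuous_on (?S \<times> cbox 0 1) (\<lambda>(x, t). t ^ Suc n * D (Suc (Suc n)) (x * t))"
        unfolding split_beta
        by (intro continuous_intros continuous_on_compose2[OF Dc[of "Suc (Suc n)"]])
           (use in_S in auto)
    qed (use x in auto)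
    then show ?thesis by (subst (asm) at_within_open) (use x in auto)
  qed
  then have "smooth_on ?S (G 0)" by (intro smooth_onI_1d[where D = G]) auto
  moreover have "f x = x * G 0 x" if "\<bar>x\<bar> < r" for x
  proof -
    have x: "x \<in> ?S" using that by auto
    have "((\<lambda>t. x * D (Suc 0) (x * t)) has_integral (f (x * 1) - f (x * 0))) {0..1}"
    proof (rule fundamental_theorem_of_calculus)
      fix t :: real assume t: "t \<in> {0..1}"
      have "(f has_real_derivative D (Suc 0) (x * t)) (at (x * t))"
        using D[of "x * t" 0] in_S[OF x, of t] t by (simp add: has_real_derivative_iff_has_vector_derivative D0)
      then have "((\<lambda>t. f (x * t)) has_real_derivative D (Suc 0) (x * t) * x) (at t)"
        by (rule DERIV_chain2) (auto intro!: derivative_eq_intros)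
      then show "((\<lambda>t. f (x * t)) has_vector_derivative x * D (Suc 0) (x * t)) (at t within {0..1})"
        unfolding has_real_derivative_iff_has_vector_derivative[symmetric]
        by (rule DERIV_subset[OF DERIV_cong]) auto
    qed simp
    from integral_unique[OF this] have "f x = x * integral {0..1} (\<lambda>t. D (Suc 0) (x * t))"
      using f0 by simp
    then show ?thesis unfolding G_def power_0 mult_1 cbox_interval One_nat_def[symmetric] by simp
  qed
  ultimately show ?thesis by (rule that)
qed

section \<open>A smooth implicit function theorem\<close>

lemma smooth_on_det:
  fixes A :: "'a::euclidean_space \<Rightarrow> real^'n^'n"
  assumes "\<And>i j. smooth_on S (\<lambda>x. A x $ i $ j)" "open S"
  shows "smooth_on S (\<lambda>x. det (A x))"
  unfolding det_def by (intro smooth_on_sum smooth_on_mult smooth_on_prod smooth_on_const assms)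

lemma hereditary_Pair_True:
  assumes "open S" "hereditary (\<lambda>_. True) S k (f :: 'a::euclidean_space \<Rightarrow> 'b::real_normed_vector)"
    "hereditary (\<lambda>_. True) S k (g :: 'a \<Rightarrow> 'c::real_normed_vector)"
  shows "hereditary (\<lambda>_. True) S k (\<lambda>x. (f x, g x))"
proof -
  have 1: "bounded_linear (\<lambda>x::'b. (x, 0::'c))" and 2: "bounded_linear (\<lambda>x::'c. (0::'b, x))"
    by (auto intro!: bounded_linear_Pair bounded_linear_ident bounded_linear_zero)
  have "hereditary (\<lambda>_. True) S k (\<lambda>x. (f x, 0::'c) + (0::'b, g x))"
    by (rule hereditary_add[OF assms(1)])
       (use hereditary_linear[OF 1 assms(1) _ _ assms(2), of "\<lambda>_. True"]
            hereditary_linear[OF 2 assms(1) _ _ assms(3), of "\<lambda>_. True"] in auto)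
  then show ?thesis by simp
qed

text \<open>Bootstrapping: if \<open>y\<close> has \<open>k\<close> derivatives, so has the
  right-hand side \<open>H (e, y e)\<close>, and hence \<open>y\<close> has one more.\<close>

lemma autonomous_ode_smooth:
  fixes y :: "real \<Rightarrow> 'b::euclidean_space"
  assumes "open I" "smooth_on T H" "\<And>e. e \<in> I \<Longrightarrow> (e, y e) \<in> T"
    "\<And>e. e \<in> I \<Longrightarrow> (y has_vector_derivative H (e, y e)) (at e)"
  shows "smooth_on I y"
proof -
  have "hereditary (\<lambda>_. True) I k y" for k
  proof (induction k)
    case (Suc k)
    have id: "hereditary (\<lambda>_. True) I k (\<lambda>e. e)" using smooth_on_id[of I] unfolding smooth_on_iff_hereditary by blast
    have H: "hereditary (\<lambda>_. True) T k H" using assms(2) unfolding smooth_on_iff_hereditary by blast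
    have "hereditary (\<lambda>_. True) I k (\<lambda>e. H (e, y e))"
      by (rule hereditary_comp[OF assms(1) hereditary_Pair_True[OF assms(1) id Suc] _ H]) (use assms(3) in auto)
    then show ?case
      using assms(1,4) by (intro hereditary_SucI[where f' = "\<lambda>e v. v *\<^sub>R H (e, y e)"]) (auto simp: has_vector_derivative_def)
  qed simp
  then show ?thesis unfolding smooth_on_iff_hereditary by blast
qed

text \<open>The inverse function theorem for \<open>G\<close>, which maps \<open>(e, z)\<close> to
  \<open>(e, F (e, z))\<close>, yields a differentiable solution that is unique in \<open>U\<close>.
  Cramer's rule expresses its derivative by a smooth function \<open>H\<close> of
  \<open>(e, y e)\<close>, and the bootstrap for differential equations gives smoothness.\<close>

lemma smooth_implicit_function:
  fixes F :: "real \<times> (real^'m) \<Rightarrow> real^'m"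
  assumes W: "open W" "(0, y0) \<in> W" and F: "smooth_on W F" and F0: "F (0, y0) = 0"
    and inj: "\<And>v. frechet_derivative F (at (0, y0)) (0, v) = 0 \<Longrightarrow> v = 0"
  obtains r U y where "r > 0" "open U" "(0, y0) \<in> U" "smooth_on {-r<..<r} y" "y 0 = y0"
    "\<And>e. \<bar>e\<bar> < r \<Longrightarrow> F (e, y e) = 0"
    "\<And>e z. \<bar>e\<bar> < r \<Longrightarrow> (e, z) \<in> U \<Longrightarrow> F (e, z) = 0 \<Longrightarrow> z = y e"
proof -
  define F' where "F' p = frechet_derivative F (at p)" for p
  have F': "(F has_derivative F' p) (at p)" if "p \<in> W" for p
    using smooth_onD(2)[OF F that] by (simp add: F'_def)
  have linF': "linear (F' p)" if "p \<in> W" for p using F'[OF that] has_derivative_linear by blast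
  define G where "G p = (fst p, F p)" for p
  define G' where "G' p v = (fst v, F' p v)" for p v
  have G': "(G has_derivative G' p) (at p)" if "p \<in> W" for p
    unfolding G_def G'_def using F'[OF that] by (auto intro!: derivative_eq_intros)
  have blG: "bounded_linear (G' p)" if "p \<in> W" for p using G'[OF that] has_derivative_bounded_linear by blast
  define B where "B p = Blinfun (G' p)" for p
  have B: "blinfun_apply (B p) = G' p" if "p \<in> W" for p
    unfolding B_def by (rule bounded_linear_Blinfun_apply[OF blG[OF that]])
  have Bcont: "continuous_on W B"
  proof (rule continuous_on_blinfun_componentwise)
    fix i :: "real \<times> (real^'m)"
    have "continuous_on W (\<lambda>p. G' p i)"
      unfolding G'_def F'_def
      by (intro continuous_intros smooth_on_imp_continuous_on smooth_on_directional F W)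
    then show "continuous_on W (\<lambda>p. blinfun_apply (B p) i)"
      by (rule continuous_on_eq) (simp add: B)
  qed
  have "inj (G' (0, y0))"
  proof -
    have "linear (G' (0, y0))" using blG[OF W(2)] bounded_linear.linear by blast
    moreover have "v = 0" if "G' (0, y0) v = 0" for v
      using that inj[of "snd v"] by (cases v) (auto simp: G'_def F'_def zero_prod_def)
    ultimately show ?thesis by (simp add: linear_injective_0)
  qed
  then obtain J where J: "linear J" "J \<circ> G' (0, y0) = id"
    using linear_injective_left_inverse[of "G' (0, y0)"] blG[OF W(2)] bounded_linear.linear by blast
  have "Blinfun J o\<^sub>L B (0, y0) = id_blinfun"
    using J(1) W(2) pointfree_idE[OF J(2)]
    by (intro blinfun_eqI)
       (simp only: B blinfun_apply_blinfun_compose id_blinfun.rep_eq id_apply linear_conv_bounded_linear bounded_linear_Blinfun_apply)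
  from inverse_function_theorem[OF W(1) _ Bcont W(2) this, of G]
  obtain U V g g' where U: "open U" "U \<subseteq> W" "(0, y0) \<in> U" and V: "open V" "G (0, y0) \<in> V"
    and hom: "homeomorphism U V G g" and g: "\<And>y. y \<in> V \<Longrightarrow> (g has_derivative g' y) (at y)"
    and bij: "\<And>y. y \<in> V \<Longrightarrow> bij (blinfun_apply (B (g y)))"
    using G' B by (metis (no_types, lifting))
  define y where "y e = snd (g (e, 0))" for e
  have gU: "g p \<in> U" "G (g p) = p" if "p \<in> V" for p using hom that unfolding homeomorphism_def by auto
  have Gg: "g (G p) = p" "G p \<in> V" if "p \<in> U" for p using hom that unfolding homeomorphism_def by auto
  have "G (0, y0) = (0, 0)" by (simp add: G_def F0)
  with V obtain r where r: "r > 0" "ball (0, 0) r \<subseteq> V" using open_contains_ball by metis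
  have inV: "(e, 0) \<in> V" if "\<bar>e\<bar> < r" for e
    using r(2) that by (auto simp: subset_eq dist_Pair_Pair dist_real_def)
  have gy: "g (e, 0) = (e, y e)" "F (e, y e) = 0" if "\<bar>e\<bar> < r" for e
  proof -
    have "fst (g (e, 0)) = e" "F (g (e, 0)) = 0" using gU(2)[OF inV[OF that]] by (auto simp: G_def)
    then show "g (e, 0) = (e, y e)" "F (e, y e) = 0"
      by (auto simp: y_def prod_eq_iff) (metis prod.collapse)
  qed
  have uniq: "z = y e" if "\<bar>e\<bar> < r" "(e, z) \<in> U" "F (e, z) = 0" for e z
    using Gg(1)[OF that(2)] that gy(1)[OF that(1)] by (simp add: G_def)
  define A :: "real \<times> (real^'m) \<Rightarrow> real^'m^'m" where "A p = (\<chi> i j. F' p (0, axis j 1) $ i)" for p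
  have A: "A p *v v = F' p (0, v)" if "p \<in> W" for p v
  proof -
    have lin: "linear (\<lambda>v. F' p (0, v))"
      using linear_compose[OF _ linF'[OF that], of "\<lambda>v. (0, v)"] by (auto simp: o_def linear_iff)
    have "matrix (\<lambda>v. F' p (0, v)) *v v = F' p (0, v)"
      using matrix_vector_mul(2)[OF lin] by (rule fun_cong)
    moreover have "matrix (\<lambda>v. F' p (0, v)) = A p" by (simp add: matrix_def A_def)
    ultimately show ?thesis by simp
  qed
  have smA: "smooth_on W (\<lambda>p. A p $ i $ j)" for i j
    unfolding A_def F'_def by (simp, intro smooth_on_nth smooth_on_directional F W)
  define W0 where "W0 = {p \<in> W. det (A p) \<noteq> 0}"
  have "open W0"
  proof -
    have "continuous_on W (\<lambda>p. det (A p))"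
      by (intro smooth_on_imp_continuous_on smooth_on_det smA W)
    then have "open (W \<inter> (\<lambda>p. det (A p)) -` (- {0}))"
      using W(1) by (intro continuous_open_preimage) auto
    moreover have "W0 = W \<inter> (\<lambda>p. det (A p)) -` (- {0})" by (auto simp: W0_def)
    ultimately show ?thesis by simp
  qed
  \<comment> \<open>Cramer's rule for \<open>A p *v z = - F' p (1, 0)\<close>, the equation that the
    derivative of the implicit function satisfies.\<close>
  define H :: "real \<times> (real^'m) \<Rightarrow> real^'m" where
    "H p = (\<chi> k. det (\<chi> i j. if j = k then (- F' p (1, 0)) $ i else A p $ i $ j) / det (A p))" for p
  have smH: "smooth_on W0 H"
  proof (rule smooth_on_vec)
    fix k
    have sub: "W0 \<subseteq> W" by (auto simp: W0_def)
    have "smooth_on W0 (\<lambda>p. if j = k then (- F' p (1, 0)) $ i else A p $ i $ j)" for i j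
    proof (cases "j = k")
      case True
      have "smooth_on W0 (\<lambda>p. (- F' p (1, 0)) $ i)"
        unfolding F'_def
        by (intro smooth_on_nth smooth_on_minus smooth_on_subset[OF smooth_on_directional[OF F W(1)] sub] \<open>open W0\<close>)
      with True show ?thesis by simp
    next
      case False
      with smooth_on_subset[OF smA sub] show ?thesis by simp
    qed
    then show "smooth_on W0 (\<lambda>x. H x $ k)"
      unfolding H_def vec_lambda_beta
      by (intro smooth_on_divide smooth_on_det \<open>open W0\<close> smooth_on_subset[OF smA sub])
         (auto simp: W0_def)
  qed (rule \<open>open W0\<close>)
  \<comment> \<open>The derivative of \<open>G\<close> stays bijective along the graph; restricted
    to vectors \<open>(0, v)\<close> it reduces to \<open>A\<close>, so the determinant in Cramer's
    rule is nonzero there.\<close>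
  have inW0: "(e, y e) \<in> W0" if "\<bar>e\<bar> < r" for e
  proof -
    have W: "(e, y e) \<in> W" using gU(1)[OF inV[OF that]] gy(1)[OF that] U(2) by auto
    have "inj (G' (e, y e))"
      using bij[OF inV[OF that]] gy(1)[OF that] B[OF W] by (simp add: bij_def)
    then have G0: "v = 0" if "G' (e, y e) (0, v) = 0" for v
      using that linear_injective_0[of "G' (e, y e)"] blG[OF W] bounded_linear.linear
      by (auto simp: zero_prod_def)
    have "v = 0" if "A (e, y e) *v v = 0" for v
      by (rule G0) (use that in \<open>simp add: A[OF W] G'_def zero_prod_def\<close>)
    then have "det (A (e, y e)) \<noteq> 0"
      by (metis invertible_det_nz invertible_left_inverse matrix_left_invertible_ker)
    with W show ?thesis by (simp add: W0_def)
  qed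
  have dy: "(y has_vector_derivative H (e, y e)) (at e)" if e: "e \<in> {-r<..<r}" for e
  proof -
    have er: "\<bar>e\<bar> < r" using e by auto
    have "((\<lambda>e. (e, 0 :: real^'m)) has_derivative (\<lambda>h. (h, 0))) (at e)"
      by (auto intro!: derivative_eq_intros)
    from diff_chain_at[OF this g[OF inV[OF er]]]
    have "((\<lambda>e. snd (g (e, 0))) has_derivative (\<lambda>h. snd (g' (e, 0) (h, 0)))) (at e)"
      by (auto simp: o_def intro: has_derivative_snd)
    then obtain y' where y': "(y has_derivative y') (at e)" unfolding y_def[symmetric] by blast
    have "((\<lambda>e. (e, y e)) has_derivative (\<lambda>h. (h, y' h))) (at e)"
      using y' by (auto intro!: derivative_eq_intros)
    from diff_chain_at[OF this F'] have "((\<lambda>e. F (e, y e)) has_derivative (\<lambda>h. F' (e, y e) (h, y' h))) (at e)"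
      using inW0[OF er] by (simp add: o_def W0_def)
    moreover have "((\<lambda>e. F (e, y e)) has_derivative (\<lambda>_. 0)) (at e)"
      by (rule has_derivative_transform_within_open[of "\<lambda>_. 0" _ _ _ "{-r<..<r}"]) (use e gy in auto)
    ultimately have "(\<lambda>h. F' (e, y e) (h, y' h)) = (\<lambda>_. 0)" by (rule has_derivative_unique)
    then have "F' (e, y e) (1, y' 1) = 0" by (rule fun_cong)
    moreover have "F' (e, y e) (1, y' 1) = F' (e, y e) (1, 0) + F' (e, y e) (0, y' 1)"
      using linear_add[OF linF', of "(e, y e)" "(1, 0)" "(0, y' 1)"] inW0[OF er] by (simp add: W0_def)
    ultimately have "A (e, y e) *v y' 1 = - F' (e, y e) (1, 0)"
      using A inW0[OF er] by (simp add: W0_def eq_neg_iff_add_eq_0 add_ac)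
    then have "y' 1 = H (e, y e)"
      using cramer[of "A (e, y e)"] inW0[OF er] by (simp add: W0_def H_def)
    moreover have "y' h = h *\<^sub>R y' 1" for h
      using linear_scale[OF has_derivative_linear[OF y'], of h 1] by simp
    then have "y' = (\<lambda>h. h *\<^sub>R y' 1)" by (rule ext)
    ultimately show ?thesis using y' unfolding has_vector_derivative_def by simp
  qed
  have smy: "smooth_on {-r<..<r} y"
    by (rule autonomous_ode_smooth[OF _ smH _ dy]) (use inW0 in auto)
  have y0: "y 0 = y0" using uniq[of 0 y0] U(3) F0 r(1) by auto
  show ?thesis by (rule that[of r U y, OF r(1) U(1,3) smy y0 gy(2) uniq])
qed

section \<open>Approximate diagonalization of smooth families of symmetric matrices\<close>

lemma smooth_on_matrix:
  fixes A :: "'a::euclidean_space \<Rightarrow> real^'n^'m"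
  assumes "\<And>i j. smooth_on S (\<lambda>x. A x $ i $ j)" "open S"
  shows "smooth_on S A"
  by (intro smooth_on_vec assms)

lemma smooth_on_entry:
  fixes A :: "'a::euclidean_space \<Rightarrow> real^'n^'m"
  assumes "smooth_on S A" "open S"
  shows "smooth_on S (\<lambda>x. A x $ i $ j)"
  by (intro smooth_on_nth assms)

lemma smooth_on_matrix_mult:
  fixes A :: "'a::euclidean_space \<Rightarrow> real^'n^'m" and B :: "'a \<Rightarrow> real^'k^'n"
  assumes "smooth_on S A" "smooth_on S B" "open S"
  shows "smooth_on S (\<lambda>x. A x ** B x)"
  by (rule smooth_on_matrix)
     (simp_all add: matrix_matrix_mult_def assms smooth_on_sum smooth_on_mult smooth_on_entry)

lemma smooth_on_transpose:
  fixes A :: "'a::euclidean_space \<Rightarrow> real^'n^'m"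
  assumes "smooth_on S A" "open S"
  shows "smooth_on S (\<lambda>x. transpose (A x))"
  by (rule smooth_on_matrix) (simp_all add: transpose_def assms smooth_on_entry)

definition block_matrix :: "('n \<Rightarrow> nat) \<Rightarrow> real^'n^'n \<Rightarrow> bool" where
  "block_matrix c M \<longleftrightarrow> (\<forall>i j. c i \<noteq> c j \<longrightarrow> M $ i $ j = 0)"

lemma block_matrixD: "block_matrix c M \<Longrightarrow> c i \<noteq> c j \<Longrightarrow> M $ i $ j = 0"
  by (simp add: block_matrix_def)

lemma block_matrix_transpose: "block_matrix c M \<Longrightarrow> block_matrix c (transpose M)"
  by (simp add: block_matrix_def transpose_def)

lemma block_matrix_mult:
  assumes "block_matrix c M" "block_matrix c N"
  shows "block_matrix c (M ** N)"
  unfolding block_matrix_def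
proof (intro allI impI)
  fix i j assume "c i \<noteq> c j"
  then have "M $ i $ k * N $ k $ j = 0" for k
    using assms unfolding block_matrix_def by (cases "c i = c k") auto
  then show "(M ** N) $ i $ j = 0" unfolding matrix_matrix_mult_def vec_lambda_beta by (intro sum.neutral ballI)
qed

lemma symmetric_conjugate:
  fixes A P :: "real^'n^'n"
  shows "transpose A = A \<Longrightarrow> transpose (transpose P ** A ** P) = transpose P ** A ** P"
  by (simp add: matrix_transpose_mul matrix_mul_assoc)

lemma symmetric_entry: "transpose A = A \<Longrightarrow> A $ i $ j = A $ j $ i"
  by (metis (no_types, lifting) transpose_def vec_lambda_beta)

lemma conjugate_entry:
  fixes A P :: "real^'n^'n"
  shows "(transpose P ** A ** P) $ i $ j = (\<Sum>k\<in>UNIV. \<Sum>l\<in>UNIV. P $ k $ i * A $ k $ l * P $ l $ j)"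
proof -
  have "(transpose P ** A ** P) $ i $ j = (\<Sum>l\<in>UNIV. \<Sum>k\<in>UNIV. P $ k $ i * A $ k $ l * P $ l $ j)"
    by (simp add: matrix_matrix_mult_def transpose_def sum_distrib_right)
  also have "\<dots> = (\<Sum>k\<in>UNIV. \<Sum>l\<in>UNIV. P $ k $ i * A $ k $ l * P $ l $ j)"
    by (rule sum.swap)
  finally show ?thesis .
qed

lemma conjugate_entry_column:
  fixes A P :: "real^'n^'n"
  shows "(transpose P ** A ** P) $ i $ j = column i P \<bullet> (A *v column j P)"
  unfolding conjugate_entry
  by (simp add: inner_vec_def matrix_vector_mult_def column_def sum_distrib_left mult.assoc)

text \<open>Maximizing \<open>tr (W P\<^sup>T S P)\<close> over the compact set of orthogonal block matrices, with distinct
  weights in the diagonal matrix \<open>W\<close>: plane rotations are admissible variations, and their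
  derivative at a maximum kills the off-diagonal entries.\<close>

lemma block_orthogonal_diagonalization:
  fixes S :: "real^'n^'n"
  assumes sym: "transpose S = S" and blk: "block_matrix c S"
  obtains P where "orthogonal_matrix P" "block_matrix c P"
    "\<And>i j. i \<noteq> j \<Longrightarrow> (transpose P ** S ** P) $ i $ j = 0"
proof -
  obtain w0 :: "'n \<Rightarrow> nat" where w0: "inj w0"
    using finite_imp_inj_to_nat_seg[of "UNIV :: 'n set"] by auto
  define w where "w i = real (w0 i)" for i
  have w: "w i \<noteq> w j" if "i \<noteq> j" for i j using w0 that by (auto simp: w_def inj_def)
  define K where "K = {P :: real^'n^'n. orthogonal_matrix P \<and> block_matrix c P}"
  define f where "f P = (\<Sum>l\<in>UNIV. w l * (transpose P ** S ** P) $ l $ l)" for P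
  have "bounded K"
    unfolding bounded_iff
  proof (intro exI ballI)
    fix P assume "P \<in> K"
    then have "norm (row i P) = 1" for i using orthogonal_matrix_orthonormal_rows[of P] by (auto simp: K_def)
    then have "norm (P $ i) = 1" for i by (simp add: row_def)
    then show "norm P \<le> (\<Sum>i\<in>(UNIV::'n set). 1)"
      using L2_set_le_sum[of UNIV "\<lambda>i. norm (P $ i)"] by (simp add: norm_vec_def)
  qed
  moreover have "closed K"
  proof -
    have c1: "closed {P :: real^'n^'n. (transpose P ** P) $ i $ j = mat 1 $ i $ j}" for i j
      unfolding matrix_matrix_mult_def transpose_def by (simp, intro closed_Collect_eq continuous_intros)
    have c2: "closed {P :: real^'n^'n. c i \<noteq> c j \<longrightarrow> P $ i $ j = 0}" for i j
      by (cases "c i = c j") (auto intro!: closed_Collect_eq continuous_intros)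
    have "K = (\<Inter>i j. {P. (transpose P ** P) $ i $ j = mat 1 $ i $ j}) \<inter> (\<Inter>i j. {P. c i \<noteq> c j \<longrightarrow> P $ i $ j = 0})"
      by (auto simp: K_def orthogonal_matrix block_matrix_def vec_eq_iff)
    also have "closed \<dots>" by (intro closed_Int closed_INT ballI c1 c2)
    finally show ?thesis .
  qed
  ultimately have "compact K" by (simp add: compact_eq_bounded_closed)
  moreover have "mat 1 \<in> K"
    unfolding K_def by (simp add: orthogonal_matrix_id) (auto simp: block_matrix_def mat_def)
  moreover have "continuous_on K f"
    unfolding f_def conjugate_entry by (intro continuous_intros)
  ultimately obtain P where P: "P \<in> K" "\<And>P'. P' \<in> K \<Longrightarrow> f P' \<le> f P"
    using continuous_attains_sup[of K f] by blast
  have oP: "orthogonal_matrix P" and bP: "block_matrix c P" using P(1) by (auto simp: K_def)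
  define p where "p l = column l P" for l
  have pp: "p l \<bullet> p m = (if l = m then 1 else 0)" for l m
    using oP unfolding orthogonal_matrix_orthonormal_columns p_def
    by (auto simp: orthogonal_def norm_eq_1)
  define q where "q x y = x \<bullet> (S *v y)" for x y
  have qsym: "q x y = q y x" for x y
    unfolding q_def by (metis dot_lmul_matrix inner_commute sym transpose_matrix_vector)
  have qadd: "q (a *\<^sub>R x + b *\<^sub>R y) (a *\<^sub>R x + b *\<^sub>R y) = a\<^sup>2 * q x x + 2 * a * b * q x y + b\<^sup>2 * q y y" for a b x y
  proof -
    have "q (a *\<^sub>R x + b *\<^sub>R y) (a *\<^sub>R x + b *\<^sub>R y) = a\<^sup>2 * q x x + a * b * q x y + a * b * q y x + b\<^sup>2 * q y y"
      by (simp add: q_def matrix_vector_right_distrib inner_add_left inner_add_right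
            matrix_vector_mult_scaleR power2_eq_square algebra_simps)
    then show ?thesis by (simp add: qsym[of y x])
  qed
  have "(transpose P ** S ** P) $ i $ j = 0" if ij: "i \<noteq> j" for i j
  proof (cases "c i = c j")
    case False
    then show ?thesis
      by (intro block_matrixD[where c = c] block_matrix_mult block_matrix_transpose bP blk)
  next
    case True
    \<comment> \<open>\<open>R t\<close> rotates the columns \<open>i\<close> and \<open>j\<close>
      of \<open>P\<close> in their plane. Both belong to the same block, so \<open>R t\<close> is
      again an admissible competitor, and \<open>R 0 = P\<close>.\<close>
    define R where "R t = (\<chi> k l. if l = i then cos t * P $ k $ i + sin t * P $ k $ j
        else if l = j then - sin t * P $ k $ i + cos t * P $ k $ j else P $ k $ l)" for t :: real
    define r where "r t l = (if l = i then cos t *\<^sub>R p i + sin t *\<^sub>R p j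
        else if l = j then (- sin t) *\<^sub>R p i + cos t *\<^sub>R p j else p l)" for t l
    have colR: "column l (R t) = r t l" for t l
      by (auto simp: R_def r_def p_def column_def vec_eq_iff)
    have "r t l \<bullet> r t m = (if l = m then 1 else 0)" for t l m
      using ij sin_cos_squared_add3[of t]
      by (auto simp: r_def inner_add_left inner_add_right pp algebra_simps)
    then have "orthogonal_matrix (R t)" for t
      unfolding orthogonal_matrix_orthonormal_columns colR by (auto simp: orthogonal_def norm_eq_1)
    moreover have "block_matrix c (R t)" for t
      using bP True by (auto simp: block_matrix_def R_def)
    ultimately have RK: "R t \<in> K" for t by (simp add: K_def)
    define const where "const = (\<Sum>l\<in>UNIV - {i} - {j}. w l * q (p l) (p l))"
    define h where "h t = w i * ((cos t)\<^sup>2 * q (p i) (p i) + 2 * cos t * sin t * q (p i) (p j) + (sin t)\<^sup>2 * q (p j) (p j))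
        + w j * ((- sin t)\<^sup>2 * q (p i) (p i) + 2 * (- sin t) * cos t * q (p i) (p j) + (cos t)\<^sup>2 * q (p j) (p j)) + const" for t
    have fR: "f (R t) = h t" for t
    proof -
      have "f (R t) = (\<Sum>l\<in>UNIV. w l * q (r t l) (r t l))"
        by (simp add: f_def conjugate_entry_column colR q_def)
      also have "\<dots> = w i * q (r t i) (r t i) + (\<Sum>l\<in>UNIV - {i}. w l * q (r t l) (r t l))"
        by (rule sum.remove) auto
      also have "(\<Sum>l\<in>UNIV - {i}. w l * q (r t l) (r t l)) = w j * q (r t j) (r t j) + (\<Sum>l\<in>UNIV - {i} - {j}. w l * q (r t l) (r t l))"
        by (rule sum.remove) (use ij in auto)
      also have "(\<Sum>l\<in>UNIV - {i} - {j}. w l * q (r t l) (r t l)) = const"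
        unfolding const_def by (rule sum.cong) (auto simp: r_def)
      finally have "f (R t) = w i * q (r t i) (r t i) + (w j * q (r t j) (r t j) + const)" .
      moreover have "r t i = cos t *\<^sub>R p i + sin t *\<^sub>R p j" "r t j = (- sin t) *\<^sub>R p i + cos t *\<^sub>R p j"
        using ij by (simp_all add: r_def)
      ultimately show ?thesis unfolding h_def by (simp only: qadd add.assoc)
    qed
    have "R 0 = P" using ij by (auto simp: R_def vec_eq_iff)
    then have "h y \<le> h 0" for y using P(2)[OF RK, of y] fR by metis
    moreover have "(h has_real_derivative 2 * (w i - w j) * q (p i) (p j)) (at 0)"
      unfolding h_def by (auto intro!: derivative_eq_intros simp: algebra_simps)
    ultimately have "2 * (w i - w j) * q (p i) (p j) = 0"
      by (intro DERIV_local_max[of h _ 0 1]) auto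
    then have "q (p i) (p j) = 0" using w[OF ij] by simp
    then show ?thesis by (simp add: conjugate_entry_column p_def q_def)
  qed
  with oP bP show ?thesis by (rule that)
qed


text \<open>If all diagonal entries in block \<open>b\<close> were equal, conjugating back with
  \<open>P\<close>, which respects the blocks, would make that block of \<open>S\<close>
  scalar.\<close>

lemma block_split_scalar:
  fixes S P :: "real^'n^'n"
  assumes P: "orthogonal_matrix P" "block_matrix c P"
    and diag: "\<And>i j. i \<noteq> j \<Longrightarrow> (transpose P ** S ** P) $ i $ j = 0"
    and nonscalar: "\<not> (\<exists>a. \<forall>i j. c i = b \<longrightarrow> c j = b \<longrightarrow> S $ i $ j = (if i = j then a else 0))"
  obtains i0 i1 where "c i0 = b" "c i1 = b"
    "(transpose P ** S ** P) $ i0 $ i0 \<noteq> (transpose P ** S ** P) $ i1 $ i1"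
proof (rule ccontr)
  let ?D = "transpose P ** S ** P"
  assume contr: "\<not> thesis"
  obtain i0 where i0: "c i0 = b" using nonscalar by blast
  have D: "?D $ k $ l = (if k = l then ?D $ i0 $ i0 else 0)" if "c k = b" for k l
    using contr that i0 \<open>\<And>i1 i0. c i0 = b \<Longrightarrow> c i1 = b \<Longrightarrow> ?D $ i0 $ i0 \<noteq> ?D $ i1 $ i1 \<Longrightarrow> thesis\<close> diag by metis
  have PP: "P ** transpose P = mat 1" using P(1) by (simp add: orthogonal_matrix_def)
  then have "P ** ?D ** transpose P = S"
    by (metis matrix_mul_assoc matrix_mul_lid matrix_mul_rid)
  moreover have "transpose P $ k $ l = P $ l $ k" for k l by (simp add: transpose_def)
  ultimately have S: "S $ i $ j = (\<Sum>k\<in>UNIV. \<Sum>l\<in>UNIV. P $ i $ k * ?D $ k $ l * P $ j $ l)" for i j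
    using conjugate_entry[of "transpose P" ?D i j] by (simp only: transpose_transpose)
  have "S $ i $ j = (if i = j then ?D $ i0 $ i0 else 0)" if "c i = b" for i j
  proof -
    have "P $ i $ k * ?D $ k $ l * P $ j $ l = ?D $ i0 $ i0 * (if k = l then P $ i $ k * P $ j $ l else 0)" for k l
    proof (cases "c i = c k")
      case True
      with D[of k l] that show ?thesis by simp
    next
      case False
      then show ?thesis using block_matrixD[OF P(2)] by auto
    qed
    then have "S $ i $ j = (\<Sum>k\<in>UNIV. \<Sum>l\<in>UNIV. ?D $ i0 $ i0 * (if k = l then P $ i $ k * P $ j $ l else 0))"
      unfolding S by simp
    also have "\<dots> = ?D $ i0 $ i0 * (P ** transpose P) $ i $ j"
      by (simp add: sum_distrib_left[symmetric] matrix_matrix_mult_def transpose_def)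
    finally show ?thesis by (simp add: PP mat_def)
  qed
  with nonscalar show False by blast
qed

text \<open>The unknown of the implicit function theorem is an arbitrary matrix \<open>P\<close>. Within each block of
  \<open>c\<close>, the symmetric part of the equation says that \<open>P\<close> is orthogonal; its skew part says that \<open>P\<close> is
  symmetric within the blocks of \<open>c'\<close> and that \<open>P\<^sup>T B P\<close> vanishes between them.\<close>

definition split_system ::
    "('n \<Rightarrow> nat) \<Rightarrow> ('n \<Rightarrow> nat) \<Rightarrow> (real \<Rightarrow> real^'n^'n) \<Rightarrow> real \<times> (real^('n \<times> 'n)) \<Rightarrow> real^('n \<times> 'n)" where
  "split_system c c' B ep = (\<chi> ij. case ij of (i, j) \<Rightarrow>
     if c i \<noteq> c j then snd ep $ (i, j)
     else (\<Sum>k\<in>UNIV. snd ep $ (k, i) * snd ep $ (k, j)) - (if i = j then 1 else 0) +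
       (if c' i = c' j then snd ep $ (i, j) - snd ep $ (j, i)
        else (if c' i < c' j then 1 else - 1) *
          (\<Sum>k\<in>UNIV. \<Sum>l\<in>UNIV. snd ep $ (k, i) * B (fst ep) $ k $ l * snd ep $ (l, j))))"

lemma split_system_smooth:
  fixes B :: "real \<Rightarrow> real^'n^'n"
  assumes B: "smooth_on T B" "open T"
  shows "smooth_on (T \<times> UNIV) (split_system c c' B)"
proof (rule smooth_on_vec)
  have op: "open (T \<times> (UNIV :: (real^('n \<times> 'n)) set))" using B(2) by (intro open_Times) auto
  have B': "smooth_on (T \<times> (UNIV :: (real^('n \<times> 'n)) set)) (\<lambda>ep. B (fst ep) $ k $ l)" for k l
    by (rule smooth_on_compose[OF smooth_on_entry[OF B]]) (auto intro!: smooth_on_fst op)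
  have P': "smooth_on (T \<times> (UNIV :: (real^('n \<times> 'n)) set)) (\<lambda>ep. snd ep $ ij)" for ij
    by (intro smooth_on_nth smooth_on_snd smooth_on_id op)
  fix ij :: "'n \<times> 'n"
  obtain i j where ij: "ij = (i, j)" by (cases ij)
  show "smooth_on (T \<times> UNIV) (\<lambda>ep. split_system c c' B ep $ ij)"
  proof (cases "c i = c j")
    case False
    then show ?thesis by (simp add: split_system_def ij P')
  next
    case True
    let ?K = "\<lambda>ep. if c' i = c' j then snd ep $ (i, j) - snd ep $ (j, i)
        else (if c' i < c' j then 1 else - 1) *
          (\<Sum>k\<in>UNIV. \<Sum>l\<in>UNIV. snd ep $ (k, i) * B (fst ep) $ k $ l * snd ep $ (l, j))"
    have "smooth_on (T \<times> UNIV) ?K"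
    proof (cases "c' i = c' j")
      case True
      have "smooth_on (T \<times> (UNIV :: (real^('n \<times> 'n)) set)) (\<lambda>ep. snd ep $ (i, j) - snd ep $ (j, i))"
        by (intro smooth_on_diff op P')
      with True show ?thesis by simp
    next
      case False
      have "smooth_on (T \<times> (UNIV :: (real^('n \<times> 'n)) set)) (\<lambda>ep. (if c' i < c' j then 1 else - 1) *
          (\<Sum>k\<in>UNIV. \<Sum>l\<in>UNIV. snd ep $ (k, i) * B (fst ep) $ k $ l * snd ep $ (l, j)))"
        by (intro smooth_on_sum smooth_on_mult smooth_on_const op B' P')
      with False show ?thesis by simp
    qed
    then have "smooth_on (T \<times> (UNIV :: (real^('n \<times> 'n)) set))
        (\<lambda>ep. (\<Sum>k\<in>UNIV. snd ep $ (k, i) * snd ep $ (k, j)) - (if i = j then 1 else 0) + ?K ep)"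
      by (intro smooth_on_add smooth_on_diff smooth_on_sum smooth_on_mult smooth_on_const op P')
    with True show ?thesis by (simp add: split_system_def ij)
  qed
qed (use B(2) in \<open>auto intro!: open_Times\<close>)

text \<open>\<open>L i j\<close> is the derivative at the identity of component
  \<open>(i, j)\<close> in direction \<open>v\<close>; it is simple because \<open>B 0\<close> is
  diagonal. Combining \<open>L i j\<close> with \<open>L j i\<close> separates the symmetric from
  the skew part. Across two pieces of one block what remains is a pair of equations for
  \<open>v $ (i, j)\<close> and \<open>v $ (j, i)\<close> whose determinant is a difference of
  distinct diagonal entries.\<close>

lemma split_system_derivative_injective:
  fixes B :: "real \<Rightarrow> real^'n^'n"
  assumes B: "smooth_on T B" "open T" "0 \<in> T"
    and D: "\<And>i j. i \<noteq> j \<Longrightarrow> B 0 $ i $ j = 0"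
    and c': "\<And>i j. c i = c j \<Longrightarrow> c' i \<noteq> c' j \<Longrightarrow> B 0 $ i $ i \<noteq> B 0 $ j $ j"
    and v: "frechet_derivative (split_system c c' B) (at (0, \<chi> ij. if fst ij = snd ij then 1 else 0)) (0, v) = 0"
  shows "v = 0"
proof -
  let ?F = "split_system c c' B" and ?p0 = "(\<chi> ij. if fst ij = snd ij then 1 else 0) :: real^('n \<times> 'n)"
  define L :: "'n \<Rightarrow> 'n \<Rightarrow> real" where "L i j = (if c i \<noteq> c j then v $ (i, j)
     else v $ (i, j) + v $ (j, i) + (if c' i = c' j then v $ (i, j) - v $ (j, i)
        else (if c' i < c' j then 1 else - 1) * (B 0 $ i $ i * v $ (i, j) + B 0 $ j $ j * v $ (j, i))))" for i j
  have L0: "L i j = 0" for i j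
  proof -
    have "?F differentiable (at ((0, ?p0) + 0 *\<^sub>R (0, v)))"
      by (rule smooth_onD(1)[OF split_system_smooth[OF B(1,2)]]) (use B in auto)
    from has_derivative_along_line[OF this]
    have "((\<lambda>s. ?F ((0, ?p0) + s *\<^sub>R (0, v))) has_vector_derivative 0) (at 0)" using v by simp
    then have "((\<lambda>s. ?F ((0, ?p0) + s *\<^sub>R (0, v)) $ (i, j)) has_vector_derivative 0 $ (i, j)) (at 0)"
      by (rule bounded_linear.has_vector_derivative[OF bounded_linear_vec_nth])
    then have 1: "((\<lambda>s. ?F (0, ?p0 + s *\<^sub>R v) $ (i, j)) has_real_derivative 0) (at 0)"
      by (simp add: has_real_derivative_iff_has_vector_derivative)
    have Bkl: "B 0 $ k $ l = (if k = l then B 0 $ k $ k else 0)" for k l using D[of k l] by auto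
    have "((\<lambda>s. ?F (0, ?p0 + s *\<^sub>R v) $ (i, j)) has_real_derivative L i j) (at 0)"
    proof (cases "c i = c j")
      case False
      then show ?thesis
        by (auto simp: split_system_def L_def intro!: derivative_eq_intros)
    next
      case True
      have 2: "((\<lambda>s. \<Sum>k\<in>UNIV. (?p0 + s *\<^sub>R v) $ (k, i) * (?p0 + s *\<^sub>R v) $ (k, j)) has_real_derivative
          (v $ (i, j) + v $ (j, i))) (at 0)"
      proof -
        have "((\<lambda>s. \<Sum>k\<in>UNIV. ((if k = i then 1 else 0) + s * v $ (k, i)) * ((if k = j then 1 else 0) + s * v $ (k, j))) has_real_derivative
          (\<Sum>k\<in>UNIV. v $ (k, i) * (if k = j then 1 else 0) + (if k = i then 1 else 0) * v $ (k, j))) (at 0)"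
          by (rule DERIV_sum) (auto intro!: derivative_eq_intros)
        moreover have "(\<Sum>k\<in>UNIV. v $ (k, i) * (if k = j then 1 else 0) + (if k = i then 1 else 0) * v $ (k, j)) = v $ (i, j) + v $ (j, i)"
          by (simp add: sum.distrib if_distrib[of "\<lambda>x. _ * x"] if_distrib[of "\<lambda>x. x * _"] cong: if_cong)
        ultimately show ?thesis by simp
      qed
      have 3: "((\<lambda>s. \<Sum>k\<in>UNIV. \<Sum>l\<in>UNIV. (?p0 + s *\<^sub>R v) $ (k, i) * B 0 $ k $ l * (?p0 + s *\<^sub>R v) $ (l, j)) has_real_derivative
          (B 0 $ i $ i * v $ (i, j) + B 0 $ j $ j * v $ (j, i))) (at 0)"
      proof -
        have "((\<lambda>s. \<Sum>k\<in>UNIV. ((if k = i then 1 else 0) + s * v $ (k, i)) * B 0 $ k $ k * ((if k = j then 1 else 0) + s * v $ (k, j))) has_real_derivative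
          (\<Sum>k\<in>UNIV. v $ (k, i) * B 0 $ k $ k * (if k = j then 1 else 0) + (if k = i then 1 else 0) * B 0 $ k $ k * v $ (k, j))) (at 0)"
          by (rule DERIV_sum) (auto intro!: derivative_eq_intros)
        moreover have "(\<Sum>k\<in>UNIV. v $ (k, i) * B 0 $ k $ k * (if k = j then 1 else 0) + (if k = i then 1 else 0) * B 0 $ k $ k * v $ (k, j))
            = B 0 $ i $ i * v $ (i, j) + B 0 $ j $ j * v $ (j, i)"
          by (simp add: sum.distrib if_distrib[of "\<lambda>x. _ * x"] if_distrib[of "\<lambda>x. x * _"] mult.commute cong: if_cong)
        moreover have "(\<Sum>l\<in>UNIV. (?p0 + s *\<^sub>R v) $ (k, i) * B 0 $ k $ l * (?p0 + s *\<^sub>R v) $ (l, j))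
            = ((if k = i then 1 else 0) + s * v $ (k, i)) * B 0 $ k $ k * ((if k = j then 1 else 0) + s * v $ (k, j))" for k s
          by (subst Bkl) (simp add: if_distrib[of "\<lambda>x. _ * x"] if_distrib[of "\<lambda>x. x * _"] cong: if_cong)
        ultimately show ?thesis by simp
      qed
      have 4: "((\<lambda>s. (?p0 + s *\<^sub>R v) $ (i, j) - (?p0 + s *\<^sub>R v) $ (j, i)) has_real_derivative v $ (i, j) - v $ (j, i)) (at 0)"
        by (auto intro!: derivative_eq_intros)
      show ?thesis
      proof (cases "c' i = c' j")
        case c: True
        show ?thesis
          using DERIV_add[OF DERIV_diff[OF 2 DERIV_const[of "if i = j then 1 else 0"]] 4] True c
          by (simp add: split_system_def L_def)
      next
        case c: False
        show ?thesis
          using DERIV_add[OF DERIV_diff[OF 2 DERIV_const[of "if i = j then 1 else 0"]] DERIV_cmult[OF 3, of "if c' i < c' j then 1 else - 1"]] True c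
          by (simp add: split_system_def L_def)
      qed
    qed
    from DERIV_unique[OF this 1] show ?thesis .
  qed
  have "v $ (i, j) = 0" for i j
  proof (cases "c i = c j")
    case False
    then show ?thesis using L0[of i j] by (simp add: L_def)
  next
    case c: True
    show ?thesis
    proof (cases "c' i = c' j")
      case True
      then show ?thesis using L0[of i j] c by (simp add: L_def)
    next
      case False
      have "v $ (i, j) + v $ (j, i) = 0 \<and> B 0 $ i $ i * v $ (i, j) + B 0 $ j $ j * v $ (j, i) = 0"
        using L0[of i j] L0[of j i] c False by (cases "c' i < c' j") (auto simp: L_def)
      moreover from this have "v $ (j, i) = - v $ (i, j)" by simp
      ultimately have "(B 0 $ i $ i - B 0 $ j $ j) * v $ (i, j) = 0"
        by (simp add: left_diff_distrib)
      with c'[OF c False] show ?thesis by simp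
    qed
  qed
  then show ?thesis by (simp add: vec_eq_iff)
qed

text \<open>\<open>S\<close> is symmetric and \<open>K\<close> is skew, so if their sum vanishes at
  \<open>(i, j)\<close> and at \<open>(j, i)\<close>, both vanish. The sign that depends on the
  order of \<open>c' i\<close> and \<open>c' j\<close> is what turns the symmetric matrix
  \<open>transpose P ** B e ** P\<close> into a skew contribution.\<close>

lemma split_system_solution:
  fixes B :: "real \<Rightarrow> real^'n^'n" and P :: "real^'n^'n"
  assumes sym: "transpose (B e) = B e"
    and c': "\<And>i j. c' i = c' j \<Longrightarrow> c i = c j"
    and F: "split_system c c' B (e, \<chi> ij. P $ fst ij $ snd ij) = 0"
  shows "orthogonal_matrix P" "block_matrix c P"
    "\<And>i j. c i = c j \<Longrightarrow> c' i \<noteq> c' j \<Longrightarrow> (transpose P ** B e ** P) $ i $ j = 0"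
proof -
  have Fij: "split_system c c' B (e, \<chi> ij. P $ fst ij $ snd ij) $ (i, j) = 0" for i j by (simp add: F)
  show blk: "block_matrix c P"
    unfolding block_matrix_def
  proof (intro allI impI)
    show "P $ i $ j = 0" if "c i \<noteq> c j" for i j
      using Fij[of i j] that by (simp add: split_system_def)
  qed
  define S where "S i j = (transpose P ** P) $ i $ j - mat 1 $ i $ j" for i j
  define K where "K i j = (if c' i = c' j then P $ i $ j - P $ j $ i
        else (if c' i < c' j then 1 else - 1) * (transpose P ** B e ** P) $ i $ j)" for i j
  have S_sym: "S j i = S i j" for i j
    by (simp add: S_def matrix_matrix_mult_def transpose_def mat_def mult.commute)
  have K_skew: "K j i = - K i j" for i j
    using symmetric_entry[OF symmetric_conjugate[OF sym], of P i j] by (auto simp: K_def)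
  have SK: "S i j + K i j = 0" if "c i = c j" for i j
  proof -
    have "S i j = (\<Sum>k\<in>UNIV. P $ k $ i * P $ k $ j) - (if i = j then 1 else 0)"
      by (simp add: S_def matrix_matrix_mult_def transpose_def mat_def)
    moreover have "K i j = (if c' i = c' j then P $ i $ j - P $ j $ i
        else (if c' i < c' j then 1 else - 1) * (\<Sum>k\<in>UNIV. \<Sum>l\<in>UNIV. P $ k $ i * B e $ k $ l * P $ l $ j))"
      by (simp add: K_def conjugate_entry)
    ultimately show ?thesis
      using Fij[of i j] that unfolding split_system_def by (cases "c' i = c' j") auto
  qed
  have SK0: "S i j = 0" "K i j = 0" if "c i = c j" for i j
    using SK[OF that] SK[OF that[symmetric]] S_sym[of i j] K_skew[of i j] by auto
  have "transpose P ** P = mat 1"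
  proof -
    have "(transpose P ** P) $ i $ j = mat 1 $ i $ j" for i j
    proof (cases "c i = c j")
      case True
      then show ?thesis using SK0(1)[of i j] by (simp add: S_def)
    next
      case False
      then show ?thesis
        using block_matrixD[OF block_matrix_mult[OF block_matrix_transpose[OF blk] blk] False]
        by (auto simp: mat_def)
    qed
    then show ?thesis by (simp add: vec_eq_iff)
  qed
  then show "orthogonal_matrix P" by (simp add: orthogonal_matrix)
  show "(transpose P ** B e ** P) $ i $ j = 0" if "c i = c j" "c' i \<noteq> c' j" for i j
    using SK0(2)[OF that(1)] that by (auto simp: K_def split: if_splits)
qed

text \<open>After a constant rotation \<open>P0\<close> the matrix \<open>B 0\<close> is diagonal,
  so the identity solves the split system at parameter 0 and the implicit function theorem continues
  it. Two distinct eigenvalues in block \<open>b\<close> provide the finer colouring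
  \<open>c'\<close>.\<close>

lemma smooth_block_split:
  fixes B :: "real \<Rightarrow> real^'n^'n"
  assumes s: "s > 0" and B: "smooth_on {-s<..<s} B" and sym: "\<And>e. \<bar>e\<bar> < s \<Longrightarrow> transpose (B e) = B e"
    and blk: "block_matrix c (B 0)"
    and nonscalar: "\<not> (\<exists>a. \<forall>i j. c i = b \<longrightarrow> c j = b \<longrightarrow> B 0 $ i $ j = (if i = j then a else 0))"
  obtains t P and c' :: "'n \<Rightarrow> nat" where "0 < t" "t \<le> s" "smooth_on {-t<..<t} P" "\<And>e. \<bar>e\<bar> < t \<Longrightarrow> orthogonal_matrix (P e)"
    "\<And>e. \<bar>e\<bar> < t \<Longrightarrow> block_matrix c (P e)" "card (range c) < card (range c')"
    "\<And>i j. c i = c j \<Longrightarrow> c' i \<noteq> c' j \<Longrightarrow> c i = b"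
    "\<And>e i j. \<bar>e\<bar> < t \<Longrightarrow> c i = c j \<Longrightarrow> c' i \<noteq> c' j \<Longrightarrow> (transpose (P e) ** B e ** P e) $ i $ j = 0"
proof -
  obtain P0 where P0: "orthogonal_matrix P0" "block_matrix c P0"
    "\<And>i j. i \<noteq> j \<Longrightarrow> (transpose P0 ** B 0 ** P0) $ i $ j = 0"
    using block_orthogonal_diagonalization[OF sym[of 0] blk] s by auto
  define B1 where "B1 e = transpose P0 ** B e ** P0" for e
  obtain i0 i1 where i01: "c i0 = b" "c i1 = b" "B1 0 $ i0 $ i0 \<noteq> B1 0 $ i1 $ i1"
    using block_split_scalar[OF P0 nonscalar] unfolding B1_def by blast
  \<comment> \<open>A colour that \<open>c\<close> does not use.\<close>
  define m where "m = Suc (Max (range c))"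
  have m: "c i < m" for i unfolding m_def by (simp add: less_Suc_eq_le)
  \<comment> \<open>Only two groups are separated: the indices of block \<open>b\<close> with the
    eigenvalue at \<open>i0\<close> get the new colour, the others keep \<open>b\<close>. The index
    \<open>i1\<close> keeps \<open>b\<close> in use, so the number of colours grows.\<close>
  define c' where "c' i = (if c i = b \<and> B1 0 $ i $ i = B1 0 $ i0 $ i0 then m else c i)" for i
  have cc': "c i = c j" if "c' i = c' j" for i j
    using that m[of i] m[of j] by (auto simp: c'_def split: if_splits)
  have c'D: "c i = b \<and> B1 0 $ i $ i \<noteq> B1 0 $ j $ j" if "c i = c j" "c' i \<noteq> c' j" for i j
    using that by (auto simp: c'_def split: if_splits)
  have "range c \<subset> range c'"
  proof
    show "range c \<subseteq> range c'"
    proof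
      fix x assume "x \<in> range c"
      then obtain i where i: "x = c i" by auto
      show "x \<in> range c'"
      proof (cases "c i = b")
        case True
        then have "x = c' i1" using i i01 by (simp add: c'_def)
        then show ?thesis by simp
      next
        case False
        then have "x = c' i" using i by (simp add: c'_def)
        then show ?thesis by simp
      qed
    qed
    have "m \<in> range c'" using i01 by (auto simp: c'_def image_iff intro!: exI[of _ i0])
    moreover have "m \<notin> range c" using m by (metis imageE less_irrefl)
    ultimately show "range c \<noteq> range c'" by auto
  qed
  then have card: "card (range c) < card (range c')" by (simp add: psubset_card_mono)
  let ?T = "{-s<..<s}" and ?p0 = "(\<chi> ij. if fst ij = snd ij then 1 else 0) :: real^('n \<times> 'n)"
  have B1: "smooth_on ?T B1"
    unfolding B1_def by (intro smooth_on_matrix_mult B smooth_on_const) auto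
  have B1sym: "transpose (B1 e) = B1 e" if "\<bar>e\<bar> < s" for e
    unfolding B1_def by (rule symmetric_conjugate[OF sym[OF that]])
  have F0: "split_system c c' B1 (0, ?p0) = 0"
  proof -
    have "B1 0 $ k $ l = (if k = l then B1 0 $ k $ k else 0)" for k l
      using P0(3)[of k l] by (simp add: B1_def)
    then have "(\<Sum>l\<in>UNIV. (if k = i then 1 else 0) * B1 0 $ k $ l * (if l = j then 1 else 0)) = 0" if "i \<noteq> j" for i j k
      using that by (intro sum.neutral) auto
    then have "split_system c c' B1 (0, ?p0) $ (i, j) = 0" for i j
      by (simp add: split_system_def if_distrib[of "\<lambda>x. x * _"] cong: if_cong)
    then show ?thesis by (simp add: vec_eq_iff)
  qed
  have inj: "v = 0" if "frechet_derivative (split_system c c' B1) (at (0, ?p0)) (0, v) = 0" for v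
    by (rule split_system_derivative_injective[OF B1 _ _ _ _ that]) (use s P0(3) c'D in \<open>auto simp: B1_def\<close>)
  have W: "open (?T \<times> (UNIV :: (real^('n \<times> 'n)) set))" "(0, ?p0) \<in> ?T \<times> UNIV"
    using s by (auto intro: open_Times)
  have smooth: "smooth_on (?T \<times> UNIV) (split_system c c' B1)" by (intro split_system_smooth B1) auto
  obtain r U y where ry: "r > 0" "smooth_on {-r<..<r} y" "y 0 = ?p0"
      "\<And>e. \<bar>e\<bar> < r \<Longrightarrow> split_system c c' B1 (e, y e) = 0"
    by (rule smooth_implicit_function[OF W smooth F0 inj], assumption) (rule that)
  define t where "t = min r s"
  have t: "t > 0" "t \<le> s" "t \<le> r" using ry(1) s by (auto simp: t_def)
  define P1 where "P1 e = (\<chi> i j. y e $ (i, j))" for e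
  have y: "y e = (\<chi> ij. P1 e $ fst ij $ snd ij)" for e by (simp add: P1_def vec_eq_iff)
  have sol: "orthogonal_matrix (P1 e)" "block_matrix c (P1 e)"
      "c i = c j \<Longrightarrow> c' i \<noteq> c' j \<Longrightarrow> (transpose (P1 e) ** B1 e ** P1 e) $ i $ j = 0" if "\<bar>e\<bar> < t" for e i j
  proof -
    have "transpose (B1 e) = B1 e" using B1sym[of e] that t by simp
    moreover have "split_system c c' B1 (e, \<chi> ij. P1 e $ fst ij $ snd ij) = 0"
      using ry(4)[of e] that t unfolding y[of e] by simp
    ultimately show "orthogonal_matrix (P1 e)" "block_matrix c (P1 e)"
      "c i = c j \<Longrightarrow> c' i \<noteq> c' j \<Longrightarrow> (transpose (P1 e) ** B1 e ** P1 e) $ i $ j = 0"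
      using split_system_solution[of B1 e c' c "P1 e"] cc' by blast+
  qed
  define P where "P e = P0 ** P1 e" for e
  show ?thesis
  proof (rule that[of t P c'])
    have "smooth_on {-t<..<t} y" by (rule smooth_on_subset[OF ry(2)]) (use t in auto)
    then have "smooth_on {-t<..<t} P1"
      unfolding P1_def by (intro smooth_on_matrix) (auto intro: smooth_on_nth)
    then show "smooth_on {-t<..<t} P" unfolding P_def by (intro smooth_on_matrix_mult) auto
    show "orthogonal_matrix (P e)" "block_matrix c (P e)" if "\<bar>e\<bar> < t" for e
      unfolding P_def using sol[OF that] P0 by (auto intro: orthogonal_matrix_mul block_matrix_mult)
    show "(transpose (P e) ** B e ** P e) $ i $ j = 0" if "\<bar>e\<bar> < t" "c i = c j" "c' i \<noteq> c' j" for e i j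
      using sol(3)[OF that] by (simp add: P_def B1_def matrix_transpose_mul matrix_mul_assoc)
  qed (use t card c'D in auto)
qed

text \<open>The radius \<open>s\<close> is the same for every \<open>k\<close>, so that all orders
  hold on one interval. The remainder \<open>B\<close> is tied to \<open>A\<close> only on rows and
  columns in \<open>T\<close>, and it is symmetric so that its block at 0 can be
  diagonalized.\<close>

definition scalar_to_order ::
    "(real \<Rightarrow> real^'n^'n) \<Rightarrow> real \<Rightarrow> 'n set \<Rightarrow> nat \<Rightarrow> (real \<Rightarrow> real) \<Rightarrow> (real \<Rightarrow> real^'n^'n) \<Rightarrow> bool" where
  "scalar_to_order A s T k a B \<longleftrightarrow> smooth_on {-s<..<s} a \<and> smooth_on {-s<..<s} B \<and>
     (\<forall>e. \<bar>e\<bar> < s \<longrightarrow> transpose (B e) = B e) \<and>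
     (\<forall>e i j. \<bar>e\<bar> < s \<longrightarrow> i \<in> T \<longrightarrow> j \<in> T \<longrightarrow> A e $ i $ j = (if i = j then a e else 0) + e ^ k * B e $ i $ j)"

text \<open>The scalar value of \<open>B 0\<close> moves into \<open>a\<close>, and Hadamard's lemma
  takes one more factor \<open>e\<close> out of each entry of what is left.\<close>

lemma scalar_to_order_Suc:
  assumes k: "scalar_to_order A s T k a B" and s: "s > 0"
    and scalar: "\<And>i j. i \<in> T \<Longrightarrow> j \<in> T \<Longrightarrow> B 0 $ i $ j = (if i = j then \<beta> else 0)"
  shows "\<exists>a B. scalar_to_order A s T (Suc k) a B"
proof -
  let ?S = "{-s<..<s}"
  have B: "smooth_on ?S B" and a: "smooth_on ?S a" and sym: "\<bar>e\<bar> < s \<Longrightarrow> transpose (B e) = B e" for e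
    using k by (auto simp: scalar_to_order_def)
  have "\<exists>g. smooth_on ?S g \<and> (\<forall>e. \<bar>e\<bar> < s \<longrightarrow> B e $ i $ j - (if i = j then \<beta> else 0) = e * g e)"
    if "i \<in> T" "j \<in> T" for i j
  proof -
    have f: "smooth_on ?S (\<lambda>e. B e $ i $ j - (if i = j then \<beta> else 0))"
      by (intro smooth_on_diff smooth_on_entry B smooth_on_const) auto
    have f0: "B 0 $ i $ j - (if i = j then \<beta> else 0) = 0" using scalar[OF that] by simp
    show ?thesis by (rule smooth_divide_by_argument[OF f f0]) blast
  qed
  then obtain g where g: "\<And>i j. i \<in> T \<Longrightarrow> j \<in> T \<Longrightarrow> smooth_on ?S (g i j)"
     "\<And>i j e. i \<in> T \<Longrightarrow> j \<in> T \<Longrightarrow> \<bar>e\<bar> < s \<Longrightarrow> B e $ i $ j - (if i = j then \<beta> else 0) = e * g i j e"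
    by metis
  \<comment> \<open>The quotients for \<open>(i, j)\<close> and \<open>(j, i)\<close> were chosen
    independently; averaging makes \<open>C\<close> symmetric without a comparison.\<close>
  define C :: "real \<Rightarrow> real^'a^'a" where
    "C e = (\<chi> i j. if i \<in> T \<and> j \<in> T then (g i j e + g j i e) * (1/2) else 0)" for e
  have "scalar_to_order A s T (Suc k) (\<lambda>e. a e + e ^ k * \<beta>) C"
    unfolding scalar_to_order_def
  proof (intro conjI allI impI)
    show "smooth_on ?S (\<lambda>e. a e + e ^ k * \<beta>)"
      by (intro smooth_on_add smooth_on_mult smooth_on_power a) auto
    show "smooth_on ?S C"
    proof (rule smooth_on_matrix)
      fix i j
      show "smooth_on ?S (\<lambda>x. C x $ i $ j)"
        by (cases "i \<in> T \<and> j \<in> T")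
           (auto simp: C_def simp del: times_divide_eq_right mult_1_right intro!: smooth_on_mult smooth_on_add g(1))
    qed auto
    fix e :: real assume e: "\<bar>e\<bar> < s"
    show "transpose (C e) = C e" by (auto simp: C_def transpose_def vec_eq_iff add.commute)
    fix i j assume ij: "i \<in> T" "j \<in> T"
    have "B e $ i $ j = (if i = j then \<beta> else 0) + e * C e $ i $ j"
      using g(2)[OF ij e] g(2)[OF ij(2,1) e] symmetric_entry[OF sym[OF e], of i j] ij
      by (auto simp: C_def algebra_simps)
    then show "A e $ i $ j = (if i = j then a e + e ^ k * \<beta> else 0) + e ^ Suc k * C e $ i $ j"
      using k e ij by (auto simp: scalar_to_order_def algebra_simps)
  qed
  then show ?thesis by blast
qed

lemma O_eps_infinity_subset: "O_eps_infinity s f \<Longrightarrow> t \<le> s \<Longrightarrow> O_eps_infinity t f"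
  unfolding O_eps_infinity_def by (meson order_less_le_trans)

text \<open>Off the diagonal the scalar part is absent, so the entry is \<open>e ^ N\<close> times a
  continuous function. Halving the interval makes that function bounded, with a bound that may
  depend on \<open>N\<close>.\<close>

lemma scalar_to_all_orders_flat:
  assumes "\<And>k. \<exists>a B. scalar_to_order A s T k a B" "s > 0" "i \<in> T" "j \<in> T" "i \<noteq> j"
  shows "O_eps_infinity (s / 2) (\<lambda>e. A e $ i $ j)"
  unfolding O_eps_infinity_def
proof
  fix N
  obtain a B where k: "scalar_to_order A s T N a B" using assms(1) by blast
  then have "continuous_on {-s<..<s} (\<lambda>e. B e $ i $ j)"
    by (intro smooth_on_imp_continuous_on smooth_on_entry) (auto simp: scalar_to_order_def)
  then have "continuous_on {-(s/2)..s/2} (\<lambda>e. B e $ i $ j)"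
    by (rule continuous_on_subset) (use assms(2) in auto)
  then have "bounded ((\<lambda>e. B e $ i $ j) ` {-(s/2)..s/2})"
    by (intro compact_imp_bounded compact_continuous_image) auto
  then obtain C where C: "\<And>e. e \<in> {-(s/2)..s/2} \<Longrightarrow> \<bar>B e $ i $ j\<bar> \<le> C"
    unfolding bounded_iff by (metis imageI real_norm_def)
  show "\<exists>C. \<forall>e. \<bar>e\<bar> < s / 2 \<longrightarrow> norm (A e $ i $ j) \<le> C * \<bar>e\<bar> ^ N"
  proof (intro exI allI impI)
    fix e assume e: "\<bar>e\<bar> < s / 2"
    then have "A e $ i $ j = e ^ N * B e $ i $ j"
      using k assms by (auto simp: scalar_to_order_def)
    then have "norm (A e $ i $ j) = \<bar>B e $ i $ j\<bar> * \<bar>e\<bar> ^ N" by (simp add: abs_mult power_abs)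
    also have "\<dots> \<le> C * \<bar>e\<bar> ^ N" by (rule mult_right_mono[OF C]) (use e in auto)
    finally show "norm (A e $ i $ j) \<le> C * \<bar>e\<bar> ^ N" .
  qed
qed

text \<open>An orthogonal family that block-diagonalizes \<open>A\<close> with the largest possible number of blocks
  diagonalizes it up to flat terms: a block that is not scalar to all orders has the form
  \<open>a I + \<epsilon>\<^sup>k B\<close> with \<open>B(0)\<close> not scalar, and can be split further.\<close>

lemma smooth_approximate_diagonalization:
  fixes A :: "real \<Rightarrow> real^'n^'n"
  assumes r: "r > 0" and A: "smooth_on {-r<..<r} A" and sym: "\<And>e. \<bar>e\<bar> < r \<Longrightarrow> transpose (A e) = A e"
  obtains s Q where "0 < s" "s \<le> r" "smooth_on {-s<..<s} Q" "\<And>e. \<bar>e\<bar> < s \<Longrightarrow> orthogonal_matrix (Q e)"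
    "\<And>i j. i \<noteq> j \<Longrightarrow> O_eps_infinity s (\<lambda>e. (transpose (Q e) ** A e ** Q e) $ i $ j)"
proof -
  define good where "good c \<longleftrightarrow> (\<exists>s Q. 0 < s \<and> s \<le> r \<and> smooth_on {-s<..<s} Q \<and>
      (\<forall>e. \<bar>e\<bar> < s \<longrightarrow> orthogonal_matrix (Q e) \<and> block_matrix c (transpose (Q e) ** A e ** Q e)))" for c
  have "good (\<lambda>_. 0)"
    unfolding good_def using r
    by (intro exI[of _ r] exI[of _ "\<lambda>_. mat 1"]) (auto simp: orthogonal_matrix_id block_matrix_def)
  moreover have "card (range c) \<le> CARD('n)" for c :: "'n \<Rightarrow> nat" by (rule card_image_le) simp
  then have "\<forall>c. good c \<longrightarrow> card (range c) < Suc (CARD('n))" by (simp add: less_Suc_eq_le)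
  ultimately obtain c where c: "good c" "\<And>c'. good c' \<Longrightarrow> card (range c') \<le> card (range c)"
    using ex_has_greatest_nat[of good "\<lambda>_. 0" "\<lambda>c. card (range c)" "Suc CARD('n)"] by auto
  then obtain s Q where s: "0 < s" "s \<le> r" and Q: "smooth_on {-s<..<s} Q"
      "\<And>e. \<bar>e\<bar> < s \<Longrightarrow> orthogonal_matrix (Q e)" "\<And>e. \<bar>e\<bar> < s \<Longrightarrow> block_matrix c (transpose (Q e) ** A e ** Q e)"
    unfolding good_def by blast
  let ?S = "{-s<..<s}"
  define A' where "A' e = transpose (Q e) ** A e ** Q e" for e
  have A': "smooth_on ?S A'"
    unfolding A'_def
    by (intro smooth_on_matrix_mult smooth_on_transpose Q smooth_on_subset[OF A]) (use s in auto)
  have A'sym: "transpose (A' e) = A' e" if "\<bar>e\<bar> < s" for e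
    unfolding A'_def by (rule symmetric_conjugate) (use sym that s in auto)
  have A'blk: "block_matrix c (A' e)" if "\<bar>e\<bar> < s" for e using Q(3)[OF that] by (simp add: A'_def)
  have all_orders: "\<exists>a B. scalar_to_order A' s (c -` {b}) k a B" for b k
  proof (induction k)
    case 0
    have "scalar_to_order A' s (c -` {b}) 0 (\<lambda>_. 0) A'"
      using A' A'sym by (auto simp: scalar_to_order_def)
    then show ?case by blast
  next
    case (Suc k)
    then obtain a B where aB: "scalar_to_order A' s (c -` {b}) k a B" by blast
    show ?case
    proof (cases "\<exists>\<beta>. \<forall>i j. c i = b \<longrightarrow> c j = b \<longrightarrow> B 0 $ i $ j = (if i = j then \<beta> else 0)")
      case True
      with scalar_to_order_Suc[OF aB s(1)] show ?thesis by (metis vimage_singleton_eq)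
    next
      case nonscalar: False
      \<comment> \<open>\<open>B\<close> is controlled on block \<open>b\<close> only; set to 0
        elsewhere it becomes a block matrix for \<open>c\<close>, as the splitting lemma
        demands.\<close>
      define C :: "real \<Rightarrow> real^'n^'n" where "C e = (\<chi> i j. if c i = b \<and> c j = b then B e $ i $ j else 0)" for e
      have B: "smooth_on ?S B" "\<And>e. \<bar>e\<bar> < s \<Longrightarrow> transpose (B e) = B e"
        "\<And>e i j. \<bar>e\<bar> < s \<Longrightarrow> c i = b \<Longrightarrow> c j = b \<Longrightarrow> A' e $ i $ j = (if i = j then a e else 0) + e ^ k * B e $ i $ j"
        using aB by (auto simp: scalar_to_order_def)
      have C: "smooth_on ?S C"
      proof (rule smooth_on_matrix)
        fix i j
        show "smooth_on ?S (\<lambda>x. C x $ i $ j)"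
          by (cases "c i = b \<and> c j = b") (auto simp: C_def intro: smooth_on_entry B)
      qed auto
      have Csym: "transpose (C e) = C e" if "\<bar>e\<bar> < s" for e
        using symmetric_entry[OF B(2)[OF that]] by (auto simp: C_def transpose_def vec_eq_iff)
      have Cblk: "block_matrix c (C 0)" by (auto simp: block_matrix_def C_def)
      have Cns: "\<not> (\<exists>a. \<forall>i j. c i = b \<longrightarrow> c j = b \<longrightarrow> C 0 $ i $ j = (if i = j then a else 0))"
        using nonscalar by (simp add: C_def)
      obtain t P and c' :: "'n \<Rightarrow> nat" where t: "0 < t" "t \<le> s" and P: "smooth_on {-t<..<t} P"
        "\<And>e. \<bar>e\<bar> < t \<Longrightarrow> orthogonal_matrix (P e)" "\<And>e. \<bar>e\<bar> < t \<Longrightarrow> block_matrix c (P e)"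
        and c': "card (range c) < card (range c')" "\<And>i j. c i = c j \<Longrightarrow> c' i \<noteq> c' j \<Longrightarrow> c i = b"
        and PCP: "\<And>e i j. \<bar>e\<bar> < t \<Longrightarrow> c i = c j \<Longrightarrow> c' i \<noteq> c' j \<Longrightarrow> (transpose (P e) ** C e ** P e) $ i $ j = 0"
        by (rule smooth_block_split[OF s(1) C Csym Cblk Cns], assumption) (rule that)
      have "block_matrix c' (transpose (P e) ** A' e ** P e)" if e: "\<bar>e\<bar> < t" for e
        unfolding block_matrix_def
      proof (intro allI impI)
        fix i j assume ij': "c' i \<noteq> c' j"
        have es: "\<bar>e\<bar> < s" using e t by simp
        show "(transpose (P e) ** A' e ** P e) $ i $ j = 0"
        proof (cases "c i = c j")
          case False
          then show ?thesis
            by (intro block_matrixD[where c = c] block_matrix_mult block_matrix_transpose P(3)[OF e] A'blk[OF es])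
        next
          case ij: True
          have ib: "c i = b" using c'(2)[OF ij ij'] .
          \<comment> \<open>\<open>P e\<close> respects the blocks of \<open>c\<close>, so only
            entries of \<open>A'\<close> inside block \<open>b\<close> contribute. There
            \<open>A'\<close> is a scalar matrix plus \<open>e ^ k\<close> times \<open>C\<close>:
            orthogonality of \<open>P e\<close> removes the scalar part and the splitting equation
            the other one, at every \<open>e\<close> including 0.\<close>
          have "P e $ k' $ i * A' e $ k' $ l * P e $ l $ j =
              a e * (P e $ k' $ i * mat 1 $ k' $ l * P e $ l $ j) + e ^ k * (P e $ k' $ i * C e $ k' $ l * P e $ l $ j)" for k' l
          proof (cases "c k' = b \<and> c l = b")
            case True
            then show ?thesis using B(3)[OF es, of k' l] by (simp add: C_def mat_def algebra_simps)
          next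
            case False
            then have "P e $ k' $ i = 0 \<or> P e $ l $ j = 0"
              using block_matrixD[OF P(3)[OF e]] ib ij by metis
            then show ?thesis by auto
          qed
          then have "(transpose (P e) ** A' e ** P e) $ i $ j =
              a e * (transpose (P e) ** mat 1 ** P e) $ i $ j + e ^ k * (transpose (P e) ** C e ** P e) $ i $ j"
            by (simp add: conjugate_entry sum.distrib sum_distrib_left del: matrix_mul_rid)
          moreover have "(transpose (P e) ** mat 1 ** P e) $ i $ j = 0"
            using P(2)[OF e] ij' unfolding orthogonal_matrix matrix_mul_rid by (auto simp: mat_def)
          ultimately show ?thesis using PCP[OF e ij ij'] by simp
        qed
      qed
      moreover have "transpose (Q e ** P e) ** A e ** (Q e ** P e) = transpose (P e) ** A' e ** P e" for e
        by (simp add: A'_def matrix_transpose_mul matrix_mul_assoc)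
      moreover have "smooth_on {-t<..<t} (\<lambda>e. Q e ** P e)"
        by (intro smooth_on_matrix_mult P smooth_on_subset[OF Q(1)]) (use t in auto)
      ultimately have "good c'"
        unfolding good_def using t s P(2) Q(2)
        by (intro exI[of _ t] exI[of _ "\<lambda>e. Q e ** P e"]) (auto intro: orthogonal_matrix_mul)
      with c(2) c'(1) show ?thesis by (meson not_less)
    qed
  qed
  show ?thesis
  proof (rule that[of "s / 2" Q])
    show "O_eps_infinity (s / 2) (\<lambda>e. (transpose (Q e) ** A e ** Q e) $ i $ j)" if "i \<noteq> j" for i j
    proof (cases "c i = c j")
      case True
      then show ?thesis
        using scalar_to_all_orders_flat[OF all_orders s(1), of i "c i" j] that by (simp add: A'_def)
    next
      case False
      then have "(transpose (Q e) ** A e ** Q e) $ i $ j = 0" if "\<bar>e\<bar> < s / 2" for e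
        using block_matrixD[OF A'blk[of e]] that s unfolding A'_def by auto
      then show ?thesis unfolding O_eps_infinity_def by (auto intro!: exI[of _ 0])
    qed
  qed (use s Q in \<open>auto intro: smooth_on_subset\<close>)
qed

section \<open>Schwartz functions and tempered multipliers\<close>

definition rapidly_decreasing :: "('a::real_normed_vector \<Rightarrow> 'b::real_normed_vector) \<Rightarrow> bool" where
  "rapidly_decreasing u \<longleftrightarrow> (\<forall>k. \<exists>C. \<forall>x. (1 + norm x) ^ k * norm (u x) \<le> C)"

definition polynomially_bounded :: "('a::real_normed_vector \<Rightarrow> 'b::real_normed_vector) \<Rightarrow> bool" where
  "polynomially_bounded a \<longleftrightarrow> (\<exists>C k. \<forall>x. norm (a x) \<le> C * (1 + norm x) ^ k)"

definition tempered :: "('a::euclidean_space \<Rightarrow> 'b::real_normed_vector) \<Rightarrow> bool" where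
  "tempered a \<longleftrightarrow> (\<forall>k. hereditary polynomially_bounded UNIV k a)"

lemma schwartz_iff_hereditary: "u \<in> schwartz \<longleftrightarrow> (\<forall>k. hereditary rapidly_decreasing UNIV k u)"
  unfolding all_hereditary_iff by (auto simp: schwartz_def smooth_on_def rapidly_decreasing_def)

lemma one_add_norm_pos: "0 < 1 + norm x"
  by (simp add: add_pos_nonneg)

lemma rapidly_decreasing_add: "rapidly_decreasing u \<Longrightarrow> rapidly_decreasing v \<Longrightarrow> rapidly_decreasing (\<lambda>x. u x + v x)"
  unfolding rapidly_decreasing_def
proof
  fix k
  assume "\<forall>k. \<exists>C. \<forall>x. (1 + norm x) ^ k * norm (u x) \<le> C" "\<forall>k. \<exists>C. \<forall>x. (1 + norm x) ^ k * norm (v x) \<le> C"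
  then obtain C D where CD: "\<And>x. (1 + norm x) ^ k * norm (u x) \<le> C" "\<And>x. (1 + norm x) ^ k * norm (v x) \<le> D"
    by metis
  show "\<exists>C. \<forall>x. (1 + norm x) ^ k * norm (u x + v x) \<le> C"
  proof (intro exI allI)
    fix x
    have "(1 + norm x) ^ k * norm (u x + v x) \<le> (1 + norm x) ^ k * (norm (u x) + norm (v x))"
      by (intro mult_left_mono norm_triangle_ineq) (simp add: one_add_norm_pos less_imp_le)
    then show "(1 + norm x) ^ k * norm (u x + v x) \<le> C + D"
      using CD[of x] by (simp add: distrib_left)
  qed
qed

lemma rapidly_decreasing_linear:
  assumes "bounded_linear L" "rapidly_decreasing u"
  shows "rapidly_decreasing (\<lambda>x. L (u x))"
  unfolding rapidly_decreasing_def
proof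
  fix k
  obtain C where C: "\<And>x. (1 + norm x) ^ k * norm (u x) \<le> C"
    using assms(2) unfolding rapidly_decreasing_def by metis
  obtain K where K: "K \<ge> 0" "\<And>y. norm (L y) \<le> norm y * K"
    using bounded_linear.nonneg_bounded[OF assms(1)] by blast
  show "\<exists>C. \<forall>x. (1 + norm x) ^ k * norm (L (u x)) \<le> C"
  proof (intro exI allI)
    fix x
    have "(1 + norm x) ^ k * norm (L (u x)) \<le> (1 + norm x) ^ k * (norm (u x) * K)"
      by (intro mult_left_mono K) (simp add: one_add_norm_pos less_imp_le)
    also have "\<dots> \<le> C * K" using mult_right_mono[OF C[of x] K(1)] by (simp add: mult.assoc)
    finally show "(1 + norm x) ^ k * norm (L (u x)) \<le> C * K" .
  qed
qed

lemma rapidly_decreasing_zero: "rapidly_decreasing (\<lambda>_. 0)"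
  by (auto simp: rapidly_decreasing_def)

lemma polynomially_boundedE:
  assumes "polynomially_bounded a"
  obtains C k where "C \<ge> 0" "\<And>x. norm (a x) \<le> C * (1 + norm x) ^ k"
proof -
  obtain C k where C: "\<And>x. norm (a x) \<le> C * (1 + norm x) ^ k"
    using assms by (auto simp: polynomially_bounded_def)
  have "norm (a x) \<le> max C 0 * (1 + norm x) ^ k" for x
    using C[of x] mult_right_mono[of C "max C 0" "(1 + norm x) ^ k"]
    by (simp add: one_add_norm_pos less_imp_le order_trans)
  then show ?thesis using that[of "max C 0" k] by auto
qed

lemma polynomially_bounded_add:
  assumes "polynomially_bounded a" "polynomially_bounded b"
  shows "polynomially_bounded (\<lambda>x. a x + b x)"
proof -
  obtain C k D l where *: "C \<ge> 0" "\<And>x. norm (a x) \<le> C * (1 + norm x) ^ k"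
     "D \<ge> 0" "\<And>x. norm (b x) \<le> D * (1 + norm x) ^ l"
    using assms by (auto elim!: polynomially_boundedE)
  have "norm (a x + b x) \<le> (C + D) * (1 + norm x) ^ (k + l)" for x
  proof -
    have "(1 + norm x) ^ k \<le> (1 + norm x) ^ (k + l)" "(1 + norm x) ^ l \<le> (1 + norm x) ^ (k + l)"
      by (intro power_increasing; simp)+
    then have "C * (1 + norm x) ^ k + D * (1 + norm x) ^ l \<le> (C + D) * (1 + norm x) ^ (k + l)"
      unfolding distrib_right using * by (intro add_mono mult_left_mono)
    with *(2,4)[of x] norm_triangle_ineq[of "a x" "b x"] show ?thesis by linarith
  qed
  then show ?thesis unfolding polynomially_bounded_def by blast
qed

lemma polynomially_bounded_mult_rapidly_decreasing:
  fixes a u :: "'a::real_normed_vector \<Rightarrow> 'b::real_normed_algebra"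
  assumes "polynomially_bounded a" "rapidly_decreasing u"
  shows "rapidly_decreasing (\<lambda>x. a x * u x)"
  unfolding rapidly_decreasing_def
proof
  fix k
  obtain C l where C: "C \<ge> 0" "\<And>x. norm (a x) \<le> C * (1 + norm x) ^ l"
    using assms(1) by (auto elim!: polynomially_boundedE)
  obtain D where D: "\<And>x. (1 + norm x) ^ (k + l) * norm (u x) \<le> D"
    using assms(2) unfolding rapidly_decreasing_def by metis
  show "\<exists>C. \<forall>x. (1 + norm x) ^ k * norm (a x * u x) \<le> C"
  proof (intro exI allI)
    fix x
    have "norm (a x * u x) \<le> C * (1 + norm x) ^ l * norm (u x)"
      by (rule order_trans[OF norm_mult_ineq mult_right_mono[OF C(2)]]) simp
    then have "(1 + norm x) ^ k * norm (a x * u x) \<le> (1 + norm x) ^ k * (C * (1 + norm x) ^ l * norm (u x))"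
      by (rule mult_left_mono) (simp add: one_add_norm_pos less_imp_le)
    also have "\<dots> = C * ((1 + norm x) ^ (k + l) * norm (u x))" by (simp add: power_add algebra_simps)
    also have "\<dots> \<le> C * D" by (intro mult_left_mono D C)
    finally show "(1 + norm x) ^ k * norm (a x * u x) \<le> C * D" .
  qed
qed

lemma affine_norm_bound:
  fixes L :: "'a::euclidean_space \<Rightarrow> 'b::real_normed_vector"
  assumes "linear L"
  obtains B :: real where "B \<ge> 1" "\<And>x. 1 + norm (L x + a) \<le> B * (1 + norm x)"
proof -
  obtain K where K: "K > 0" "\<And>x. norm (L x) \<le> norm x * K"
    using bounded_linear.pos_bounded[OF assms[unfolded linear_conv_bounded_linear]] by blast
  have "1 + norm (L x + a) \<le> (1 + K + norm a) * (1 + norm x)" for x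
  proof -
    have "norm (L x + a) \<le> norm x * K + norm a" using norm_triangle_ineq[of "L x" a] K(2)[of x] by linarith
    also have "1 + \<dots> \<le> (1 + K + norm a) * (1 + norm x)"
      using K(1) by (simp add: algebra_simps)
    finally show ?thesis by simp
  qed
  then show ?thesis using that[of "1 + K + norm a"] K(1) by simp
qed

lemma polynomially_bounded_affine:
  fixes L :: "'a::euclidean_space \<Rightarrow> 'b::real_normed_vector"
  assumes "linear L" "polynomially_bounded a"
  shows "polynomially_bounded (\<lambda>x. a (L x + t))"
proof -
  obtain C k where C: "C \<ge> 0" "\<And>x. norm (a x) \<le> C * (1 + norm x) ^ k"
    using assms(2) by (auto elim!: polynomially_boundedE)
  obtain B where B: "B \<ge> 1" "\<And>x. 1 + norm (L x + t) \<le> B * (1 + norm x)"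
    using affine_norm_bound[OF assms(1), of t] by blast
  have "norm (a (L x + t)) \<le> C * B ^ k * (1 + norm x) ^ k" for x
  proof -
    have "(1 + norm (L x + t)) ^ k \<le> (B * (1 + norm x)) ^ k" by (intro power_mono B) auto
    then have "C * (1 + norm (L x + t)) ^ k \<le> C * (B * (1 + norm x)) ^ k" by (intro mult_left_mono C)
    with C(2)[of "L x + t"] show ?thesis by (simp add: power_mult_distrib)
  qed
  then show ?thesis unfolding polynomially_bounded_def by blast
qed

text \<open>The left inverse \<open>M\<close> bounds \<open>1 + norm x\<close> by a multiple of
  \<open>1 + norm (L x + t)\<close>, so decay in the image point is decay in
  \<open>x\<close>.\<close>

lemma rapidly_decreasing_affine:
  fixes L :: "'a::real_normed_vector \<Rightarrow> 'b::euclidean_space" and M :: "'b \<Rightarrow> 'a"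
  assumes "linear L" "linear M" "\<And>x. M (L x) = x" "rapidly_decreasing u"
  shows "rapidly_decreasing (\<lambda>x. u (L x + t))"
  unfolding rapidly_decreasing_def
proof
  fix k
  obtain C where C: "\<And>x. (1 + norm x) ^ k * norm (u x) \<le> C"
    using assms(4) unfolding rapidly_decreasing_def by metis
  obtain B where B: "B \<ge> 1" "\<And>x. 1 + norm (M x + - M t) \<le> B * (1 + norm x)"
    using affine_norm_bound[OF assms(2), of "- M t"] by blast
  show "\<exists>C. \<forall>x. (1 + norm x) ^ k * norm (u (L x + t)) \<le> C"
  proof (intro exI allI)
    fix x
    have "M (L x + t) + - M t = x" using assms(2,3) by (simp add: linear_add)
    with B(2)[of "L x + t"] have "1 + norm x \<le> B * (1 + norm (L x + t))" by simp
    then have "(1 + norm x) ^ k \<le> (B * (1 + norm (L x + t))) ^ k" by (intro power_mono) auto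
    then have "(1 + norm x) ^ k * norm (u (L x + t)) \<le> (B * (1 + norm (L x + t))) ^ k * norm (u (L x + t))"
      by (rule mult_right_mono) simp
    also have "\<dots> = B ^ k * ((1 + norm (L x + t)) ^ k * norm (u (L x + t)))" by (simp add: power_mult_distrib)
    also have "\<dots> \<le> B ^ k * C" using B(1) by (intro mult_left_mono C) auto
    finally show "(1 + norm x) ^ k * norm (u (L x + t)) \<le> B ^ k * C" .
  qed
qed

lemma schwartz_add: "u \<in> schwartz \<Longrightarrow> v \<in> schwartz \<Longrightarrow> (\<lambda>x. u x + v x) \<in> schwartz"
  unfolding schwartz_iff_hereditary by (intro allI hereditary_add) (simp_all add: rapidly_decreasing_add)

lemma schwartz_sum: "(\<And>i. i \<in> I \<Longrightarrow> u i \<in> schwartz) \<Longrightarrow> (\<lambda>x. \<Sum>i\<in>I. u i x) \<in> schwartz"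
  unfolding schwartz_iff_hereditary
  by (intro allI hereditary_sum) (simp_all add: rapidly_decreasing_add rapidly_decreasing_zero)

lemma schwartz_linear: "bounded_linear L \<Longrightarrow> u \<in> schwartz \<Longrightarrow> (\<lambda>x. L (u x)) \<in> schwartz"
  unfolding schwartz_iff_hereditary
  by (intro allI, rule hereditary_linear[where P = rapidly_decreasing]) (simp_all add: rapidly_decreasing_linear)

lemmas schwartz_cmult = schwartz_linear[OF bounded_linear_mult_right]

lemma schwartz_tempered_mult: "tempered a \<Longrightarrow> u \<in> schwartz \<Longrightarrow> (\<lambda>x. a x * u x) \<in> schwartz"
  unfolding schwartz_iff_hereditary tempered_def
  by (intro allI, rule hereditary_bilinear[OF bounded_bilinear_mult, where P = polynomially_bounded and Q = rapidly_decreasing])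
     (simp_all add: polynomially_bounded_mult_rapidly_decreasing rapidly_decreasing_add)

lemma schwartz_affine:
  assumes "linear L" "linear M" "\<And>x. M (L x) = x" "u \<in> schwartz"
  shows "(\<lambda>x. u (L x + t)) \<in> schwartz"
  unfolding schwartz_iff_hereditary
  by (intro allI, rule hereditary_comp_affine[where P = rapidly_decreasing, OF assms(1)])
     (insert assms(4)[unfolded schwartz_iff_hereditary], simp_all add: rapidly_decreasing_add rapidly_decreasing_zero rapidly_decreasing_affine[OF assms(1-3)]
        rapidly_decreasing_linear[OF bounded_linear_scaleR_right])

lemma tempered_affine:
  assumes "linear L" "tempered a"
  shows "tempered (\<lambda>x. a (L x + t))"
  unfolding tempered_def
proof (intro allI, rule hereditary_comp_affine[where P = polynomially_bounded, OF assms(1)])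
  show "polynomially_bounded (\<lambda>x. c *\<^sub>R f x)" if "polynomially_bounded f" for c :: real and f :: "'b \<Rightarrow> 'c"
  proof -
    obtain C k where C: "\<And>x. norm (f x) \<le> C * (1 + norm x) ^ k" using \<open>polynomially_bounded f\<close> by (auto simp: polynomially_bounded_def)
    have "norm (c *\<^sub>R f x) \<le> (\<bar>c\<bar> * C) * (1 + norm x) ^ k" for x
      using mult_left_mono[OF C[of x], of "\<bar>c\<bar>"] by (simp add: mult.assoc)
    then show ?thesis unfolding polynomially_bounded_def by blast
  qed
  show "polynomially_bounded (\<lambda>_::'b. 0::'c)" by (auto simp: polynomially_bounded_def intro: exI[of _ 0])
qed (insert assms(2)[unfolded tempered_def], simp_all add: polynomially_bounded_add polynomially_bounded_affine[OF assms(1)])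

lemma tempered_of_real:
  assumes "tempered a"
  shows "tempered (\<lambda>x. complex_of_real (a x))"
  unfolding tempered_def
  by (intro allI, rule hereditary_linear[OF bounded_linear_of_real, where P = polynomially_bounded])
     (insert assms[unfolded tempered_def], simp_all add: polynomially_bounded_def)

text \<open>Every derivative is a constant multiple of the function itself. The induction therefore
  quantifies over the constant \<open>c\<close> in front.\<close>

lemma tempered_iexp: "tempered (\<lambda>y. exp (\<i> * complex_of_real ((x - y) \<bullet> \<eta>)))"
proof -
  have "hereditary polynomially_bounded UNIV k (\<lambda>y. c * exp (\<i> * complex_of_real ((x - y) \<bullet> \<eta>)))" for k c
  proof (induction k arbitrary: c)
    have bound: "polynomially_bounded (\<lambda>y. c * exp (\<i> * complex_of_real ((x - y) \<bullet> \<eta>)))" for c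
      unfolding polynomially_bounded_def by (intro exI[of _ "norm c"] exI[of _ 0]) (simp add: norm_mult)
    {
      case 0
      show ?case using bound by simp
    next
      case (Suc k)
      show ?case
      proof (rule hereditary_SucI)
        fix y
        show "((\<lambda>y. c * exp (\<i> * complex_of_real ((x - y) \<bullet> \<eta>))) has_derivative
            (\<lambda>v. (c * (- \<i> * complex_of_real (v \<bullet> \<eta>))) * exp (\<i> * complex_of_real ((x - y) \<bullet> \<eta>)))) (at y)"
        proof -
          have "((\<lambda>y. \<i> * complex_of_real ((x - y) \<bullet> \<eta>)) has_derivative (\<lambda>v. - \<i> * complex_of_real (v \<bullet> \<eta>))) (at y)"
            by (auto intro!: derivative_eq_intros bounded_linear.has_derivative[OF bounded_linear_of_real])
          from has_derivative_compose[OF this DERIV_exp[unfolded has_field_derivative_def]]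
          show ?thesis by (auto intro!: derivative_eq_intros)
        qed
        show "hereditary polynomially_bounded UNIV k
            (\<lambda>y. (c * (- \<i> * complex_of_real (v \<bullet> \<eta>))) * exp (\<i> * complex_of_real ((x - y) \<bullet> \<eta>)))" for v
          by (rule Suc)
      qed (use bound in auto)
    }
  qed
  from this[of _ 1] show ?thesis by (simp add: tempered_def)
qed

lemma schwartz_has_derivative:
  "u \<in> schwartz \<Longrightarrow> (u has_derivative frechet_derivative u (at x)) (at x)"
  by (auto simp: schwartz_def intro: smooth_onD)

lemma schwartz_rapidly_decreasing: "u \<in> schwartz \<Longrightarrow> rapidly_decreasing u"
  unfolding schwartz_iff_hereditary using hereditary_imp by blast

lemma schwartz_continuous_on: "u \<in> schwartz \<Longrightarrow> continuous_on S u"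
  by (auto simp: schwartz_def intro: smooth_on_imp_continuous_on[THEN continuous_on_subset])

lemma schwartz_measurable: "u \<in> schwartz \<Longrightarrow> u \<in> borel_measurable borel"
  by (intro borel_measurable_continuous_onI schwartz_continuous_on)

lemma schwartz_derivative: 
  assumes "u \<in> schwartz"
  shows "(\<lambda>x. frechet_derivative u (at x) v) \<in> schwartz"
proof -
  have "(\<lambda>x. frechet_derivative u (at x) b) \<in> schwartz" if "b \<in> Basis" for b
    using assms that hereditary_SucD(3) unfolding schwartz_iff_hereditary by blast
  then have "(\<lambda>x. \<Sum>b\<in>Basis. (v \<bullet> b) *\<^sub>R frechet_derivative u (at x) b) \<in> schwartz"
    by (intro schwartz_sum schwartz_linear[OF bounded_linear_scaleR_right]) auto
  moreover have "(\<Sum>b\<in>Basis. (v \<bullet> b) *\<^sub>R frechet_derivative u (at x) b) = frechet_derivative u (at x) v" for x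
    using has_derivative_linear[OF schwartz_has_derivative[OF assms]]
    by (subst (2) euclidean_representation[symmetric, of v]) (simp add: linear_sum linear_scale)
  ultimately show ?thesis by simp
qed

section \<open>Linear changes of variables\<close>

text \<open>For an affine bijection \<open>T\<close>, the factor \<open>c\<close> is the reciprocal
  of the absolute value of its determinant, since it describes the image measure.\<close>

definition scales_lborel :: "('a::euclidean_space \<Rightarrow> 'a) \<Rightarrow> real \<Rightarrow> bool" where
  "scales_lborel T c \<longleftrightarrow> T \<in> borel_measurable borel \<and> c > 0 \<and> distr lborel borel T = density lborel (\<lambda>_. ennreal c)"

lemma scales_lborel_integral:
  fixes f :: "'a::euclidean_space \<Rightarrow> 'b::{banach, second_countable_topology}"
  assumes "scales_lborel T c" "f \<in> borel_measurable borel"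
  shows "integrable lborel (\<lambda>x. f (T x)) \<longleftrightarrow> integrable lborel f"
    "(LINT x|lborel. f (T x)) = c *\<^sub>R (LINT x|lborel. f x)"
proof -
  have T: "T \<in> lborel \<rightarrow>\<^sub>M borel" "c > 0" "distr lborel borel T = density lborel (\<lambda>_. ennreal c)"
    using assms(1) by (auto simp: scales_lborel_def)
  show "integrable lborel (\<lambda>x. f (T x)) \<longleftrightarrow> integrable lborel f"
  proof -
    have "integrable lborel (\<lambda>x. f (T x)) \<longleftrightarrow> integrable lborel (\<lambda>x. c *\<^sub>R f x)"
      using integrable_distr_eq[OF T(1) assms(2)] assms(2) T(2)
      by (simp add: T(3) integrable_density less_imp_le)
    also have "\<dots> \<longleftrightarrow> integrable lborel f"
      using T(2) integrable_scaleR_right[of c lborel f] integrable_scaleR_right[of "inverse c" lborel "\<lambda>x. c *\<^sub>R f x"] by auto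
    finally show ?thesis .
  qed
  show "(LINT x|lborel. f (T x)) = c *\<^sub>R (LINT x|lborel. f x)"
    using integral_distr[OF T(1) assms(2)] assms(2) T(2)
    by (simp add: T(3) integral_density less_imp_le)
qed

lemma scales_lborel_AE:
  assumes "scales_lborel T c" "AE x in lborel. P x"
  shows "AE x in lborel. P (T x)"
proof -
  obtain N where N: "{x. \<not> P x} \<subseteq> N" "emeasure lborel N = 0" "N \<in> sets borel"
    using assms(2) by (auto elim!: AE_E)
  have T: "T \<in> lborel \<rightarrow>\<^sub>M borel" "distr lborel borel T = density lborel (\<lambda>_. ennreal c)"
    using assms(1) by (auto simp: scales_lborel_def)
  have "emeasure lborel (T -` N) = emeasure (distr lborel borel T) N"
    using emeasure_distr[OF T(1) N(3)] by simp
  also have "\<dots> = 0" using N by (simp add: T(2) emeasure_density_const)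
  finally have "T -` N \<in> null_sets lborel"
    using measurable_sets[OF T(1) N(3)] by (auto simp: null_sets_def)
  then show ?thesis by (rule AE_I') (use N in auto)
qed

lemma scales_lborel_compose:
  assumes "scales_lborel T c" "scales_lborel R d"
  shows "scales_lborel (\<lambda>x. T (R x)) (c * d)"
proof -
  have T: "T \<in> borel \<rightarrow>\<^sub>M borel" "c > 0" "distr lborel borel T = density lborel (\<lambda>_. ennreal c)"
   and R: "R \<in> borel \<rightarrow>\<^sub>M borel" "d > 0" "distr lborel borel R = density lborel (\<lambda>_. ennreal d)"
    using assms by (auto simp: scales_lborel_def)
  have "distr lborel borel (\<lambda>x. T (R x)) = distr (distr lborel borel R) borel T"
    using T R by (subst distr_distr) (auto simp: o_def)
  also have "\<dots> = density lborel (\<lambda>_. ennreal (c * d))"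
  proof (rule measure_eqI)
    fix A assume "A \<in> sets (distr (distr lborel borel R) borel T)"
    then have A: "A \<in> sets borel" by simp
    have "T -` A \<in> sets borel" using measurable_sets[OF T(1) A] by simp
    then have "emeasure (distr (distr lborel borel R) borel T) A = ennreal d * emeasure lborel (T -` A)"
      using A T R by (simp add: R(3) emeasure_distr emeasure_density_const)
    also have "emeasure lborel (T -` A) = ennreal c * emeasure lborel A"
      using A emeasure_distr[of T lborel borel A] T(1) by (simp add: T(3) emeasure_density_const)
    finally show "emeasure (distr (distr lborel borel R) borel T) A = emeasure (density lborel (\<lambda>_. ennreal (c * d))) A"
      using A T R by (simp add: emeasure_density_const ennreal_mult mult_ac)
  qed simp
  finally show ?thesis using T R by (auto simp: scales_lborel_def)
qed

lemma scales_lborel_translation: "scales_lborel (\<lambda>x. x + a) 1"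
proof -
  have "(+) a = (\<lambda>x. x + a)" by (simp add: fun_eq_iff add.commute)
  then show ?thesis using lborel_distr_plus[of a] by (simp add: scales_lborel_def density_1)
qed

lemma scales_lborelI:
  assumes "T \<in> borel_measurable borel" "c > 0" "lborel = density (distr lborel borel T) (\<lambda>_. ennreal (inverse c))"
  shows "scales_lborel T c"
proof -
  have "density lborel (\<lambda>_. ennreal c) = density (density (distr lborel borel T) (\<lambda>_. ennreal (inverse c))) (\<lambda>_. ennreal c)"
    using assms(3) by simp
  also have "\<dots> = density (distr lborel borel T) (\<lambda>_. 1)"
    using assms(2) by (subst density_density_eq) (auto simp: ennreal_mult[symmetric])
  finally show ?thesis using assms by (simp add: scales_lborel_def density_1)
qed

lemma scales_lborel_scaleR:
  assumes "c \<noteq> 0"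
  shows "scales_lborel (\<lambda>x::'a::euclidean_space. t + c *\<^sub>R x) (inverse (\<bar>c\<bar> ^ DIM('a)))"
  by (rule scales_lborelI) (use assms lborel_affine[OF assms, of t] in auto)

lemma scales_lborel_diagonal:
  fixes d :: "'n::finite \<Rightarrow> real"
  assumes "\<And>j. d j > 0"
  shows "scales_lborel (\<lambda>x::real^'n. \<chi> j. x $ j / d j) (\<Prod>j\<in>UNIV. d j)"
proof (rule scales_lborelI)
  define c :: "real^'n \<Rightarrow> real" where "c b = (\<chi> j. inverse (d j)) \<bullet> b" for b
  have B: "(Basis :: (real^'n) set) = (\<lambda>j. axis j 1) ` UNIV" by (auto simp: Basis_vec_def)
  have cb: "c (axis j 1) = inverse (d j)" for j by (simp add: c_def inner_axis)
  have cne: "c b \<noteq> 0" if "b \<in> Basis" for b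
    using that assms by (auto simp: B cb less_imp_neq[THEN not_sym])
  have "(\<Prod>b\<in>Basis. \<bar>c b\<bar>) = (\<Prod>j\<in>UNIV. inverse (d j))"
    unfolding B using assms
    by (subst prod.reindex) (auto simp: inj_on_def axis_eq_axis cb less_imp_le intro!: prod.cong)
  moreover have "(0 :: real^'n) + (\<Sum>b\<in>Basis. (c b * (x \<bullet> b)) *\<^sub>R b) = (\<chi> j. x $ j / d j)" for x
  proof (rule euclidean_eqI)
    fix b :: "real^'n" assume b: "b \<in> Basis"
    then obtain j where j: "b = axis j 1" using B by auto
    have "(0 + (\<Sum>b\<in>Basis. (c b * (x \<bullet> b)) *\<^sub>R b)) \<bullet> b = c b * (x \<bullet> b)"
      using b by (simp add: inner_sum_left_Basis)
    then show "(0 + (\<Sum>b\<in>Basis. (c b * (x \<bullet> b)) *\<^sub>R b)) \<bullet> b = (\<chi> j. x $ j / d j) \<bullet> b"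
      by (simp add: j cb inner_axis divide_inverse)
  qed
  ultimately show "lborel = density (distr lborel borel (\<lambda>x::real^'n. \<chi> j. x $ j / d j)) (\<lambda>_. ennreal (inverse (\<Prod>j\<in>UNIV. d j)))"
    using lborel_affine_euclidean[of c 0, OF cne] by (simp add: prod_inversef[symmetric] o_def)
  show "(\<lambda>x::real^'n. \<chi> j. x $ j / d j) \<in> borel_measurable borel"
    by (intro borel_measurable_continuous_onI continuous_intros)
       (use assms in \<open>auto simp: less_imp_neq[THEN not_sym]\<close>)
  show "(\<Prod>j\<in>UNIV. d j) > 0" using assms by (simp add: prod_pos)
qed

text \<open>The uniqueness argument for Haar measure: Fubini's theorem and translation invariance compare
  the image of Lebesgue measure with Lebesgue measure on the unit ball, which is preserved.\<close>

lemma nn_integral_lborel_translate: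
  "f \<in> borel_measurable borel \<Longrightarrow> (\<integral>\<^sup>+y. f (a + y) \<partial>lborel) = (\<integral>\<^sup>+y. f y \<partial>lborel)"
  using nn_integral_distr[of "(+) a" lborel borel f] by (simp add: lborel_distr_plus)

lemma nn_integral_lborel_reflect:
  fixes f :: "'a::euclidean_space \<Rightarrow> ennreal"
  assumes [measurable]: "f \<in> borel_measurable borel"
  shows "(\<integral>\<^sup>+y. f (a - y) \<partial>lborel) = (\<integral>\<^sup>+y. f y \<partial>lborel)"
proof -
  have "scales_lborel (\<lambda>y::'a. a + (-1) *\<^sub>R y) 1" using scales_lborel_scaleR[of "-1" a] by simp
  then have "distr lborel borel (\<lambda>y. a - y) = lborel" by (simp add: scales_lborel_def density_1)
  then show ?thesis using nn_integral_distr[of "\<lambda>y. a - y" lborel borel f] by simp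
qed

lemma scales_lborel_orthogonal:
  fixes f :: "'a::euclidean_space \<Rightarrow> 'a"
  assumes "orthogonal_transformation f"
  shows "scales_lborel f 1"
proof -
  have lin: "linear f" and nf: "norm (f x) = norm x" for x
    using assms by (auto simp: orthogonal_transformation)
  have [measurable]: "f \<in> borel_measurable borel"
    by (intro borel_measurable_continuous_onI linear_continuous_on) (use lin in \<open>simp add: linear_conv_bounded_linear\<close>)
  have surj: "surj f" using orthogonal_transformation_surj[OF assms] .
  define g where "g = inv f"
  have fg: "f (g y) = y" for y using surj by (simp add: g_def surj_f_inv_f)
  define B where "B = ball (0::'a) 1"
  have B[measurable]: "B \<in> sets borel" by (simp add: B_def)
  have fB: "f x \<in> B \<longleftrightarrow> x \<in> B" for x by (simp add: B_def nf)
  have "unit_ball_vol (real DIM('a)) \<noteq> 0" by (rule less_imp_neq[THEN not_sym]) simp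
  then have bfin: "emeasure lborel B \<noteq> 0" "emeasure lborel B \<noteq> \<infinity>"
    using emeasure_ball[of 1 "0::'a"] unfolding B_def by auto
  have "emeasure (distr lborel borel f) A = emeasure lborel A" if A[measurable]: "A \<in> sets borel" for A
  proof -
    let ?i = "\<lambda>S x. indicator S x :: ennreal"
    have "emeasure (distr lborel borel f) A * emeasure lborel B
        = (\<integral>\<^sup>+x. ?i A (f x) * (\<integral>\<^sup>+y. ?i B y \<partial>lborel) \<partial>lborel)"
      using nn_integral_distr[of f lborel borel "?i A"] by (simp add: nn_integral_multc)
    also have "\<dots> = (\<integral>\<^sup>+x. \<integral>\<^sup>+y. ?i A (f x) * ?i B (f x + y) \<partial>lborel \<partial>lborel)"
      by (simp add: nn_integral_cmult nn_integral_lborel_translate)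
    also have "\<dots> = (\<integral>\<^sup>+y. \<integral>\<^sup>+x. ?i A (f x) * ?i B (f x + y) \<partial>lborel \<partial>lborel)"
      by (rule lborel_pair.Fubini') simp
    \<comment> \<open>The substitution of \<open>x - g y\<close> for \<open>x\<close>, where
      \<open>f (g y) = y\<close>, moves the shift from \<open>B\<close> to \<open>A\<close>. After
      exchanging the integrals, the one over \<open>y\<close> is the measure of \<open>A\<close> for
      every \<open>x\<close>, and \<open>f x \<in> B\<close> means \<open>x \<in> B\<close>.\<close>
    also have "\<dots> = (\<integral>\<^sup>+y. \<integral>\<^sup>+x. ?i A (f x - y) * ?i B (f x) \<partial>lborel \<partial>lborel)"
    proof (rule nn_integral_cong)
      fix y
      have "(\<integral>\<^sup>+x. ?i A (f x) * ?i B (f x + y) \<partial>lborel) = (\<integral>\<^sup>+x. ?i A (f (- g y + x)) * ?i B (f (- g y + x) + y) \<partial>lborel)"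
        by (rule nn_integral_lborel_translate[symmetric]) simp
      then show "(\<integral>\<^sup>+x. ?i A (f x) * ?i B (f x + y) \<partial>lborel) = (\<integral>\<^sup>+x. ?i A (f x - y) * ?i B (f x) \<partial>lborel)"
        using linear_diff[OF lin] by (simp add: fg)
    qed
    also have "\<dots> = (\<integral>\<^sup>+x. \<integral>\<^sup>+y. ?i A (f x - y) * ?i B (f x) \<partial>lborel \<partial>lborel)"
      by (rule lborel_pair.Fubini') simp
    also have "\<dots> = (\<integral>\<^sup>+x. emeasure lborel A * ?i B x \<partial>lborel)"
      by (simp add: nn_integral_multc nn_integral_lborel_reflect) (simp add: indicator_def fB)
    also have "\<dots> = emeasure lborel A * emeasure lborel B" by (simp add: nn_integral_cmult)
    finally show ?thesis using bfin by (metis infinity_ennreal_def mult_divide_eq_ennreal)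
  qed
  then have "distr lborel borel f = lborel" by (intro measure_eqI) auto
  then show ?thesis by (simp add: scales_lborel_def density_1)
qed

section \<open>Fourier inversion for Schwartz functions\<close>

lemma lborel_product_integral:
  fixes f :: "'a::euclidean_space \<Rightarrow> real \<Rightarrow> 'b::{real_normed_field, banach, second_countable_topology}"
  assumes "\<And>b. b \<in> Basis \<Longrightarrow> integrable lborel (f b)"
  shows "(LINT x|lborel. (\<Prod>b\<in>Basis. f b (x \<bullet> b))) = (\<Prod>b\<in>Basis. (LINT t|lborel. f b t))"
    and "integrable lborel (\<lambda>x::'a. \<Prod>b\<in>Basis. f b (x \<bullet> b))"
proof -
  interpret product_sigma_finite "\<lambda>_::'a. lborel :: real measure" ..
  have [measurable]: "f b \<in> borel_measurable borel" if "b \<in> Basis" for b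
    using borel_measurable_integrable[OF assms[OF that]] by simp
  let ?g = "\<lambda>x::'a. \<Prod>b\<in>Basis. f b (x \<bullet> b)"
  have g: "?g \<in> borel_measurable borel" by measurable
  have T: "(\<lambda>p. \<Sum>b\<in>Basis. p b *\<^sub>R b) \<in> (\<Pi>\<^sub>M b\<in>(Basis::'a set). (lborel :: real measure)) \<rightarrow>\<^sub>M (borel :: 'a measure)"
    by measurable
  have eq: "?g (\<Sum>b\<in>Basis. p b *\<^sub>R b) = (\<Prod>b\<in>Basis. f b (p b))" for p
    by (intro prod.cong refl) (simp add: inner_sum_left_Basis)
  show "(LINT x|lborel. ?g x) = (\<Prod>b\<in>Basis. (LINT t|lborel. f b t))"
    by (subst lborel_eq, subst integral_distr[OF T g]) (simp add: eq product_integral_prod assms)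
  show "integrable lborel ?g"
    by (subst lborel_eq, subst integrable_distr_eq[OF T g]) (simp add: eq product_integrable_prod assms)
qed

lemma integrable_inverse_one_plus_square: "integrable lborel (\<lambda>t::real. inverse (1 + t\<^sup>2))"
  using integrable_inverse_1_plus_square by (simp add: set_integrable_def)

text \<open>An integrable majorant in product form: its integrability is one-dimensional, and the
  inverse of each factor is the Fourier multiplier of the identity minus a second partial
  derivative.\<close>

definition decay :: "'a::euclidean_space \<Rightarrow> real" where
  "decay x = (\<Prod>b\<in>Basis. inverse (1 + (x \<bullet> b)\<^sup>2))"

lemma integrable_decay: "integrable lborel decay"
  unfolding decay_def
  by (rule lborel_product_integral(2)[of "\<lambda>_ t. inverse (1 + t\<^sup>2)"]) (rule integrable_inverse_one_plus_square)

lemma decay_pos: "decay x > 0"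
  unfolding decay_def by (intro prod_pos) (simp add: add_pos_nonneg)

lemma decay_ge: "1 \<le> decay x * (1 + norm x) ^ (2 * DIM('a))" for x :: "'a::euclidean_space"
proof -
  have "(\<Prod>b\<in>(Basis :: 'a set). 1 + (x \<bullet> b)\<^sup>2) \<le> (\<Prod>b\<in>(Basis :: 'a set). (1 + norm x)\<^sup>2)"
  proof (rule prod_mono, intro conjI)
    fix b :: 'a assume b: "b \<in> Basis"
    have "(x \<bullet> b)\<^sup>2 \<le> (norm x)\<^sup>2" using Basis_le_norm[OF b, of x] by (metis abs_ge_zero power2_abs power_mono)
    then show "1 + (x \<bullet> b)\<^sup>2 \<le> (1 + norm x)\<^sup>2"
      using norm_ge_zero[of x] unfolding power2_sum one_power2 mult_1_right by linarith
  qed (simp add: add_nonneg_nonneg)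
  also have "\<dots> = (1 + norm x) ^ (2 * DIM('a))" by (simp add: power_mult)
  finally have "decay x * (\<Prod>b\<in>(Basis :: 'a set). 1 + (x \<bullet> b)\<^sup>2) \<le> decay x * (1 + norm x) ^ (2 * DIM('a))"
    using decay_pos[of x] by (intro mult_left_mono) auto
  moreover have "decay x * (\<Prod>b\<in>(Basis :: 'a set). 1 + (x \<bullet> b)\<^sup>2) = 1"
    unfolding decay_def prod.distrib[symmetric]
    by (rule prod.neutral) (simp add: add_nonneg_eq_0_iff)
  ultimately show ?thesis by simp
qed

lemma rapidly_decreasing_le_decay:
  fixes u :: "'a::euclidean_space \<Rightarrow> 'b::real_normed_vector"
  assumes "rapidly_decreasing u" 
  obtains C where "C \<ge> 0" "\<And>x. norm (u x) \<le> C * decay x"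
proof -
  obtain C where C: "\<And>x. (1 + norm x) ^ (2 * DIM('a)) * norm (u x) \<le> C"
    using assms unfolding rapidly_decreasing_def by metis
  have "norm (u x) \<le> C * decay x" for x
  proof -
    have "norm (u x) * 1 \<le> norm (u x) * (decay x * (1 + norm x) ^ (2 * DIM('a)))"
      by (intro mult_left_mono decay_ge) simp
    also have "\<dots> = decay x * ((1 + norm x) ^ (2 * DIM('a)) * norm (u x))" by simp
    also have "\<dots> \<le> decay x * C" using decay_pos[of x] by (intro mult_left_mono C) auto
    finally show ?thesis by (simp add: mult.commute)
  qed
  moreover have "C \<ge> 0" using C[of 0] by (metis norm_ge_zero norm_zero add.right_neutral mult_1 order_trans power_one)
  ultimately show ?thesis using that[of C] by simp
qed

lemma integrable_le_decay:
  fixes u :: "'a::euclidean_space \<Rightarrow> complex"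
  assumes "u \<in> borel_measurable borel" "\<And>x. norm (u x) \<le> C * decay x"
  shows "integrable lborel u"
  by (rule Bochner_Integration.integrable_bound[of _ "\<lambda>x. C * decay x"])
     (use assms integrable_decay in \<open>auto intro: order_trans[OF _ abs_ge_self]\<close>)

lemma schwartz_integrable: "u \<in> schwartz \<Longrightarrow> integrable lborel u"
  by (metis integrable_le_decay rapidly_decreasing_le_decay schwartz_measurable schwartz_rapidly_decreasing)

text \<open>A majorant that is uniform over bounded shifts, as dominated convergence of difference
  quotients requires. A shift by at most \<open>r\<close> changes \<open>1 + norm x\<close> by a
  factor of at most \<open>1 + \<bar>r\<bar>\<close>.\<close>

lemma rapidly_decreasing_translate_le_decay:
  fixes u :: "'a::euclidean_space \<Rightarrow> 'b::real_normed_vector"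
  assumes "rapidly_decreasing u"
  obtains C where "C \<ge> 0" "\<And>x z. norm z \<le> r \<Longrightarrow> norm (u (x + z)) \<le> C * decay x"
proof -
  let ?n = "2 * DIM('a)"
  obtain C where C: "\<And>x. (1 + norm x) ^ ?n * norm (u x) \<le> C"
    using assms unfolding rapidly_decreasing_def by metis
  have C0: "C \<ge> 0" using C[of 0] by (metis norm_ge_zero norm_zero add.right_neutral mult_1 order_trans power_one)
  have "norm (u (x + z)) \<le> ((1 + \<bar>r\<bar>) ^ ?n * C) * decay x" if "norm z \<le> r" for x z
  proof -
    have "norm x \<le> norm (x + z) + norm z" using norm_triangle_ineq4[of "x + z" z] by simp
    then have "1 + norm x \<le> 1 + norm (x + z) + \<bar>r\<bar>" using that by simp
    also have "\<dots> \<le> (1 + \<bar>r\<bar>) * (1 + norm (x + z))" by (simp add: algebra_simps)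
    finally have "(1 + norm x) ^ ?n \<le> ((1 + \<bar>r\<bar>) * (1 + norm (x + z))) ^ ?n"
      by (intro power_mono) auto
    then have "(1 + norm x) ^ ?n * norm (u (x + z)) \<le> ((1 + \<bar>r\<bar>) * (1 + norm (x + z))) ^ ?n * norm (u (x + z))"
      by (intro mult_right_mono) auto
    also have "\<dots> = (1 + \<bar>r\<bar>) ^ ?n * ((1 + norm (x + z)) ^ ?n * norm (u (x + z)))" by (simp add: power_mult_distrib)
    also have "\<dots> \<le> (1 + \<bar>r\<bar>) ^ ?n * C" by (intro mult_left_mono C) auto
    finally have *: "(1 + norm x) ^ ?n * norm (u (x + z)) \<le> (1 + \<bar>r\<bar>) ^ ?n * C" .
    have "norm (u (x + z)) * 1 \<le> norm (u (x + z)) * (decay x * (1 + norm x) ^ ?n)"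
      by (intro mult_left_mono decay_ge) simp
    also have "\<dots> = decay x * ((1 + norm x) ^ ?n * norm (u (x + z)))" by simp
    also have "\<dots> \<le> decay x * ((1 + \<bar>r\<bar>) ^ ?n * C)" using decay_pos[of x] by (intro mult_left_mono *) auto
    finally show ?thesis by (simp add: mult.commute)
  qed
  then show ?thesis using that[of "(1 + \<bar>r\<bar>) ^ ?n * C"] C0 by auto
qed

lemma vector_derivative_quotient:
  assumes "(f has_vector_derivative D) (at x)"
  shows "((\<lambda>h. inverse h *\<^sub>R (f (x + h) - f x)) \<longlongrightarrow> D) (at 0)"
proof -
  have "((\<lambda>h. norm (f (x + h) - f x - h *\<^sub>R D) / norm h) \<longlongrightarrow> 0) (at 0)"
    using assms by (simp add: has_vector_derivative_def has_derivative_at)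
  then have "((\<lambda>h. norm (inverse h *\<^sub>R (f (x + h) - f x) - D)) \<longlongrightarrow> 0) (at 0)"
  proof (rule Lim_transform_eventually)
    have "norm (f (x + h) - f x - h *\<^sub>R D) / norm h = norm (inverse h *\<^sub>R (f (x + h) - f x) - D)" if "h \<noteq> 0" for h
    proof -
      have "inverse h *\<^sub>R (f (x + h) - f x) - D = inverse h *\<^sub>R (f (x + h) - f x - h *\<^sub>R D)"
        using that by (simp add: scaleR_diff_right)
      then show ?thesis by (simp add: divide_inverse mult.commute)
    qed
    then show "\<forall>\<^sub>F h in at 0. norm (f (x + h) - f x - h *\<^sub>R D) / norm h = norm (inverse h *\<^sub>R (f (x + h) - f x) - D)"
      by (simp add: eventually_at_filter)
  qed
  then show ?thesis by (simp add: tendsto_norm_zero_iff LIM_zero_iff)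
qed

text \<open>Differentiate under translation: difference quotients have integral \<open>0\<close>.\<close>

lemma schwartz_integral_derivative:
  fixes u :: "real^'n \<Rightarrow> complex"
  assumes u: "u \<in> schwartz"
  shows "(LINT y|lborel. frechet_derivative u (at y) v) = 0"
proof -
  let ?u' = "\<lambda>y. frechet_derivative u (at y) v"
  \<comment> \<open>Step sizes of at most 1 keep all intermediate shifts within
    \<open>norm v\<close>, the radius for which the majorant is taken.\<close>
  define t where "t n = inverse (real (Suc n))" for n
  have t: "t n > 0" "t n \<le> 1" for n by (auto simp: t_def inverse_le_1_iff)
  define s where "s n y = inverse (t n) *\<^sub>R (u (y + t n *\<^sub>R v) - u y)" for n y
  obtain C where C: "C \<ge> 0" "\<And>x z. norm z \<le> norm v \<Longrightarrow> norm (?u' (x + z)) \<le> C * decay x"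
    using rapidly_decreasing_translate_le_decay[OF schwartz_rapidly_decreasing[OF schwartz_derivative[OF u]]] by blast
  have um: "u \<in> borel_measurable borel" by (rule schwartz_measurable[OF u])
  have ui: "integrable lborel u" by (rule schwartz_integrable[OF u])
  have ti: "integrable lborel (\<lambda>y. u (y + a))" "(LINT y|lborel. u (y + a)) = (LINT y|lborel. u y)" for a
    using scales_lborel_integral[OF scales_lborel_translation um, of a] ui by auto
  have s0: "(LINT y|lborel. s n y) = 0" for n
    unfolding s_def using ti ui by simp
  have line: "((\<lambda>q. u (y + q *\<^sub>R v)) has_vector_derivative ?u' (y + q *\<^sub>R v)) (at q)" for y q
    by (rule has_derivative_along_line) (use schwartz_has_derivative[OF u] in \<open>auto simp: differentiable_def\<close>)
  have "(\<lambda>n. LINT y|lborel. s n y) \<longlonglongrightarrow> (LINT y|lborel. ?u' y)"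
  proof (rule integral_dominated_convergence)
    show "integrable lborel (\<lambda>y::real^'n. C * decay y)" by (intro integrable_mult_right integrable_decay)
    show "?u' \<in> borel_measurable lborel" using schwartz_measurable[OF schwartz_derivative[OF u]] by simp
    show "s n \<in> borel_measurable lborel" for n
      unfolding s_def using borel_measurable_integrable[OF ti(1)] um by measurable
    show "AE y in lborel. (\<lambda>n. s n y) \<longlonglongrightarrow> ?u' y"
    proof (rule AE_I2)
      fix y
      have "((\<lambda>q. u (y + q *\<^sub>R v)) has_vector_derivative ?u' y) (at 0)" using line[of y 0] by simp
      then have "((\<lambda>h. inverse h *\<^sub>R (u (y + h *\<^sub>R v) - u y)) \<longlongrightarrow> ?u' y) (at 0)"
        using vector_derivative_quotient by fastforce
      moreover have "filterlim t (at 0) sequentially"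
        unfolding filterlim_at t_def using LIMSEQ_inverse_real_of_nat by auto
      ultimately show "(\<lambda>n. s n y) \<longlonglongrightarrow> ?u' y"
        unfolding s_def by (rule filterlim_compose)
    qed
    show "AE y in lborel. norm (s n y) \<le> C * decay y" for n
    proof (rule AE_I2)
      fix y
      have "\<exists>q\<in>{0<..<t n}. norm (u (y + t n *\<^sub>R v) - u (y + 0 *\<^sub>R v)) \<le> norm ((t n - 0) *\<^sub>R ?u' (y + q *\<^sub>R v))"
      proof (rule mvt_general[OF t(1)])
        show "continuous_on {0..t n} (\<lambda>q. u (y + q *\<^sub>R v))"
          using line by (intro continuous_at_imp_continuous_on ballI has_vector_derivative_continuous)
      qed (use line in \<open>auto simp: has_vector_derivative_def\<close>)
      then obtain q where q: "0 < q" "q < t n" "norm (u (y + t n *\<^sub>R v) - u y) \<le> t n * norm (?u' (y + q *\<^sub>R v))"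
        using t(1)[of n] by auto
      have "norm (q *\<^sub>R v) \<le> norm v" using q t(2)[of n] by (simp add: mult_left_le_one_le)
      then have "norm (?u' (y + q *\<^sub>R v)) \<le> C * decay y" by (rule C(2))
      then have "t n * norm (?u' (y + q *\<^sub>R v)) \<le> t n * (C * decay y)" using t(1)[of n] by (intro mult_left_mono) auto
      with q(3) have "norm (u (y + t n *\<^sub>R v) - u y) \<le> t n * (C * decay y)" by linarith
      then have "inverse (t n) * norm (u (y + t n *\<^sub>R v) - u y) \<le> inverse (t n) * (t n * (C * decay y))"
        using t(1)[of n] by (intro mult_left_mono) auto
      moreover have "inverse (t n) * (t n * (C * decay y)) = C * decay y" using t(1)[of n] by simp
      moreover have "norm (s n y) = inverse (t n) * norm (u (y + t n *\<^sub>R v) - u y)"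
        using t(1)[of n] by (simp add: s_def)
      ultimately show "norm (s n y) \<le> C * decay y" by simp
    qed
  qed
  then have "(\<lambda>_::nat. 0) \<longlonglongrightarrow> (LINT y|lborel. ?u' y)" by (simp only: s0)
  from LIMSEQ_unique[OF this tendsto_const] show ?thesis .
qed


section \<open>The Fourier transform of a Schwartz function and its decay\<close>

definition plane_wave :: "real^'n \<Rightarrow> real^'n \<Rightarrow> real^'n \<Rightarrow> complex" where
  "plane_wave x \<eta> y = exp (\<i> * complex_of_real ((x - y) \<bullet> \<eta>))"

text \<open>This is the Fourier transform of \<open>u\<close> at \<eta> times the phase of the
  inverse transform at \<open>x\<close>. With the phase included, inversion is plain integration
  over \<eta>, and the inner Weyl integral has the same shape.\<close>

definition wave_transform :: "(real^'n \<Rightarrow> complex) \<Rightarrow> real^'n \<Rightarrow> real^'n \<Rightarrow> complex" where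
  "wave_transform u x \<eta> = (LINT y|lborel. plane_wave x \<eta> y * u y)"

lemma norm_plane_wave [simp]: "norm (plane_wave x \<eta> y) = 1"
  by (simp add: plane_wave_def)

lemma schwartz_plane_wave: "u \<in> schwartz \<Longrightarrow> (\<lambda>y. plane_wave x \<eta> y * u y) \<in> schwartz"
  unfolding plane_wave_def by (rule schwartz_tempered_mult[OF tempered_iexp])

lemma plane_wave_integrable: "u \<in> schwartz \<Longrightarrow> integrable lborel (\<lambda>y. plane_wave x \<eta> y * u y)"
  by (intro schwartz_integrable schwartz_plane_wave)

text \<open>Integration by parts: the derivative of the product of the plane wave with
  \<open>u\<close> has integral 0.\<close>

lemma wave_transform_derivative:
  fixes u :: "real^'n \<Rightarrow> complex"
  assumes u: "u \<in> schwartz"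
  shows "wave_transform (\<lambda>y. frechet_derivative u (at y) v) x \<eta> = \<i> * complex_of_real (v \<bullet> \<eta>) * wave_transform u x \<eta>"
proof -
  let ?u' = "\<lambda>y. frechet_derivative u (at y) v"
  have D: "((\<lambda>y. plane_wave x \<eta> y * u y) has_derivative
      (\<lambda>v. plane_wave x \<eta> y * frechet_derivative u (at y) v + (- \<i> * complex_of_real (v \<bullet> \<eta>) * plane_wave x \<eta> y) * u y)) (at y)" for y
  proof -
    have "((\<lambda>y. \<i> * complex_of_real ((x - y) \<bullet> \<eta>)) has_derivative (\<lambda>v. - \<i> * complex_of_real (v \<bullet> \<eta>))) (at y)"
      by (auto intro!: derivative_eq_intros bounded_linear.has_derivative[OF bounded_linear_of_real])
    from has_derivative_compose[OF this DERIV_exp[unfolded has_field_derivative_def]]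
    have "((\<lambda>y. plane_wave x \<eta> y) has_derivative (\<lambda>v. - \<i> * complex_of_real (v \<bullet> \<eta>) * plane_wave x \<eta> y)) (at y)"
      by (simp add: plane_wave_def[abs_def] mult.commute)
    from has_derivative_mult[OF this schwartz_has_derivative[OF u, of y]] show ?thesis .
  qed
  have "0 = (LINT y|lborel. frechet_derivative (\<lambda>y. plane_wave x \<eta> y * u y) (at y) v)"
    using schwartz_integral_derivative[OF schwartz_plane_wave[OF u]] by simp
  also have "\<dots> = (LINT y|lborel. plane_wave x \<eta> y * ?u' y + (- \<i> * complex_of_real (v \<bullet> \<eta>)) * (plane_wave x \<eta> y * u y))"
    unfolding frechet_derivative_eqI[OF D] by (simp add: mult.assoc)
  also have "\<dots> = wave_transform ?u' x \<eta> + (- \<i> * complex_of_real (v \<bullet> \<eta>)) * wave_transform u x \<eta>"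
    unfolding wave_transform_def
    by (subst Bochner_Integration.integral_add)
       (auto intro!: plane_wave_integrable integrable_mult_right schwartz_derivative u simp del: mult_minus_left)
  finally show ?thesis by (simp add: eq_neg_iff_add_eq_0 algebra_simps)
qed

lemma wave_transform_second_derivative:
  fixes u :: "real^'n \<Rightarrow> complex"
  assumes u: "u \<in> schwartz"
  shows "wave_transform (pderivs [v, v] u) x \<eta> = - complex_of_real ((v \<bullet> \<eta>)\<^sup>2) * wave_transform u x \<eta>"
  using wave_transform_derivative[OF schwartz_derivative[OF u], of v v] wave_transform_derivative[OF u, of v]
  by (simp add: power2_eq_square algebra_simps)

lemma schwartz_pderivs:
  "u \<in> schwartz \<Longrightarrow> pderivs vs u \<in> schwartz"
  by (induction vs) (auto intro: schwartz_derivative)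

lemma wave_transform_add:
  "u \<in> schwartz \<Longrightarrow> v \<in> schwartz \<Longrightarrow> wave_transform (\<lambda>y. u y + v y) x \<eta> = wave_transform u x \<eta> + wave_transform v x \<eta>"
  unfolding wave_transform_def by (simp add: distrib_left plane_wave_integrable)

lemma wave_transform_cmult:
  "wave_transform (\<lambda>y. c * u y) x \<eta> = c * wave_transform u x \<eta>"
  unfolding wave_transform_def by (simp add: mult.left_commute)

lemma wave_transform_sum:
  "finite I \<Longrightarrow> (\<And>i. i \<in> I \<Longrightarrow> u i \<in> schwartz) \<Longrightarrow>
    wave_transform (\<lambda>y. \<Sum>i\<in>I. u i y) x \<eta> = (\<Sum>i\<in>I. wave_transform (u i) x \<eta>)"
  unfolding wave_transform_def by (simp add: sum_distrib_left plane_wave_integrable)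

text \<open>Replacing \<open>u\<close> by \<open>u\<close> minus its second derivative along
  \<open>b\<close> multiplies the transform by \<open>1 + (\<eta> \<bullet> b)\<^sup>2\<close>.
  Doing so for each basis vector leaves a Schwartz function, whose transform is bounded by its
  integral norm. The induction generalizes over \<open>u\<close> because each step changes
  it.\<close>

lemma wave_transform_decay:
  fixes u :: "real^'n \<Rightarrow> complex"
  assumes u: "u \<in> schwartz"
  obtains C where "\<And>\<eta>. norm (wave_transform u x \<eta>) \<le> C * decay \<eta>"
proof -
  have *: "\<exists>C. \<forall>\<eta>. (\<Prod>b\<in>I. 1 + (\<eta> \<bullet> b)\<^sup>2) * norm (wave_transform u x \<eta>) \<le> C" if "finite I" for I :: "(real^'n) set"
    using that u
  proof (induction I arbitrary: u rule: finite_induct)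
    case empty
    have "norm (wave_transform u x \<eta>) \<le> (LINT y|lborel. norm (u y))" for \<eta>
      unfolding wave_transform_def using integral_norm_bound[of lborel "\<lambda>y. plane_wave x \<eta> y * u y"] by (simp add: norm_mult)
    then show ?case by auto
  next
    case (insert b I)
    let ?v = "\<lambda>y. u y + (-1) * pderivs [b, b] u y"
    have v: "?v \<in> schwartz"
      by (intro schwartz_add schwartz_cmult schwartz_pderivs insert.prems)
    from insert.IH[OF v] obtain C where C: "\<And>\<eta>. (\<Prod>b\<in>I. 1 + (\<eta> \<bullet> b)\<^sup>2) * norm (wave_transform ?v x \<eta>) \<le> C" by blast
    have "wave_transform ?v x \<eta> = complex_of_real (1 + (\<eta> \<bullet> b)\<^sup>2) * wave_transform u x \<eta>" for \<eta>
    proof -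
      have "wave_transform ?v x \<eta> = wave_transform u x \<eta> + (-1) * wave_transform (pderivs [b, b] u) x \<eta>"
        unfolding wave_transform_cmult[symmetric]
        by (intro wave_transform_add schwartz_cmult schwartz_pderivs insert.prems)
      then show ?thesis
        unfolding wave_transform_second_derivative[OF insert.prems] by (simp add: inner_commute algebra_simps)
    qed
    then have "norm (wave_transform ?v x \<eta>) = (1 + (\<eta> \<bullet> b)\<^sup>2) * norm (wave_transform u x \<eta>)" for \<eta>
      by (simp only: norm_mult norm_of_real abs_of_nonneg add_nonneg_nonneg zero_le_one zero_le_power2)
    with C insert.hyps show ?case by (auto simp: mult_ac intro!: exI[of _ C])
  qed
  obtain C where C: "\<And>\<eta>. (\<Prod>b\<in>(Basis :: (real^'n) set). 1 + (\<eta> \<bullet> b)\<^sup>2) * norm (wave_transform u x \<eta>) \<le> C"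
    using *[of Basis] by auto
  have "norm (wave_transform u x \<eta>) \<le> C * decay \<eta>" for \<eta>
  proof -
    have "decay \<eta> * (\<Prod>b\<in>(Basis :: (real^'n) set). 1 + (\<eta> \<bullet> b)\<^sup>2) = 1"
      unfolding decay_def prod.distrib[symmetric] by (rule prod.neutral) (simp add: add_nonneg_eq_0_iff)
    then have "norm (wave_transform u x \<eta>) = decay \<eta> * ((\<Prod>b\<in>(Basis :: (real^'n) set). 1 + (\<eta> \<bullet> b)\<^sup>2) * norm (wave_transform u x \<eta>))"
      by (simp add: mult.assoc[symmetric])
    also have "\<dots> \<le> decay \<eta> * C" using decay_pos[of \<eta>] by (intro mult_left_mono C) auto
    finally show ?thesis by (simp add: mult.commute)
  qed
  then show ?thesis by (rule that)
qed

lemma plane_wave_measurable [measurable]: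
  "(\<lambda>(\<eta>, y). plane_wave x \<eta> y) \<in> borel_measurable (borel \<Otimes>\<^sub>M borel)"
proof -
  have "(\<lambda>p. plane_wave x (fst p) (snd p)) \<in> borel_measurable borel"
    unfolding plane_wave_def by (intro borel_measurable_continuous_onI continuous_intros)
  then show ?thesis by (simp add: borel_prod split_beta)
qed

lemma wave_transform_integrable:
  fixes u :: "real^'n \<Rightarrow> complex"
  assumes u: "u \<in> schwartz"
  shows "integrable lborel (wave_transform u x)"
proof -
  note [measurable] = schwartz_measurable[OF u]
  obtain C where "\<And>\<eta>. norm (wave_transform u x \<eta>) \<le> C * decay \<eta>" using wave_transform_decay[OF u, of x] by blast
  moreover have "wave_transform u x \<in> borel_measurable borel"
  proof -
    have "(\<lambda>(\<eta>, y). plane_wave x \<eta> y * u y) \<in> borel_measurable (borel \<Otimes>\<^sub>M lborel)" by measurable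
    then have "(\<lambda>\<eta>. LINT y|lborel. plane_wave x \<eta> y * u y) \<in> borel_measurable borel"
      by (rule lborel.borel_measurable_lebesgue_integral)
    then show ?thesis by (simp add: wave_transform_def[abs_def])
  qed
  ultimately show ?thesis by (intro integrable_le_decay)
qed

section \<open>Gaussian regularization and the inversion formula\<close>

lemma gaussian_fourier_1d:
  "integrable lborel (\<lambda>t. complex_of_real (exp (- t\<^sup>2 / 2)) * exp (\<i> * complex_of_real (s * t)))"
  "(LINT t|lborel. complex_of_real (exp (- t\<^sup>2 / 2)) * exp (\<i> * complex_of_real (s * t))) =
     complex_of_real (sqrt (2 * pi) * exp (- s\<^sup>2 / 2))"
proof -
  have eq: "complex_of_real (exp (- t\<^sup>2 / 2)) * exp (\<i> * complex_of_real (s * t)) =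
      complex_of_real (sqrt (2 * pi)) * (std_normal_density t *\<^sub>R iexp (s * t))" for t
    by (simp add: std_normal_density_def scaleR_conv_of_real)
  have "integrable lborel (\<lambda>t. std_normal_density t *\<^sub>R iexp (s * t))"
    by (rule Bochner_Integration.integrable_bound[of _ std_normal_density])
       (auto simp: integrable_normal_density)
  then show "integrable lborel (\<lambda>t. complex_of_real (exp (- t\<^sup>2 / 2)) * exp (\<i> * complex_of_real (s * t)))"
    unfolding eq by (intro integrable_mult_right)
  have char: "(LINT t|lborel. std_normal_density t *\<^sub>R iexp (s * t)) = char std_normal_distribution s"
    unfolding char_def by (subst integral_density) auto
  then show "(LINT t|lborel. complex_of_real (exp (- t\<^sup>2 / 2)) * exp (\<i> * complex_of_real (s * t))) =
     complex_of_real (sqrt (2 * pi) * exp (- s\<^sup>2 / 2))"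
    unfolding eq integral_mult_right_zero char char_std_normal_distribution by simp
qed

definition gaussian :: "real^'n \<Rightarrow> real" where "gaussian z = exp (- (z \<bullet> z) / 2)"

lemma gaussian_fourier:
  fixes w :: "real^'n"
  shows "integrable lborel (\<lambda>z. complex_of_real (gaussian z) * exp (\<i> * complex_of_real (w \<bullet> z)))"
    "(LINT z|lborel. complex_of_real (gaussian z) * exp (\<i> * complex_of_real (w \<bullet> z))) =
      complex_of_real (sqrt (2 * pi) ^ CARD('n) * gaussian w)"
proof -
  let ?f = "\<lambda>b t. complex_of_real (exp (- t\<^sup>2 / 2)) * exp (\<i> * complex_of_real ((w \<bullet> b) * t))"
  have g: "gaussian z = (\<Prod>b\<in>Basis. exp (- (z \<bullet> b)\<^sup>2 / 2))" for z :: "real^'n"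
    unfolding gaussian_def
    by (subst euclidean_inner) (simp add: exp_sum[symmetric] sum_divide_distrib sum_negf power2_eq_square)
  have eq: "complex_of_real (gaussian z) * exp (\<i> * complex_of_real (w \<bullet> z)) = (\<Prod>b\<in>Basis. ?f b (z \<bullet> b))" for z
  proof -
    have "exp (\<i> * complex_of_real (w \<bullet> z)) = (\<Prod>b\<in>Basis. exp (\<i> * complex_of_real ((w \<bullet> b) * (z \<bullet> b))))"
      by (subst euclidean_inner) (simp add: exp_sum[symmetric] sum_distrib_left)
    then show ?thesis by (simp only: g prod.distrib of_real_prod)
  qed
  show "integrable lborel (\<lambda>z. complex_of_real (gaussian z) * exp (\<i> * complex_of_real (w \<bullet> z)))"
    unfolding eq by (rule lborel_product_integral(2)) (rule gaussian_fourier_1d)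
  have "(LINT z|lborel. complex_of_real (gaussian z) * exp (\<i> * complex_of_real (w \<bullet> z))) =
      (\<Prod>b\<in>(Basis::(real^'n) set). complex_of_real (sqrt (2 * pi) * exp (- (w \<bullet> b)\<^sup>2 / 2)))"
    unfolding eq by (subst lborel_product_integral(1)) (rule gaussian_fourier_1d, simp only: gaussian_fourier_1d)
  then show "(LINT z|lborel. complex_of_real (gaussian z) * exp (\<i> * complex_of_real (w \<bullet> z))) =
      complex_of_real (sqrt (2 * pi) ^ CARD('n) * gaussian w)"
    by (simp add: g prod.distrib)
qed


lemma gaussian_le_1: "gaussian z \<le> 1" and gaussian_pos: "gaussian z > 0"
  by (auto simp: gaussian_def)

lemma gaussian_integrable: "integrable lborel (gaussian :: real^'n \<Rightarrow> real)"
  and gaussian_integral: "(LINT z|lborel. gaussian (z :: real^'n)) = sqrt (2 * pi) ^ CARD('n)"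
proof -
  have *: "integrable lborel (\<lambda>z::real^'n. complex_of_real (gaussian z))"
    "(LINT z|lborel. complex_of_real (gaussian (z :: real^'n))) = complex_of_real (sqrt (2 * pi) ^ CARD('n))"
    using gaussian_fourier[of "0 :: real^'n"] by (simp_all add: gaussian_def)
  from integrable_Re[OF *(1)] show "integrable lborel (gaussian :: real^'n \<Rightarrow> real)" by simp
  from *(2) show "(LINT z|lborel. gaussian (z :: real^'n)) = sqrt (2 * pi) ^ CARD('n)"
    by (simp only: integral_complex_of_real of_real_eq_iff)
qed

lemma gaussian_continuous: "continuous_on S gaussian"
  unfolding gaussian_def by (intro continuous_intros) simp

lemma gaussian_measurable [measurable]: "gaussian \<in> borel_measurable borel"
  by (intro borel_measurable_continuous_onI gaussian_continuous)

lemma gaussian_uminus [simp]: "gaussian (- z) = gaussian z"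
  by (simp add: gaussian_def)

text \<open>The Gaussian factor makes the double integral absolutely convergent, so that Fubini's
  theorem applies. The integral over \<eta> is then the transform of a Gaussian, again a Gaussian,
  concentrated near \<open>y = x\<close> at scale \<open>d\<close>; the substitution
  \<open>y = x + d *\<^sub>R z\<close> absorbs the powers of \<open>d\<close>.\<close>

lemma regularized_inversion:
  fixes u :: "real^'n \<Rightarrow> complex"
  assumes u: "u \<in> schwartz" and d: "d > 0"
  shows "(LINT \<eta>|lborel. complex_of_real (gaussian (d *\<^sub>R \<eta>)) * wave_transform u x \<eta>) =
    complex_of_real (sqrt (2 * pi) ^ CARD('n)) * (LINT z|lborel. u (x + d *\<^sub>R z) * complex_of_real (gaussian z))"
proof -
  note [measurable] = schwartz_measurable[OF u]
  let ?c = "complex_of_real (sqrt (2 * pi) ^ CARD('n))" and ?d = "inverse (d ^ CARD('n))"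
  let ?f = "\<lambda>\<eta> y. complex_of_real (gaussian (d *\<^sub>R \<eta>)) * (plane_wave x \<eta> y * u y)"
  have sc: "scales_lborel (\<lambda>\<eta>::real^'n. t + d *\<^sub>R \<eta>) ?d" for t
    using scales_lborel_scaleR[of d t] d by simp
  have gi: "integrable lborel (\<lambda>\<eta>::real^'n. gaussian (d *\<^sub>R \<eta>))"
    using scales_lborel_integral(1)[OF sc[of 0], of gaussian] gaussian_integrable by simp
  have inner: "(LINT \<eta>|lborel. ?f \<eta> y) = ?d *\<^sub>R (?c * (u y * complex_of_real (gaussian (inverse d *\<^sub>R (x - y)))))" for y
  proof -
    let ?F = "\<lambda>\<zeta>. complex_of_real (gaussian \<zeta>) * exp (\<i> * complex_of_real ((inverse d *\<^sub>R (x - y)) \<bullet> \<zeta>))"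
    have Fm: "?F \<in> borel_measurable borel" by measurable
    have "(LINT \<eta>|lborel. ?f \<eta> y) = (LINT \<eta>|lborel. u y * ?F (0 + d *\<^sub>R \<eta>))"
    proof (intro Bochner_Integration.integral_cong refl)
      fix \<eta> :: "real^'n"
      have "(inverse d *\<^sub>R (x - y)) \<bullet> (0 + d *\<^sub>R \<eta>) = (x - y) \<bullet> \<eta>" using d by simp
      then show "?f \<eta> y = u y * ?F (0 + d *\<^sub>R \<eta>)" unfolding plane_wave_def by (simp only: mult_ac add_0)
    qed
    also have "\<dots> = u y * (?d *\<^sub>R (LINT \<zeta>|lborel. ?F \<zeta>))"
      using scales_lborel_integral(2)[OF sc[of 0] Fm] by simp
    finally show ?thesis
      unfolding gaussian_fourier(2) by (simp add: scaleR_conv_of_real mult_ac)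
  qed
  have int: "integrable (lborel \<Otimes>\<^sub>M lborel) (\<lambda>(\<eta>, y). ?f \<eta> y)"
  proof (rule lborel_pair.Fubini_integrable)
    show "(\<lambda>(\<eta>, y). ?f \<eta> y) \<in> borel_measurable (lborel \<Otimes>\<^sub>M lborel)" by measurable
    have "integrable lborel (\<lambda>\<eta>::real^'n. gaussian (d *\<^sub>R \<eta>) * (LINT y|lborel. norm (u y)))"
      by (intro integrable_mult_left gi)
    then show "integrable lborel (\<lambda>\<eta>. LINT y|lborel. norm (case (\<eta>, y) of (\<eta>, y) \<Rightarrow> ?f \<eta> y))"
      using gaussian_pos gi by (simp add: norm_mult less_imp_le)
    show "AE \<eta> in lborel. integrable lborel (\<lambda>y. case (\<eta>, y) of (\<eta>, y) \<Rightarrow> ?f \<eta> y)"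
      using plane_wave_integrable[OF u] by simp
  qed
  have "(LINT \<eta>|lborel. complex_of_real (gaussian (d *\<^sub>R \<eta>)) * wave_transform u x \<eta>) = (LINT \<eta>|lborel. LINT y|lborel. ?f \<eta> y)"
    by (simp add: wave_transform_def)
  also have "\<dots> = (LINT y|lborel. LINT \<eta>|lborel. ?f \<eta> y)"
    by (rule lborel_pair.Fubini_integral[OF int, symmetric])
  also have "\<dots> = ?c * (?d *\<^sub>R (LINT y|lborel. u y * complex_of_real (gaussian (inverse d *\<^sub>R (x - y)))))"
    unfolding inner by simp
  also have "?d *\<^sub>R (LINT y|lborel. u y * complex_of_real (gaussian (inverse d *\<^sub>R (x - y)))) =
      (LINT z|lborel. u (x + d *\<^sub>R z) * complex_of_real (gaussian (inverse d *\<^sub>R (x - (x + d *\<^sub>R z)))))"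
    by (rule scales_lborel_integral(2)[OF sc, symmetric]) measurable
  finally show ?thesis using d by simp
qed

text \<open>Both sides of the regularized formula converge as \<open>d\<close> tends to 0: the left
  one is dominated by the integrable transform, the right one by a multiple of the Gaussian since
  \<open>u\<close> is bounded. One factor \<open>sqrt (2 * pi) ^ CARD('n)\<close> comes from the
  transform of the Gaussian, the other from its integral.\<close>

lemma wave_transform_inversion:
  fixes u :: "real^'n \<Rightarrow> complex"
  assumes u: "u \<in> schwartz"
  shows "(LINT \<eta>|lborel. wave_transform u x \<eta>) = complex_of_real ((2 * pi) ^ CARD('n)) * u x"
proof -
  note [measurable] = schwartz_measurable[OF u]
  define d where "d n = inverse (real (Suc n))" for n
  have d: "d n > 0" for n by (simp add: d_def)
  have d0: "d \<longlonglongrightarrow> 0" unfolding d_def by (rule LIMSEQ_inverse_real_of_nat)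
  let ?c = "complex_of_real (sqrt (2 * pi) ^ CARD('n))"
  have 1: "(\<lambda>n. LINT \<eta>|lborel. complex_of_real (gaussian (d n *\<^sub>R \<eta>)) * wave_transform u x \<eta>) \<longlonglongrightarrow> (LINT \<eta>|lborel. wave_transform u x \<eta>)"
  proof (rule integral_dominated_convergence)
    show "integrable lborel (\<lambda>\<eta>. norm (wave_transform u x \<eta>))"
      by (intro integrable_norm wave_transform_integrable u)
    have [measurable]: "wave_transform u x \<in> borel_measurable borel"
      using borel_measurable_integrable[OF wave_transform_integrable[OF u]] by simp
    show "wave_transform u x \<in> borel_measurable lborel" by simp
    show "(\<lambda>\<eta>. complex_of_real (gaussian (d n *\<^sub>R \<eta>)) * wave_transform u x \<eta>) \<in> borel_measurable lborel" for n
      by measurable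
    show "AE \<eta> in lborel. (\<lambda>n. complex_of_real (gaussian (d n *\<^sub>R \<eta>)) * wave_transform u x \<eta>) \<longlonglongrightarrow> wave_transform u x \<eta>"
    proof (rule AE_I2)
      fix \<eta> :: "real^'n"
      have "(\<lambda>n. gaussian (d n *\<^sub>R \<eta>)) \<longlonglongrightarrow> gaussian (0 *\<^sub>R \<eta>)"
        unfolding gaussian_def by (intro tendsto_intros d0) simp
      then have "(\<lambda>n. complex_of_real (gaussian (d n *\<^sub>R \<eta>)) * wave_transform u x \<eta>) \<longlonglongrightarrow> complex_of_real (gaussian (0 *\<^sub>R \<eta>)) * wave_transform u x \<eta>"
        by (intro tendsto_intros)
      then show "(\<lambda>n. complex_of_real (gaussian (d n *\<^sub>R \<eta>)) * wave_transform u x \<eta>) \<longlonglongrightarrow> wave_transform u x \<eta>"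
        by (simp add: gaussian_def)
    qed
    show "AE \<eta> in lborel. norm (complex_of_real (gaussian (d n *\<^sub>R \<eta>)) * wave_transform u x \<eta>) \<le> norm (wave_transform u x \<eta>)" for n
    proof (rule AE_I2)
      fix \<eta> :: "real^'n"
      have "\<bar>gaussian (d n *\<^sub>R \<eta>)\<bar> \<le> 1"
        using gaussian_le_1[of "d n *\<^sub>R \<eta>"] gaussian_pos[of "d n *\<^sub>R \<eta>"] by simp
      then show "norm (complex_of_real (gaussian (d n *\<^sub>R \<eta>)) * wave_transform u x \<eta>) \<le> norm (wave_transform u x \<eta>)"
        by (simp add: norm_mult mult_left_le_one_le)
    qed
  qed
  obtain C where C: "\<And>y. norm (u y) \<le> C"
    using schwartz_rapidly_decreasing[OF u] unfolding rapidly_decreasing_def by (metis mult_1 power_0)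
  have 2: "(\<lambda>n. LINT z|lborel. u (x + d n *\<^sub>R z) * complex_of_real (gaussian z)) \<longlonglongrightarrow> (LINT z|lborel. u x * complex_of_real (gaussian (z :: real^'n)))"
  proof (rule integral_dominated_convergence)
    show "integrable lborel (\<lambda>z::real^'n. C * gaussian z)" by (intro integrable_mult_right gaussian_integrable)
    show "(\<lambda>z::real^'n. u x * complex_of_real (gaussian z)) \<in> borel_measurable lborel"
      "(\<lambda>z. u (x + d n *\<^sub>R z) * complex_of_real (gaussian z)) \<in> borel_measurable lborel" for n
      by measurable
    show "AE z in lborel. (\<lambda>n. u (x + d n *\<^sub>R z) * complex_of_real (gaussian z)) \<longlonglongrightarrow> u x * complex_of_real (gaussian z)"
    proof (rule AE_I2)
      fix z :: "real^'n"
      have "(\<lambda>n. x + d n *\<^sub>R z) \<longlonglongrightarrow> x + 0 *\<^sub>R z" by (intro tendsto_intros d0)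
      moreover have "isCont u x"
        using schwartz_continuous_on[OF u, of UNIV] by (simp add: continuous_on_eq_continuous_at)
      ultimately have "(\<lambda>n. u (x + d n *\<^sub>R z)) \<longlonglongrightarrow> u x" by (auto intro: isCont_tendsto_compose)
      then show "(\<lambda>n. u (x + d n *\<^sub>R z) * complex_of_real (gaussian z)) \<longlonglongrightarrow> u x * complex_of_real (gaussian z)"
        by (intro tendsto_intros)
    qed
    show "AE z in lborel. norm (u (x + d n *\<^sub>R z :: real^'n) * complex_of_real (gaussian z)) \<le> C * gaussian z" for n
      by (rule AE_I2)
         (simp only: norm_mult norm_of_real abs_of_pos[OF gaussian_pos] mult_right_mono[OF C less_imp_le[OF gaussian_pos]])
  qed
  have "(LINT z|lborel. u x * complex_of_real (gaussian (z :: real^'n))) = u x * ?c"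
    by (simp only: integral_mult_right_zero integral_complex_of_real gaussian_integral)
  from tendsto_mult[OF tendsto_const 2[unfolded this]]
  have "(\<lambda>n. ?c * (LINT z|lborel. u (x + d n *\<^sub>R z) * complex_of_real (gaussian z))) \<longlonglongrightarrow> ?c * (u x * ?c)" .
  then have "(LINT \<eta>|lborel. wave_transform u x \<eta>) = ?c * (u x * ?c)"
    using LIMSEQ_unique[OF 1] by (simp only: regularized_inversion[OF u d])
  also have "\<dots> = complex_of_real (sqrt (2 * pi) ^ CARD('n) * sqrt (2 * pi) ^ CARD('n)) * u x" by simp
  also have "sqrt (2 * pi) ^ CARD('n) * sqrt (2 * pi) ^ CARD('n) = (2 * pi) ^ CARD('n)"
    by (simp only: power_mult_distrib[symmetric]) simp
  finally show ?thesis .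
qed

section \<open>Weyl quantization of a quadratic form in the momenta plus a potential\<close>

text \<open>For \<open>\<eta> = \<xi> / h\<close> the inner integral of the Weyl quantization is the wave transform of a Schwartz
  function of \<open>y\<close> that depends on \<open>x\<close>; at \<open>y = x\<close> it is the value of the differential operator.\<close>

lemma has_weyl_symbol_quadratic:
  fixes W :: "real^'n \<Rightarrow> real" and w :: "'n \<Rightarrow> real"
  assumes h: "h > 0" and W: "tempered W"
    and A: "\<And>u x. u \<in> schwartz \<Longrightarrow>
      A u x = (\<Sum>j\<in>UNIV. - complex_of_real (h\<^sup>2 / 2 * w j) * pderivs [axis j 1, axis j 1] u x) + complex_of_real (W x) * u x"
    and a: "\<And>x \<xi>. a x \<xi> h = complex_of_real ((\<Sum>j\<in>UNIV. w j / 2 * (\<xi> $ j)\<^sup>2) + W x)"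
  shows "has_weyl_symbol h A a"
  unfolding has_weyl_symbol_def
proof (intro ballI allI)
  fix u :: "real^'n \<Rightarrow> complex" and x :: "real^'n" assume u: "u \<in> schwartz"
  let ?D = "\<lambda>j. pderivs [axis j 1, axis j 1] u"
  define P where "P y = complex_of_real (W ((1/2) *\<^sub>R (x + y))) * u y" for y
  define Q where "Q y = (\<Sum>j\<in>UNIV. - complex_of_real (h\<^sup>2 / 2 * w j) * ?D j y)" for y
  have P: "P \<in> schwartz"
  proof -
    have "linear (\<lambda>y::real^'n. (1/2) *\<^sub>R y)" by (simp add: linear_iff scaleR_add_right)
    from tempered_affine[OF this W, of "(1/2) *\<^sub>R x"]
    have "tempered (\<lambda>y. complex_of_real (W ((1/2) *\<^sub>R (x + y))))"
      by (intro tempered_of_real) (simp add: scaleR_add_right add.commute)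
    from schwartz_tempered_mult[OF this u] show ?thesis by (simp add: P_def[abs_def])
  qed
  have QD: "(\<lambda>y. - complex_of_real (h\<^sup>2 / 2 * w j) * ?D j y) \<in> schwartz" for j
    by (intro schwartz_cmult schwartz_pderivs u)
  have Q: "Q \<in> schwartz" unfolding Q_def[abs_def] by (intro schwartz_sum QD)
  define G where "G y = Q y + P y" for y
  have G: "G \<in> schwartz" unfolding G_def[abs_def] by (intro schwartz_add Q P)
  define r where "r = inverse h"
  have integrand: "weyl_integrand h a u x \<xi> y = plane_wave x (r *\<^sub>R \<xi>) y *
      (complex_of_real (\<Sum>j\<in>UNIV. w j / 2 * (\<xi> $ j)\<^sup>2) * u y + P y)" for \<xi> y
  proof -
    have "exp (\<i> / complex_of_real h * complex_of_real ((x - y) \<bullet> \<xi>)) = plane_wave x (r *\<^sub>R \<xi>) y"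
      unfolding plane_wave_def r_def by (simp add: divide_inverse mult.assoc)
    then show ?thesis
      unfolding weyl_integrand_def a P_def by (simp only: of_real_add distrib_left distrib_right mult.assoc)
  qed
  have S: "(\<lambda>y. complex_of_real (\<Sum>j\<in>UNIV. w j / 2 * (\<xi> $ j)\<^sup>2) * u y) \<in> schwartz" for \<xi>
    by (intro schwartz_cmult u)
  have int1: "integrable lborel (\<lambda>y. weyl_integrand h a u x \<xi> y)" for \<xi>
    unfolding integrand by (intro plane_wave_integrable schwartz_add S P)
  \<comment> \<open>At \<eta> = \<xi> / h the operator with symbol
    \<open>w j / 2 * (\<xi> $ j)\<^sup>2\<close> acts on \<open>u\<close> under the transform, so
    the polynomial in \<xi>, which by itself would ruin integrability, is absorbed into the Schwartz
    function \<open>Q\<close>.\<close>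
  have inner: "(LINT y|lborel. weyl_integrand h a u x \<xi> y) = wave_transform G x (r *\<^sub>R \<xi>)" for \<xi>
  proof -
    have "wave_transform (\<lambda>y. - complex_of_real (h\<^sup>2 / 2 * w j) * ?D j y) x (r *\<^sub>R \<xi>) =
        complex_of_real (w j / 2 * (\<xi> $ j)\<^sup>2) * wave_transform u x (r *\<^sub>R \<xi>)" for j
    proof -
      have "(h\<^sup>2 / 2 * w j) * (axis j 1 \<bullet> r *\<^sub>R \<xi>)\<^sup>2 = w j / 2 * (\<xi> $ j)\<^sup>2"
        using h by (simp add: r_def inner_axis' power_mult_distrib field_simps)
      then have "- complex_of_real (h\<^sup>2 / 2 * w j) * - complex_of_real ((axis j 1 \<bullet> r *\<^sub>R \<xi>)\<^sup>2) = complex_of_real (w j / 2 * (\<xi> $ j)\<^sup>2)"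
        by (simp only: minus_mult_minus of_real_mult[symmetric])
      then show ?thesis
        unfolding wave_transform_cmult wave_transform_second_derivative[OF u] by (simp only: mult.assoc[symmetric])
    qed
    then have Q_eq: "wave_transform Q x (r *\<^sub>R \<xi>) = complex_of_real (\<Sum>j\<in>UNIV. w j / 2 * (\<xi> $ j)\<^sup>2) * wave_transform u x (r *\<^sub>R \<xi>)"
      unfolding Q_def[abs_def] by (simp only: wave_transform_sum[OF finite QD] of_real_sum sum_distrib_right)
    have "(LINT y|lborel. weyl_integrand h a u x \<xi> y) =
        wave_transform (\<lambda>y. complex_of_real (\<Sum>j\<in>UNIV. w j / 2 * (\<xi> $ j)\<^sup>2) * u y + P y) x (r *\<^sub>R \<xi>)"
      by (simp only: integrand wave_transform_def)
    also have "\<dots> = wave_transform Q x (r *\<^sub>R \<xi>) + wave_transform P x (r *\<^sub>R \<xi>)"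
      by (simp only: wave_transform_add[OF S P] wave_transform_cmult Q_eq)
    also have "\<dots> = wave_transform G x (r *\<^sub>R \<xi>)"
      by (simp only: G_def[abs_def] wave_transform_add[OF Q P])
    finally show ?thesis .
  qed
  \<comment> \<open>The substitution contributes \<open>h ^ CARD('n)\<close> and the inversion
    formula \<open>(2 * pi) ^ CARD('n)\<close>; together they cancel the normalization of
    \<open>Op_W\<close>.\<close>
  have sc: "scales_lborel (\<lambda>\<xi>::real^'n. 0 + r *\<^sub>R \<xi>) (h ^ CARD('n))"
    using scales_lborel_scaleR[of r "0 :: real^'n"] h by (simp add: r_def power_inverse)
  have m: "wave_transform G x \<in> borel_measurable borel"
    using borel_measurable_integrable[OF wave_transform_integrable[OF G]] by simp
  have int2: "integrable lborel (\<lambda>\<xi>. LINT y|lborel. weyl_integrand h a u x \<xi> y)"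
    unfolding inner using scales_lborel_integral(1)[OF sc m] wave_transform_integrable[OF G] by simp
  have "(LINT \<xi>|lborel. (LINT y|lborel. weyl_integrand h a u x \<xi> y)) = h ^ CARD('n) *\<^sub>R (complex_of_real ((2 * pi) ^ CARD('n)) * G x)"
    unfolding inner using scales_lborel_integral(2)[OF sc m] wave_transform_inversion[OF G] by simp
  also have "\<dots> = complex_of_real ((2 * pi * h) ^ CARD('n)) * G x"
    by (simp add: scaleR_conv_of_real power_mult_distrib)
  finally have "Op_W h a u x = G x" using h by (simp add: Op_W_def)
  moreover have "G x = A u x" by (simp add: G_def Q_def P_def A[OF u] scaleR_2[symmetric])
  ultimately show "(\<forall>\<xi>. integrable lborel (\<lambda>y. weyl_integrand h a u x \<xi> y)) \<and>
     integrable lborel (\<lambda>\<xi>. LINT y|lborel. weyl_integrand h a u x \<xi> y) \<and> A u x = Op_W h a u x"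
    using int1 int2 by simp
qed

section \<open>The unitary operator\<close>

lemma linear_axis_expansion:
  fixes f :: "real^'n \<Rightarrow> 'b::real_vector"
  assumes "linear f"
  shows "f v = (\<Sum>k\<in>UNIV. v $ k *\<^sub>R f (axis k 1))"
proof -
  have "f (\<Sum>k\<in>UNIV. v $ k *\<^sub>R axis k 1) = (\<Sum>k\<in>UNIV. v $ k *\<^sub>R f (axis k 1))"
    using assms by (simp add: linear_sum linear_scale)
  moreover have "(\<Sum>k\<in>UNIV. v $ k *\<^sub>R axis k 1) = v"
    using basis_expansion[of v] by (simp add: scalar_mult_eq_scaleR)
  ultimately show ?thesis by simp
qed

locale affine_unitary =
  fixes w :: "'n::finite \<Rightarrow> real" and Q :: "real^'n^'n" and a :: "real^'n"
  assumes w_pos: "\<And>j. w j > 0" and orthogonal: "orthogonal_matrix Q"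
begin

definition amplitude :: real where "amplitude = (\<Prod>j\<in>UNIV. w j) powr (-1/4)"

definition expand :: "real^'n \<Rightarrow> real^'n" where "expand y = Q *v (\<chi> j. y $ j / sqrt (w j))"

definition contract :: "real^'n \<Rightarrow> real^'n" where "contract x = (\<chi> j. sqrt (w j) * (transpose Q *v x) $ j)"

definition U :: "(real^'n \<Rightarrow> complex) \<Rightarrow> real^'n \<Rightarrow> complex" where
  "U f y = complex_of_real amplitude * f (expand y + a)"

text \<open>The argument is the inverse of \<open>expand y + a\<close>, written as a linear map plus
  a constant to fit the lemmas on affine substitutions.\<close>

definition Ustar :: "(real^'n \<Rightarrow> complex) \<Rightarrow> real^'n \<Rightarrow> complex" where
  "Ustar g x = complex_of_real (inverse amplitude) * g (contract x + contract (- a))"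

lemma U_eq: "scaling w \<circ> change_of_variables Q \<circ> translation a = U"
  by (intro ext) (simp add: scaling_def change_of_variables_def translation_def U_def expand_def amplitude_def)

lemma sqrt_w [simp]: "sqrt (w j) \<noteq> 0" "sqrt (w j) > 0" "sqrt (w j) * sqrt (w j) = w j" "w j \<noteq> 0"
  using w_pos[of j] by auto

lemma linear_expand: "linear expand"
proof -
  have "linear (\<lambda>y::real^'n. \<chi> j. y $ j / sqrt (w j))"
    by (auto simp: linear_iff vec_eq_iff add_divide_distrib)
  from linear_compose[OF this matrix_vector_mul_linear[of Q]] show ?thesis
    by (simp add: o_def expand_def[abs_def])
qed

lemma linear_contract: "linear contract"
proof -
  have "linear (\<lambda>y::real^'n. \<chi> j. sqrt (w j) * y $ j)"
    by (auto simp: linear_iff vec_eq_iff algebra_simps)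
  from linear_compose[OF matrix_vector_mul_linear[of "transpose Q"] this] show ?thesis
    by (simp add: o_def contract_def[abs_def])
qed

lemma QQ: "transpose Q ** Q = mat 1" "Q ** transpose Q = mat 1"
  using orthogonal by (auto simp: orthogonal_matrix_def)

lemma contract_expand [simp]: "contract (expand y) = y"
  by (simp add: contract_def expand_def matrix_vector_mul_assoc QQ vec_eq_iff)

lemma expand_contract [simp]: "expand (contract x) = x"
proof -
  have "(\<chi> j. contract x $ j / sqrt (w j)) = transpose Q *v x" by (simp add: contract_def vec_eq_iff)
  then show ?thesis unfolding expand_def by (simp only: matrix_vector_mul_assoc QQ matrix_vector_mul_lid)
qed

lemma inverse_affine [simp]:
  "contract (expand y + a) + contract (- a) = y" "expand (contract x + contract (- a)) + a = x"
  using linear_add[OF linear_contract] linear_diff[OF linear_expand] linear_neg[OF linear_contract]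
  by simp_all

lemma amplitude_pos: "amplitude > 0"
  using w_pos by (simp add: amplitude_def prod_pos less_imp_neq[THEN not_sym])

text \<open>Translation and rotation preserve Lebesgue measure, and the diagonal scaling contributes
  the product of the \<open>sqrt (w j)\<close>. The exponent -1/4 in \<open>amplitude\<close> is
  chosen so that its square compensates this factor, which makes \<open>U\<close> unitary.\<close>

lemma scales: "scales_lborel (\<lambda>y. expand y + a) (inverse (amplitude\<^sup>2))"
proof -
  have "orthogonal_transformation ((*v) Q)"
    using orthogonal by (simp add: orthogonal_transformation_matrix)
  from scales_lborel_compose[OF scales_lborel_translation[of a] scales_lborel_compose[OF
      scales_lborel_orthogonal[OF this] scales_lborel_diagonal[of "\<lambda>j. sqrt (w j)", OF sqrt_w(2)]]]
  have "scales_lborel (\<lambda>y. expand y + a) (\<Prod>j\<in>UNIV. sqrt (w j))"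
    by (simp add: expand_def)
  moreover have "inverse (amplitude\<^sup>2) = (\<Prod>j\<in>UNIV. sqrt (w j))"
  proof -
    have p: "(\<Prod>j\<in>UNIV. w j) > 0" using w_pos by (simp add: prod_pos)
    have "amplitude\<^sup>2 = (\<Prod>j\<in>UNIV. w j) powr (-1/2)"
      unfolding amplitude_def power2_eq_square powr_add[symmetric] by simp
    then have "inverse (amplitude\<^sup>2) = sqrt (\<Prod>j\<in>UNIV. w j)"
      using p by (simp add: powr_minus powr_half_sqrt)
    moreover have "sqrt (\<Prod>j\<in>A. w j) = (\<Prod>j\<in>A. sqrt (w j))" for A
      by (induction A rule: infinite_finite_induct) (auto simp: real_sqrt_mult)
    ultimately show ?thesis by simp
  qed
  ultimately show ?thesis by simp
qed

lemma expand_measurable [measurable]: "(\<lambda>y. expand y + a) \<in> borel_measurable borel"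
  using scales by (simp add: scales_lborel_def)

lemma contract_measurable [measurable]: "contract \<in> borel_measurable borel"
  using linear_contract
  by (intro borel_measurable_continuous_onI linear_continuous_on) (simp add: linear_conv_bounded_linear)

lemma U_Ustar [simp]: "U (Ustar g) = g"
  using amplitude_pos by (simp add: U_def Ustar_def fun_eq_iff flip: of_real_mult)

lemma U_L2: "f \<in> L2 \<Longrightarrow> U f \<in> L2"
proof -
  assume "f \<in> L2"
  then have f[measurable]: "f \<in> borel_measurable borel" and i: "integrable lborel (\<lambda>x. (norm (f x))\<^sup>2)"
    by (auto simp: L2_def)
  have m: "U f \<in> borel_measurable borel"
    unfolding U_def[abs_def] using measurable_compose[OF expand_measurable f] by simp
  have "(\<lambda>x. (norm (f x))\<^sup>2) \<in> borel_measurable borel" by measurable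
  from scales_lborel_integral(1)[OF scales this] i
  have "integrable lborel (\<lambda>y. amplitude\<^sup>2 * (norm (f (expand y + a)))\<^sup>2)" by (intro integrable_mult_right) simp
  with m show ?thesis by (simp add: L2_def U_def norm_mult power_mult_distrib)
qed

lemma Ustar_L2: "g \<in> L2 \<Longrightarrow> Ustar g \<in> L2"
proof -
  assume "g \<in> L2"
  then have g[measurable]: "g \<in> borel_measurable borel" and i: "integrable lborel (\<lambda>x. (norm (g x))\<^sup>2)"
    by (auto simp: L2_def)
  have m[measurable]: "Ustar g \<in> borel_measurable borel" unfolding Ustar_def[abs_def] by measurable
  have K: "(\<lambda>x. (norm (Ustar g x))\<^sup>2) \<in> borel_measurable borel" by measurable
  have "(norm (Ustar g (expand y + a)))\<^sup>2 = (inverse amplitude)\<^sup>2 * (norm (g y))\<^sup>2" for y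
    using amplitude_pos by (simp add: Ustar_def norm_mult norm_inverse power_mult_distrib)
  then have "integrable lborel (\<lambda>y. (norm (Ustar g (expand y + a)))\<^sup>2)" using i by simp
  with scales_lborel_integral(1)[OF scales K] m show ?thesis by (simp add: L2_def)
qed

lemma L2_inner_U:
  assumes "f \<in> L2" "g \<in> L2"
  shows "L2_inner (U f) g = L2_inner f (Ustar g)"
proof -
  have [measurable]: "f \<in> borel_measurable borel" "Ustar g \<in> borel_measurable borel"
    using assms(1) Ustar_L2[OF assms(2)] by (auto simp: L2_def)
  have "L2_inner (U f) g = (LINT y|lborel. complex_of_real (amplitude\<^sup>2) * (cnj (f (expand y + a)) * Ustar g (expand y + a)))"
    unfolding L2_inner_def using amplitude_pos
    by (intro Bochner_Integration.integral_cong refl) (simp add: U_def Ustar_def power2_eq_square)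
  also have "\<dots> = complex_of_real (amplitude\<^sup>2) * (inverse (amplitude\<^sup>2) *\<^sub>R L2_inner f (Ustar g))"
  proof -
    have "cnj \<in> borel_measurable borel" by (intro borel_measurable_continuous_onI continuous_intros)
    then have "(\<lambda>x. cnj (f x) * Ustar g x) \<in> borel_measurable borel" by measurable
    from scales_lborel_integral(2)[OF scales this] show ?thesis by (simp add: L2_inner_def)
  qed
  finally show ?thesis using amplitude_pos by (simp add: scaleR_conv_of_real)
qed

lemma unitary_U: "unitary_L2 U"
  unfolding unitary_L2_def
proof (intro conjI ballI allI impI)
  show "U f \<in> L2" if "f \<in> L2" for f using U_L2[OF that] .
  show "AE x in lborel. U f x = U g x" if "AE x in lborel. f x = g x" for f g
    using scales_lborel_AE[OF scales that] by (auto simp: U_def elim: eventually_mono)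
  show "AE x in lborel. U (\<lambda>y. p * f y + q * g y) x = p * U f x + q * U g x" for f g p q
    by (simp add: U_def algebra_simps)
  show "L2_inner (U f) (U g) = L2_inner f g" if "f \<in> L2" "g \<in> L2" for f g
    using L2_inner_U[OF that(1) U_L2[OF that(2)]] amplitude_pos
    by (simp add: Ustar_def[abs_def] U_def mult.assoc[symmetric] flip: of_real_mult)
  show "\<exists>f\<in>L2. AE x in lborel. U f x = g x" if "g \<in> L2" for g
    using Ustar_L2[OF that] by (intro bexI[of _ "Ustar g"]) auto
qed

lemma adjoint_U: "adjoint_L2 U Ustar"
  using Ustar_L2 L2_inner_U by (simp add: adjoint_L2_def)

lemma Ustar_schwartz: "u \<in> schwartz \<Longrightarrow> Ustar u \<in> schwartz"
  unfolding Ustar_def[abs_def]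
  by (intro schwartz_cmult schwartz_affine[OF linear_contract linear_expand]) auto

text \<open>The second derivative at \<open>y\<close> is a bilinear form \<open>B\<close>, evaluated
  on the images of the standard basis under \<open>contract\<close>. Orthonormality of the columns
  of \<open>Q\<close> makes the sum over that basis diagonal, with entries
  \<open>w k\<close>.\<close>

lemma laplacian_Ustar:
  assumes u: "u \<in> schwartz"
  shows "laplacian (Ustar u) (expand y + a) =
    complex_of_real (inverse amplitude) * (\<Sum>k\<in>UNIV. complex_of_real (w k) * pderivs [axis k 1, axis k 1] u y)"
proof -
  let ?c = "complex_of_real (inverse amplitude)" and ?psi = "\<lambda>x. contract x + contract (- a)"
  have chain: "((\<lambda>x. v (?psi x)) has_derivative (\<lambda>h. frechet_derivative v (at (?psi x)) (contract h))) (at x)"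
    if "v \<in> schwartz" for v x
  proof -
    have "(?psi has_derivative contract) (at x)"
      using linear_contract by (auto intro!: derivative_eq_intros bounded_linear_imp_has_derivative simp: linear_conv_bounded_linear)
    from diff_chain_at[OF this schwartz_has_derivative[OF that]] show ?thesis by (simp add: o_def)
  qed
  have D1: "frechet_derivative (Ustar u) (at x) v = ?c * frechet_derivative u (at (?psi x)) (contract v)" for x v
    unfolding Ustar_def[abs_def] using frechet_derivative_eqI[OF has_derivative_mult_right[OF chain[OF u]]] by simp
  define B where "B v v' = frechet_derivative (\<lambda>z. frechet_derivative u (at z) v) (at y) v'" for v v'
  have D2: "pderivs [v, v] (Ustar u) (expand y + a) = ?c * B (contract v) (contract v)" for v
    using frechet_derivative_eqI[OF has_derivative_mult_right[OF chain[OF schwartz_derivative[OF u, of "contract v"]]], of ?c "expand y + a"]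
    by (simp add: D1 B_def)
  have B2: "B v v' = (\<Sum>l\<in>UNIV. complex_of_real (v' $ l) * B v (axis l 1))" for v v'
  proof -
    have "linear (B v)"
      unfolding B_def using has_derivative_linear[OF schwartz_has_derivative[OF schwartz_derivative[OF u]]] by blast
    then show ?thesis
      by (subst linear_axis_expansion) (simp_all add: scaleR_conv_of_real)
  qed
  have B1: "B v v' = (\<Sum>k\<in>UNIV. complex_of_real (v $ k) * B (axis k 1) v')" for v v'
  proof -
    have e: "frechet_derivative u (at z) v = (\<Sum>k\<in>UNIV. complex_of_real (v $ k) * frechet_derivative u (at z) (axis k 1))" for z
      using has_derivative_linear[OF schwartz_has_derivative[OF u, of z]]
      by (subst linear_axis_expansion) (simp_all add: scaleR_conv_of_real)
    have d: "((\<lambda>z. \<Sum>k\<in>UNIV. complex_of_real (v $ k) * frechet_derivative u (at z) (axis k 1)) has_derivative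
        (\<lambda>v'. \<Sum>k\<in>UNIV. complex_of_real (v $ k) * B (axis k 1) v')) (at y)"
      unfolding B_def
      by (intro has_derivative_sum has_derivative_mult_right schwartz_has_derivative schwartz_derivative u)
    show ?thesis
      unfolding B_def[of v] e frechet_derivative_eqI[OF d] ..
  qed
  have l: "contract (axis i 1) $ k = sqrt (w k) * Q $ i $ k" for i k
    by (simp add: contract_def matrix_vector_mult_def transpose_def axis_def if_distrib cong: if_cong)
  have QQ': "(\<Sum>i\<in>UNIV. Q $ i $ k * Q $ i $ l) = (if k = l then 1 else 0)" for k l
    using arg_cong[OF QQ(1), of "\<lambda>M. M $ k $ l"] by (simp add: matrix_matrix_mult_def transpose_def mat_def)
  have LL: "(\<Sum>i\<in>UNIV. contract (axis i 1) $ k * contract (axis i 1) $ l) = (if k = l then w k else 0)" for k l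
  proof -
    have "(\<Sum>i\<in>UNIV. contract (axis i 1) $ k * contract (axis i 1) $ l) =
        sqrt (w k) * sqrt (w l) * (\<Sum>i\<in>UNIV. Q $ i $ k * Q $ i $ l)"
      unfolding l sum_distrib_left by (intro sum.cong refl) (simp add: mult_ac)
    then show ?thesis using w_pos[of l] by (simp add: QQ')
  qed
  have "(\<Sum>i\<in>UNIV. B (contract (axis i 1)) (contract (axis i 1))) =
      (\<Sum>i\<in>UNIV. \<Sum>k\<in>UNIV. \<Sum>l\<in>UNIV. complex_of_real (contract (axis i 1) $ k * contract (axis i 1) $ l) * B (axis k 1) (axis l 1))"
    by (intro sum.cong refl) (subst B1, subst B2, simp add: sum_distrib_left mult.assoc)
  also have "\<dots> = (\<Sum>k\<in>UNIV. \<Sum>l\<in>UNIV. \<Sum>i\<in>UNIV. complex_of_real (contract (axis i 1) $ k * contract (axis i 1) $ l) * B (axis k 1) (axis l 1))"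
    by (rule trans[OF sum.swap]) (intro sum.cong refl sum.swap)
  also have "\<dots> = (\<Sum>k\<in>UNIV. \<Sum>l\<in>UNIV. complex_of_real (if k = l then w k else 0) * B (axis k 1) (axis l 1))"
    by (simp only: sum_distrib_right[symmetric] of_real_sum[symmetric] LL)
  also have "\<dots> = (\<Sum>k\<in>UNIV. complex_of_real (w k) * B (axis k 1) (axis k 1))"
    by (intro sum.cong refl) (simp add: if_distrib[of complex_of_real] if_distrib[of "\<lambda>x. x * _"] cong: if_cong)
  finally show ?thesis
    by (simp only: laplacian_def D2 sum_distrib_left[symmetric]) (simp add: B_def)
qed

lemma conjugated_schroedinger:
  assumes u: "u \<in> schwartz"
  shows "U (schroedinger h V (Ustar u)) y =
    (\<Sum>j\<in>UNIV. - complex_of_real (h\<^sup>2 / 2 * w j) * pderivs [axis j 1, axis j 1] u y) +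
    complex_of_real (V (expand y + a)) * u y"
proof -
  let ?S = "\<Sum>k\<in>UNIV. complex_of_real (w k) * pderivs [axis k 1, axis k 1] u y"
  have c: "complex_of_real amplitude * complex_of_real (inverse amplitude) = 1"
    using amplitude_pos by (simp flip: of_real_mult)
  have "U (schroedinger h V (Ustar u)) y =
      (complex_of_real amplitude * complex_of_real (inverse amplitude)) * (- complex_of_real (h\<^sup>2 / 2) * ?S + complex_of_real (V (expand y + a)) * u y)"
    unfolding U_def schroedinger_def laplacian_Ustar[OF u] Ustar_def[of u "expand y + a"] inverse_affine
    by (simp only: distrib_left mult_ac)
  also have "\<dots> = - complex_of_real (h\<^sup>2 / 2) * ?S + complex_of_real (V (expand y + a)) * u y"
    by (simp only: c mult_1)
  also have "- complex_of_real (h\<^sup>2 / 2) * ?S = (\<Sum>j\<in>UNIV. - complex_of_real (h\<^sup>2 / 2 * w j) * pderivs [axis j 1, axis j 1] u y)"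
    by (simp only: sum_distrib_left of_real_mult mult.assoc mult_minus_left)
  finally show ?thesis .
qed

lemma conjugated_weyl_symbol:
  assumes "h > 0" "tempered V"
    and "\<And>x \<xi>. s x \<xi> h = complex_of_real ((\<Sum>j\<in>UNIV. w j / 2 * (\<xi> $ j)\<^sup>2) + V (expand x + a))"
  shows "has_weyl_symbol h (\<lambda>u. U (schroedinger h V (Ustar u))) s"
  by (rule has_weyl_symbol_quadratic[OF assms(1) tempered_affine[OF linear_expand assms(2)]])
     (rule conjugated_schroedinger, assumption, rule assms(3))

end

section \<open>Weighted Taylor coefficients\<close>

lemma list_with_counts:
  assumes "finite B"
  shows "\<exists>vs. set vs \<subseteq> B \<and> (\<forall>b\<in>B. count_list vs b = c b)"
  using assms
proof (induction B rule: finite_induct)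
  case (insert b B)
  then obtain vs where vs: "set vs \<subseteq> B" "\<forall>b\<in>B. count_list vs b = c b" by blast
  have "count_list (replicate n b) b' = (if b = b' then n else 0)" for n and b' :: 'a
    by (induction n) auto
  moreover have "count_list vs b = 0" using vs insert.hyps by (auto simp: count_list_0_iff)
  ultimately show ?case
    using vs insert.hyps by (intro exI[of _ "replicate (c b) b @ vs"]) (auto simp: set_replicate_conv_if)
qed simp

lemma Basis_point:
  "(Basis :: 'n::finite point set) = range (\<lambda>i. (axis i 1, 0, 0, 0)) \<union> range (\<lambda>i. (0, axis i 1, 0, 0)) \<union>
     {(0, 0, 1, 0), (0, 0, 0, 1)}"
  by (auto simp: Basis_prod_def Basis_vec_def zero_prod_def image_iff)

text \<open>\<open>directions\<close> is a choice, so a list with the prescribed counts has to be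
  exhibited first. The length counts \<open>h\<close> once whereas \<open>deg\<close> counts it
  twice: the order of differentiation never exceeds the weighted degree.\<close>

lemma directions_props:
  fixes \<alpha> \<beta> :: "'n::finite \<Rightarrow> nat" and m l :: nat
  defines "vs \<equiv> directions (\<alpha>, \<beta>, m, l)"
  shows "set vs \<subseteq> Basis" "count_list vs (0, 0, 0, 1) = l"
    "length vs = (\<Sum>i\<in>UNIV. \<alpha> i) + (\<Sum>i\<in>UNIV. \<beta> i) + m + l"
proof -
  let ?X = "\<lambda>i. (axis i 1, 0, 0, 0) :: 'n point" and ?Y = "\<lambda>i. (0, axis i 1, 0, 0) :: 'n point"
  let ?e = "(0, 0, 1, 0) :: 'n point" and ?h = "(0, 0, 0, 1) :: 'n point"
  have ne: "axis i (1::real) \<noteq> (0::real^'n)" "(0::real^'n) \<noteq> axis i 1" for i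
    by (auto simp: axis_def vec_eq_iff)
  define c where "c b = (if b = ?e then m else if b = ?h then l
     else if \<exists>i. b = ?X i then \<alpha> (SOME i. b = ?X i) else \<beta> (SOME i. b = ?Y i))" for b
  have "(SOME i'. axis i (1::real) = axis i' 1) = i" for i :: 'n
    by (rule some_equality) (auto simp: axis_eq_axis)
  then have cX: "c (?X i) = \<alpha> i" and cY: "c (?Y i) = \<beta> i" for i
    using ne by (auto simp: c_def)
  have ceh: "c ?e = m" "c ?h = l" by (auto simp: c_def)
  obtain ws where ws: "set ws \<subseteq> (Basis :: 'n point set)" "\<forall>b\<in>Basis. count_list ws b = c b"
    using list_with_counts[of "Basis :: 'n point set" c] by auto
  have wsc: "count_list ws (?X i) = \<alpha> i" "count_list ws (?Y i) = \<beta> i" "count_list ws ?e = m" "count_list ws ?h = l" for i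
    using ws(2) cX cY ceh by (auto simp: Basis_point)
  have vs: "set vs \<subseteq> Basis \<and> (\<forall>i. count_list vs (?X i) = \<alpha> i) \<and> (\<forall>i. count_list vs (?Y i) = \<beta> i) \<and>
     count_list vs ?e = m \<and> count_list vs ?h = l"
    unfolding vs_def directions_def prod.case by (rule someI[of _ ws]) (use ws(1) wsc in blast)
  then show "set vs \<subseteq> Basis" "count_list vs ?h = l" by auto
  have "length vs = (\<Sum>b\<in>Basis. count_list vs b)"
    using vs by (intro sum_count_set[symmetric]) auto
  also have "\<dots> = (\<Sum>b\<in>range ?X \<union> range ?Y. count_list vs b) + (\<Sum>b\<in>{?e, ?h}. count_list vs b)"
    unfolding Basis_point by (rule sum.union_disjoint) (use ne in auto)
  also have "(\<Sum>b\<in>range ?X \<union> range ?Y. count_list vs b) = (\<Sum>b\<in>range ?X. count_list vs b) + (\<Sum>b\<in>range ?Y. count_list vs b)"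
    by (rule sum.union_disjoint) (use ne in auto)
  also have "(\<Sum>b\<in>range ?X. count_list vs b) = (\<Sum>i\<in>UNIV. \<alpha> i)"
    using vs by (subst sum.reindex) (auto simp: inj_on_def axis_eq_axis)
  also have "(\<Sum>b\<in>range ?Y. count_list vs b) = (\<Sum>i\<in>UNIV. \<beta> i)"
    using vs by (subst sum.reindex) (auto simp: inj_on_def axis_eq_axis)
  finally show "length vs = (\<Sum>i\<in>UNIV. \<alpha> i) + (\<Sum>i\<in>UNIV. \<beta> i) + m + l"
    using vs by simp
qed

lemma pderivs_complex_of_real:
  fixes f :: "'a::euclidean_space \<Rightarrow> real"
  assumes "smooth_on S f" "open S" "set vs \<subseteq> Basis" "x \<in> S"
  shows "pderivs vs (\<lambda>x. complex_of_real (f x)) x = complex_of_real (pderivs vs f x)"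
  using assms(3,4)
proof (induction vs arbitrary: x)
  case (Cons v vs)
  have sm: "smooth_on S (pderivs vs f)" using smooth_on_pderivs[OF assms(1)] Cons.prems by simp
  have "frechet_derivative (pderivs vs (\<lambda>x. complex_of_real (f x))) (at x) =
      frechet_derivative (\<lambda>x. complex_of_real (pderivs vs f x)) (at x)"
    by (rule frechet_derivative_cong_open[OF assms(2) Cons.prems(2)]) (use Cons in auto)
  also have "\<dots> = (\<lambda>v. complex_of_real (frechet_derivative (pderivs vs f) (at x) v))"
    by (intro frechet_derivative_eqI bounded_linear.has_derivative[OF bounded_linear_of_real] smooth_onD(2)[OF sm] Cons.prems)
  finally show ?case by simp
qed simp

text \<open>Hadamard's lemma is applied twice. Away from 0 each quotient inherits the bound with one
  power less, and continuity then forces its value at 0 to vanish.\<close>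

lemma smooth_near_0_cubic:
  fixes f :: "real \<Rightarrow> real"
  assumes f: "smooth_on {-d<..<d} f" and d: "d > 0" and bound: "\<And>t. \<bar>t\<bar> < d \<Longrightarrow> \<bar>f t\<bar> \<le> C * \<bar>t\<bar> ^ 3"
  shows "\<exists>g. smooth_on {-d<..<d} g \<and> g 0 = 0 \<and> (\<forall>t. \<bar>t\<bar> < d \<longrightarrow> f t = t * (t * g t))"
proof -
  have lim: "g 0 = 0" if g: "smooth_on {-d<..<d} g" and b: "\<And>t. \<bar>t\<bar> < d \<Longrightarrow> t \<noteq> 0 \<Longrightarrow> \<bar>g t\<bar> \<le> C * \<bar>t\<bar> ^ n" "n > 0" for g :: "real \<Rightarrow> real" and n
  proof -
    have "isCont g 0"
      using smooth_onD(1)[OF g, of 0] d differentiable_imp_continuous_within by auto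
    then have "((\<lambda>t. \<bar>g t\<bar>) \<longlongrightarrow> \<bar>g 0\<bar>) (at 0)" by (intro tendsto_rabs) (simp add: isCont_def)
    moreover have "((\<lambda>t. C * \<bar>t\<bar> ^ n) \<longlongrightarrow> C * \<bar>0\<bar> ^ n) (at 0)" by (intro tendsto_intros)
    moreover have "\<forall>\<^sub>F t in at 0. \<bar>g t\<bar> \<le> C * \<bar>t\<bar> ^ n"
      using d b(1) by (auto simp: eventually_at dist_real_def)
    ultimately have "\<bar>g 0\<bar> \<le> C * \<bar>0\<bar> ^ n" by (intro tendsto_le[OF _ _ _, of "at 0"]) auto
    with b(2) show ?thesis by (simp add: power_0_left)
  qed
  have "f 0 = 0" using bound[of 0] d by simp
  then obtain g1 where g1: "smooth_on {-d<..<d} g1" "\<And>t. \<bar>t\<bar> < d \<Longrightarrow> f t = t * g1 t"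
    using smooth_divide_by_argument[OF f] by blast
  have "\<bar>g1 t\<bar> \<le> C * \<bar>t\<bar> ^ 2" if "\<bar>t\<bar> < d" "t \<noteq> 0" for t
    using bound[OF that(1)] that(2) unfolding g1(2)[OF that(1)] by (simp add: abs_mult power3_eq_cube power2_eq_square)
  from lim[OF g1(1) this] have "g1 0 = 0" by simp
  then obtain g2 where g2: "smooth_on {-d<..<d} g2" "\<And>t. \<bar>t\<bar> < d \<Longrightarrow> g1 t = t * g2 t"
    using smooth_divide_by_argument[OF g1(1)] by blast
  have "\<bar>g2 t\<bar> \<le> C * \<bar>t\<bar> ^ 1" if "\<bar>t\<bar> < d" "t \<noteq> 0" for t
  proof (rule mult_left_le_imp_le[of "\<bar>t\<bar>\<^sup>2"])
    have "\<bar>t * (t * g2 t)\<bar> = \<bar>t\<bar>\<^sup>2 * \<bar>g2 t\<bar>" by (simp only: abs_mult power2_eq_square mult.assoc)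
    moreover have "C * \<bar>t\<bar> ^ 3 = \<bar>t\<bar>\<^sup>2 * (C * \<bar>t\<bar> ^ 1)" by (simp only: power3_eq_cube power2_eq_square power_one_right mult_ac)
    ultimately show "\<bar>t\<bar>\<^sup>2 * \<bar>g2 t\<bar> \<le> \<bar>t\<bar>\<^sup>2 * (C * \<bar>t\<bar> ^ 1)"
      using bound[OF that(1)] unfolding g1(2)[OF that(1)] g2(2)[OF that(1)] by (simp only:)
  qed (use that in simp)
  from lim[OF g2(1) this] have "g2 0 = 0" by simp
  with g1 g2 show ?thesis by (intro exI[of _ g2]) auto
qed

text \<open>With \<open>f t = t * (t * g t)\<close> and \<open>g 0 = 0\<close> the first two
  derivatives at 0 can be read off from the product rule.\<close>

lemma cubic_imp_derivatives_vanish_1d: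
  fixes f f' :: "real \<Rightarrow> real"
  assumes f: "smooth_on {-d<..<d} f" and d: "d > 0" and bound: "\<And>t. \<bar>t\<bar> < d \<Longrightarrow> \<bar>f t\<bar> \<le> C * \<bar>t\<bar> ^ 3"
    and f': "\<And>t. \<bar>t\<bar> < d \<Longrightarrow> (f has_real_derivative f' t) (at t)"
    and f'': "(f' has_real_derivative f'') (at 0)"
  shows "f' 0 = 0" "f'' = 0"
proof -
  obtain g where g: "smooth_on {-d<..<d} g" "g 0 = 0" "\<And>t. \<bar>t\<bar> < d \<Longrightarrow> f t = t * (t * g t)"
    using smooth_near_0_cubic[OF f d bound] by blast
  obtain D where D: "D 0 = g" "\<And>n x. x \<in> {-d<..<d} \<Longrightarrow> (D n has_vector_derivative D (Suc n) x) (at x)"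
    by (rule smooth_on_1d_derivs[OF g(1)]) blast
  have g': "(g has_real_derivative D 1 t) (at t)" "(D 1 has_real_derivative D 2 t) (at t)" if "\<bar>t\<bar> < d" for t
  proof -
    have t: "t \<in> {-d<..<d}" using that by auto
    show "(g has_real_derivative D 1 t) (at t)" "(D 1 has_real_derivative D 2 t) (at t)"
      using D(2)[OF t, of 0] D(2)[OF t, of 1] by (simp_all add: D(1) has_real_derivative_iff_has_vector_derivative numeral_2_eq_2)
  qed
  have eq: "f' t = 2 * t * g t + t\<^sup>2 * D 1 t" if t: "\<bar>t\<bar> < d" for t
  proof -
    have "((\<lambda>t. t * (t * g t)) has_real_derivative 2 * t * g t + t\<^sup>2 * D 1 t) (at t)"
      using g'(1)[OF t] by (auto intro!: derivative_eq_intros simp: power2_eq_square algebra_simps)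
    then have "(f has_real_derivative 2 * t * g t + t\<^sup>2 * D 1 t) (at t)"
      by (rule has_field_derivative_transform_within_open[of _ _ _ "{-d<..<d}"]) (use t g(3) in auto)
    with f'[OF t] show ?thesis by (rule DERIV_unique)
  qed
  then show "f' 0 = 0" using d by simp
  have "((\<lambda>t. 2 * t * g t + t\<^sup>2 * D 1 t) has_real_derivative 0) (at 0)"
    using g'[of 0] d g(2) by (auto intro!: derivative_eq_intros)
  then have "(f' has_real_derivative 0) (at 0)"
    by (rule has_field_derivative_transform_within_open[of _ _ _ "{-d<..<d}"]) (use d eq in auto)
  with f'' show "f'' = 0" by (rule DERIV_unique)
qed

text \<open>Restriction to lines through 0 reduces to one variable and kills the first derivative
  and the second derivative along a single direction. Polarization, with the symmetry of second
  derivatives, gives the mixed ones.\<close>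

lemma cubic_imp_pderivs_vanish:
  fixes f :: "'a::euclidean_space \<Rightarrow> real"
  assumes f: "smooth_on S f" "open S" "0 \<in> S" and d: "d > 0" and bound: "\<And>p. norm p < d \<Longrightarrow> \<bar>f p\<bar> \<le> C * norm p ^ 3"
    and vs: "length vs \<le> 2"
  shows "pderivs vs f 0 = 0"
proof -
  obtain d' where d': "d' > 0" "ball 0 d' \<subseteq> S" using f(2,3) open_contains_ball by blast
  define B where "B v w = frechet_derivative (\<lambda>z. frechet_derivative f (at z) v) (at 0) w" for v w
  have 1: "frechet_derivative f (at 0) u = 0" "B u u = 0" for u
  proof -
    define r where "r = min d d' / (norm u + 1)"
    have r: "r > 0" using d d' by (simp add: r_def add_nonneg_pos)
    have tr: "norm (t *\<^sub>R u) < min d d'" if "\<bar>t\<bar> < r" for t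
    proof -
      have "norm (t *\<^sub>R u) \<le> \<bar>t\<bar> * (norm u + 1)" by (simp add: mult_left_mono)
      also have "\<dots> < r * (norm u + 1)" using that by (intro mult_strict_right_mono) (auto simp: add_nonneg_pos)
      also have "\<dots> = min d d'"
      proof -
        have "norm u + 1 \<noteq> 0" using norm_ge_zero[of u] by linarith
        then show ?thesis by (simp add: r_def)
      qed
      finally show ?thesis .
    qed
    then have inS: "t *\<^sub>R u \<in> S" if "\<bar>t\<bar> < r" for t using d'(2) that by fastforce
    have sm: "smooth_on {-r<..<r} (\<lambda>t. f (t *\<^sub>R u))"
      by (rule smooth_on_compose[OF f(1)]) (use inS in \<open>auto intro!: smooth_on_scaleR\<close>)
    have b: "\<bar>f (t *\<^sub>R u)\<bar> \<le> (C * norm u ^ 3) * \<bar>t\<bar> ^ 3" if "\<bar>t\<bar> < r" for t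
      using bound[of "t *\<^sub>R u"] tr[OF that] by (simp add: power_mult_distrib mult_ac)
    have D1: "((\<lambda>t. f (t *\<^sub>R u)) has_real_derivative frechet_derivative f (at (t *\<^sub>R u)) u) (at t)" if "\<bar>t\<bar> < r" for t
      using has_derivative_along_line[of f 0 t u] smooth_onD(1)[OF f(1) inS[OF that]]
      by (simp add: has_real_derivative_iff_has_vector_derivative)
    have D2: "((\<lambda>t. frechet_derivative f (at (t *\<^sub>R u)) u) has_real_derivative B u u) (at 0)"
      using has_derivative_along_line[of "\<lambda>z. frechet_derivative f (at z) u" 0 0 u]
        smooth_onD(1)[OF smooth_on_directional[OF f(1,2)] f(3)]
      by (simp add: has_real_derivative_iff_has_vector_derivative B_def)
    from cubic_imp_derivatives_vanish_1d[OF sm r b D1 D2]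
    show "frechet_derivative f (at 0) u = 0" "B u u = 0" by auto
  qed
  have lin: "linear (B v)" for v
    unfolding B_def by (intro frechet_derivative_linear smooth_onD(1)[OF smooth_on_directional[OF f(1,2)] f(3)])
  have sym: "B v w = B w v" for v w
    unfolding B_def by (rule frechet_derivative_commute[OF f])
  have "B (v + w) (v + w) = B v v + B v w + (B v w + B w w)" for v w
    using linear_add[OF lin, of "v + w" v w] sym[of "v + w" v] sym[of "v + w" w] linear_add[OF lin, of v v w] linear_add[OF lin, of w v w] sym[of w v]
    by simp
  then have 2: "B v w = 0" for v w using 1(2)[of "v + w"] 1(2)[of v] 1(2)[of w] by simp
  have 0: "f 0 = 0" using bound[of 0] d by simp
  consider "vs = []" | v where "vs = [v]" | v w where "vs = [w, v]"
    using vs by (cases vs; cases "tl vs") auto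
  then show ?thesis using 0 1(1) 2 by cases (auto simp: B_def)
qed

lemma belongs_to_O3:
  fixes f :: "'n::finite point \<Rightarrow> real"
  assumes f: "smooth_on S f" "open S" "0 \<in> S" and d: "d > 0" and bound: "\<And>p. norm p < d \<Longrightarrow> \<bar>f p\<bar> \<le> C * norm p ^ 3"
  shows "belongs_to (\<lambda>p. complex_of_real (f p)) (O_space 3)"
  unfolding belongs_to_def
proof
  show "\<exists>S. open S \<and> 0 \<in> S \<and> smooth_on S (\<lambda>p. complex_of_real (f p))"
    using f by (intro exI[of _ S]) (auto intro: smooth_on_of_real)
  show "taylor_series (\<lambda>p. complex_of_real (f p)) \<in> O_space 3"
    unfolding O_space_def
  proof (intro CollectI allI impI)
    fix e :: "'n exponent" assume e: "deg e < 3"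
    obtain \<alpha> \<beta> m l where eq: "e = (\<alpha>, \<beta>, m, l)" by (cases e)
    have "length (directions e) \<le> 2" using e directions_props(3)[of \<alpha> \<beta> m l] by (simp add: eq deg_def)
    from cubic_imp_pderivs_vanish[OF f d bound this]
    have "pderivs (directions e) (\<lambda>p. complex_of_real (f p)) 0 = 0"
      using pderivs_complex_of_real[OF f(1,2) _ f(3)] directions_props(1)[of \<alpha> \<beta> m l] by (simp add: eq)
    then show "taylor_series (\<lambda>p. complex_of_real (f p)) e = 0" by (simp add: taylor_series_def eq)
  qed
qed

section \<open>Taylor coefficients of quadratic forms\<close>

lemma pderivs_const: "vs \<noteq> [] \<Longrightarrow> pderivs vs (\<lambda>_. c) = (\<lambda>_. 0)"
proof (induction vs arbitrary: c rule: rev_induct)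
  case (snoc v vs)
  then show ?case
    by (cases "vs = []") (auto simp: pderivs_snoc frechet_derivative_const)
qed simp

lemma pderivs_quadratic:
  fixes \<beta> :: "'a::euclidean_space \<Rightarrow> 'a \<Rightarrow> real"
  assumes \<beta>: "bounded_bilinear \<beta>" "\<And>p q. \<beta> p q = \<beta> q p"
  shows "length vs \<noteq> 2 \<Longrightarrow> pderivs vs (\<lambda>p. \<beta> p p) 0 = 0"
    "pderivs [w, v] (\<lambda>p. \<beta> p p) = (\<lambda>_. 2 * \<beta> w v)"
proof -
  have D1: "frechet_derivative (\<lambda>p. \<beta> p p) (at p) v = 2 * \<beta> p v" for p v
    using frechet_derivative_eqI[OF bounded_bilinear.FDERIV[OF \<beta>(1) has_derivative_ident has_derivative_ident, of p UNIV]] \<beta>(2)[of v p]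
    by simp
  have "((\<lambda>p. \<beta> p v) has_derivative (\<lambda>w. \<beta> w v)) (at p)" for p v
    by (rule bounded_linear_imp_has_derivative[OF bounded_bilinear.bounded_linear_left[OF \<beta>(1)]])
  then have D0: "((\<lambda>p. 2 * \<beta> p v) has_derivative (\<lambda>w. 2 * \<beta> w v)) (at p)" for p v
    by (rule has_derivative_mult_right)
  have D2: "frechet_derivative (\<lambda>p. 2 * \<beta> p v) (at p) w = 2 * \<beta> w v" for p v w
    using fun_cong[OF frechet_derivative_eqI[OF D0]] .
  show *: "pderivs [w, v] (\<lambda>p. \<beta> p p) = (\<lambda>_. 2 * \<beta> w v)" for w v
    by (simp add: D1 D2)
  have z: "\<beta> 0 v = 0" for v by (rule bounded_bilinear.zero_left[OF \<beta>(1)])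
  assume vs: "length vs \<noteq> 2"
  show "pderivs vs (\<lambda>p. \<beta> p p) 0 = 0"
  proof (cases vs rule: rev_cases)
    case (snoc us v)
    show ?thesis
    proof (cases us rule: rev_cases)
      case (snoc us' w)
      with vs \<open>vs = us @ [v]\<close> have "us' \<noteq> []" by auto
      have "vs = us' @ [w, v]" using snoc \<open>vs = us @ [v]\<close> by simp
      then show ?thesis by (simp only: pderivs_append * pderivs_const[OF \<open>us' \<noteq> []\<close>])
    qed (use snoc in \<open>simp add: D1 z\<close>)
  qed (simp add: z)
qed

text \<open>Only derivatives of order 2 survive at the origin. A monomial of order 2 has weighted
  degree 2 unless it contains \<open>h\<close>, and the hypothesis \<open>h\<close> excludes that
  variable.\<close>

lemma belongs_to_D2:
  fixes \<beta> :: "'n::finite point \<Rightarrow> 'n point \<Rightarrow> real"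
  assumes \<beta>: "bounded_bilinear \<beta>" "\<And>p q. \<beta> p q = \<beta> q p" and h: "\<And>p. \<beta> p (0, 0, 0, 1) = 0"
  shows "belongs_to (\<lambda>p. complex_of_real (\<beta> p p)) (D_space 2)"
  unfolding belongs_to_def
proof
  have sm: "smooth_on UNIV (\<lambda>p. \<beta> p p)" by (intro smooth_on_bilinear[OF \<beta>(1)]) auto
  then show "\<exists>S. open S \<and> 0 \<in> S \<and> smooth_on S (\<lambda>p. complex_of_real (\<beta> p p))"
    by (intro exI[of _ UNIV]) (auto intro: smooth_on_of_real)
  show "taylor_series (\<lambda>p. complex_of_real (\<beta> p p)) \<in> D_space 2"
    unfolding D_space_def
  proof (intro CollectI allI impI)
    fix e :: "'n exponent" assume e: "deg e \<noteq> 2"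
    obtain \<alpha> \<beta>' m l where eq: "e = (\<alpha>, \<beta>', m, l)" by (cases e)
    note P = directions_props[of \<alpha> \<beta>' m l]
    have "pderivs (directions e) (\<lambda>p. \<beta> p p) 0 = 0"
    proof (cases "length (directions e) = 2")
      case False
      then show ?thesis by (rule pderivs_quadratic(1)[OF \<beta>])
    next
      case True
      then have "l \<noteq> 0" using e P(3) by (auto simp: eq deg_def)
      then have "(0, 0, 0, 1) \<in> set (directions e)" using P(2) unfolding eq by (metis count_list_0_iff)
      moreover obtain w v where wv: "directions e = [w, v]"
        using True by (auto simp: numeral_2_eq_2 length_Suc_conv)
      ultimately have "w = (0, 0, 0, 1) \<or> v = (0, 0, 0, 1)" by auto
      then have "\<beta> w v = 0" using h[of w] h[of v] \<beta>(2)[of w v] by metis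
      then show ?thesis unfolding wv pderivs_quadratic(2)[OF \<beta>] by simp
    qed
    then have "pderivs (directions e) (\<lambda>p. complex_of_real (\<beta> p p)) 0 = 0"
      using pderivs_complex_of_real[OF sm open_UNIV] P(1) by (simp add: eq)
    then show "taylor_series (\<lambda>p. complex_of_real (\<beta> p p)) e = 0" by (simp add: taylor_series_def eq)
  qed
qed

section \<open>Families of functions, Hessians and Taylor expansion\<close>

text \<open>Derivatives in \<open>x\<close> of a single member of the family are derivatives of the
  joint function. This transfers joint smoothness to the gradient and to the Hessian as functions of
  the parameter.\<close>

lemma pderivs_slice:
  fixes V :: "real \<Rightarrow> 'a::euclidean_space \<Rightarrow> real"
  assumes V: "smooth_on UNIV (\<lambda>(e, x). V e x)" and "set vs \<subseteq> Basis"
  shows "pderivs vs (V e) x = pderivs (map (Pair 0) vs) (\<lambda>(e, x). V e x) (e, x)"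
  using assms(2)
proof (induction vs arbitrary: x)
  case (Cons v vs)
  let ?g = "pderivs (map (Pair 0) vs) (\<lambda>(e, x). V e x)"
  have "set (map (Pair (0::real)) vs) \<subseteq> Basis" using Cons.prems by (auto simp: Basis_prod_def)
  then have sm: "smooth_on UNIV ?g" by (rule smooth_on_pderivs[OF V])
  have "pderivs vs (V e) = (\<lambda>x. ?g (e, x))" using Cons by auto
  moreover have "((\<lambda>x. ?g (e, x)) has_derivative (\<lambda>v. frechet_derivative ?g (at (e, x)) (0, v))) (at x)"
  proof -
    have "((\<lambda>x. (e, x)) has_derivative (\<lambda>v. (0, v))) (at x)" by (auto intro!: derivative_eq_intros)
    from diff_chain_at[OF this smooth_onD(2)[OF sm, of "(e, x)"]] show ?thesis by (simp add: o_def)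
  qed
  ultimately show ?case by (simp add: frechet_derivative_eqI)
qed simp

lemma smooth_on_slice: 
  assumes "smooth_on UNIV (\<lambda>(e, x). V e x)"
  shows "smooth_on UNIV (V (e::real) :: 'a::euclidean_space \<Rightarrow> real)"
proof -
  have "smooth_on UNIV (\<lambda>x. (\<lambda>(e, x). V e x) (e, x))"
    by (rule smooth_on_compose[OF assms]) (auto intro!: smooth_on_Pair)
  then show ?thesis by simp
qed

lemma hessian_form:
  fixes f :: "real^'n \<Rightarrow> real"
  assumes f: "smooth_on UNIV f"
  shows "frechet_derivative (\<lambda>z. frechet_derivative f (at z) v) (at x) w = w \<bullet> (hessian f x *v v)"
proof -
  have lin: "linear (frechet_derivative f (at z))" for z
    by (intro frechet_derivative_linear smooth_onD(1)[OF f]) simp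
  have sm: "smooth_on UNIV (\<lambda>z. frechet_derivative f (at z) u)" for u
    by (rule smooth_on_directional[OF f]) simp
  have "(\<lambda>z. frechet_derivative f (at z) v) = (\<lambda>z. \<Sum>j\<in>UNIV. v $ j *\<^sub>R frechet_derivative f (at z) (axis j 1))"
    by (intro ext linear_axis_expansion lin)
  moreover have "((\<lambda>z. \<Sum>j\<in>UNIV. v $ j *\<^sub>R frechet_derivative f (at z) (axis j 1)) has_derivative
      (\<lambda>w. \<Sum>j\<in>UNIV. v $ j *\<^sub>R frechet_derivative (\<lambda>z. frechet_derivative f (at z) (axis j 1)) (at x) w)) (at x)"
    by (intro has_derivative_sum has_derivative_scaleR_right smooth_onD(2)[OF sm]) simp
  ultimately have "frechet_derivative (\<lambda>z. frechet_derivative f (at z) v) (at x) w =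
      (\<Sum>j\<in>UNIV. v $ j *\<^sub>R frechet_derivative (\<lambda>z. frechet_derivative f (at z) (axis j 1)) (at x) w)"
    by (simp add: frechet_derivative_eqI)
  also have "\<dots> = (\<Sum>j\<in>UNIV. v $ j *\<^sub>R (\<Sum>i\<in>UNIV. w $ i *\<^sub>R hessian f x $ i $ j))"
  proof (intro sum.cong refl arg_cong[where f = "(*\<^sub>R) _"])
    fix j
    have "linear (frechet_derivative (\<lambda>z. frechet_derivative f (at z) (axis j 1)) (at x))"
      by (intro frechet_derivative_linear smooth_onD(1)[OF sm]) simp
    from linear_axis_expansion[OF this, of w]
    show "frechet_derivative (\<lambda>z. frechet_derivative f (at z) (axis j 1)) (at x) w = (\<Sum>i\<in>UNIV. w $ i *\<^sub>R hessian f x $ i $ j)"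
      by (simp add: hessian_def)
  qed
  also have "\<dots> = (\<Sum>j\<in>UNIV. \<Sum>i\<in>UNIV. w $ i * (hessian f x $ i $ j * v $ j))"
    by (simp add: sum_distrib_left mult_ac)
  also have "\<dots> = w \<bullet> (hessian f x *v v)"
    by (subst sum.swap) (simp add: inner_vec_def matrix_vector_mult_def sum_distrib_left)
  finally show ?thesis .
qed

lemma hessian_symmetric:
  fixes f :: "real^'n \<Rightarrow> real"
  assumes "smooth_on UNIV f"
  shows "transpose (hessian f x) = hessian f x"
  using frechet_derivative_commute[OF assms open_UNIV UNIV_I]
  by (simp add: hessian_def transpose_def vec_eq_iff)

text \<open>The third-order remainder is the third derivative of \<open>t \<mapsto> V\<^sub>e (a + t y)\<close> for unit vectors \<open>y\<close>, which
  is bounded on compact sets because it is a partial derivative of a smooth function of \<open>(e, a, y, t)\<close>.\<close>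

lemma uniform_taylor_at_minimum:
  fixes V :: "real \<Rightarrow> real^'n \<Rightarrow> real"
  assumes V: "smooth_on UNIV (\<lambda>(e, x). V e x)"
  obtains K where "K \<ge> 0" "\<And>e a y. \<bar>e\<bar> \<le> s \<Longrightarrow> norm a \<le> r \<Longrightarrow> norm y \<le> 1 \<Longrightarrow> \<forall>z. V e a \<le> V e z \<Longrightarrow>
    \<bar>V e (a + y) - V e a - (1/2) * (y \<bullet> (hessian (V e) a *v y))\<bar> \<le> K * norm y ^ 3"
proof -
  define G where "G p = V (fst p) (fst (snd p) + snd (snd (snd p)) *\<^sub>R fst (snd (snd p)))"
    for p :: "real \<times> (real^'n) \<times> (real^'n) \<times> real"
  let ?t = "(0, 0, 0, 1) :: real \<times> (real^'n) \<times> (real^'n) \<times> real"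
  have G: "smooth_on UNIV G"
  proof -
    have "smooth_on UNIV (\<lambda>p :: real \<times> (real^'n) \<times> (real^'n) \<times> real.
        (\<lambda>(e, x). V e x) (fst p, fst (snd p) + snd (snd (snd p)) *\<^sub>R fst (snd (snd p))))"
      by (rule smooth_on_compose[OF V])
         (auto intro!: smooth_on_Pair smooth_on_add smooth_on_scaleR smooth_on_fst smooth_on_snd)
    then show ?thesis by (simp add: G_def[abs_def])
  qed
  define D where "D m = pderivs (replicate m ?t) G" for m
  have Dsm: "smooth_on UNIV (D m)" for m
    unfolding D_def by (rule smooth_on_pderivs[OF G]) (auto simp: Basis_prod_def)
  have DD: "((\<lambda>t. D m (e, a, y, t)) has_real_derivative D (Suc m) (e, a, y, t)) (at t)" for m e a y t
    using has_derivative_along_line[of "D m" "(e, a, y, 0)" t ?t] smooth_onD(1)[OF Dsm]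
    by (simp add: has_real_derivative_iff_has_vector_derivative D_def)
  have "compact ({-s..s} \<times> cball (0::real^'n) r \<times> cball (0::real^'n) 1 \<times> {0..1::real})"
    by (intro compact_Times) auto
  moreover have "continuous_on ({-s..s} \<times> cball (0::real^'n) r \<times> cball (0::real^'n) 1 \<times> {0..1::real}) (D 3)"
    using smooth_on_imp_continuous_on[OF Dsm] continuous_on_subset by blast
  ultimately have "bounded (D 3 ` ({-s..s} \<times> cball (0::real^'n) r \<times> cball (0::real^'n) 1 \<times> {0..1::real}))"
    by (intro compact_imp_bounded compact_continuous_image)
  then obtain K where K: "\<And>p. p \<in> {-s..s} \<times> cball (0::real^'n) r \<times> cball (0::real^'n) 1 \<times> {0..1::real} \<Longrightarrow> \<bar>D 3 p\<bar> \<le> K"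
    unfolding bounded_iff by (metis imageI real_norm_def)
  \<comment> \<open>The absolute value makes the constant nonnegative also when the parameter box is
    empty and \<open>K\<close> is arbitrary.\<close>
  show ?thesis
  proof (rule that[of "\<bar>K\<bar>"])
    fix e a and y :: "real^'n"
    assume e: "\<bar>e\<bar> \<le> s" and a: "norm a \<le> r" and y: "norm y \<le> 1" and min: "\<forall>z. V e a \<le> V e z"
    show "\<bar>V e (a + y) - V e a - (1/2) * (y \<bullet> (hessian (V e) a *v y))\<bar> \<le> \<bar>K\<bar> * norm y ^ 3"
    proof (cases "y = 0")
      case False
      define h where "h = norm y"
      define u where "u = inverse h *\<^sub>R y"
      have h: "0 < h" "h \<le> 1" using y False by (auto simp: h_def)
      have u: "norm u = 1" "y = h *\<^sub>R u" using h by (auto simp: u_def h_def)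
      let ?d = "\<lambda>m t. D m (e, a, u, t)"
      obtain t where t: "0 < t" "t < h" "?d 0 h = (\<Sum>m<3. ?d m 0 / fact m * h ^ m) + ?d 3 t / fact 3 * h ^ 3"
        using Maclaurin[of h 3 ?d "?d 0"] h DD by auto
      have d0: "?d 0 t = V e (a + t *\<^sub>R u)" for t by (simp add: D_def G_def)
      have d1: "?d 1 0 = 0"
      proof (rule DERIV_local_min[of "?d 0" _ 0 1])
        show "(?d 0 has_real_derivative ?d 1 0) (at 0)" using DD[of 0] by simp
        show "\<forall>y. \<bar>0 - y\<bar> < 1 \<longrightarrow> ?d 0 0 \<le> ?d 0 y" using min by (simp add: d0)
      qed simp
      have d2: "?d 2 0 = u \<bullet> (hessian (V e) a *v u)"
      proof -
        have sm: "smooth_on UNIV (V e)" by (rule smooth_on_slice[OF V])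
        have "((\<lambda>t. V e (a + t *\<^sub>R u)) has_real_derivative frechet_derivative (V e) (at (a + t *\<^sub>R u)) u) (at t)" for t
          unfolding has_real_derivative_iff_has_vector_derivative
          by (intro has_derivative_along_line smooth_onD(1)[OF sm]) simp
        moreover have "((\<lambda>t. V e (a + t *\<^sub>R u)) has_real_derivative ?d 1 t) (at t)" for t
          using DD[of 0 e a u t] by (simp add: d0)
        ultimately have d1_eq: "?d 1 = (\<lambda>t. frechet_derivative (V e) (at (a + t *\<^sub>R u)) u)"
          by (intro ext) (rule DERIV_unique)
        have "((\<lambda>t. frechet_derivative (V e) (at (a + t *\<^sub>R u)) u) has_real_derivative u \<bullet> (hessian (V e) a *v u)) (at 0)"
          using has_derivative_along_line[of "\<lambda>z. frechet_derivative (V e) (at z) u" a 0 u]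
            smooth_onD(1)[OF smooth_on_directional[OF sm]]
          by (simp add: has_real_derivative_iff_has_vector_derivative hessian_form[OF sm])
        moreover have "(?d 1 has_real_derivative ?d 2 0) (at 0)" using DD[of 1] by (simp add: numeral_2_eq_2)
        ultimately show ?thesis unfolding d1_eq by (intro DERIV_unique)
      qed
      have "V e (a + y) = V e a + (1/2) * (u \<bullet> (hessian (V e) a *v u)) * h\<^sup>2 + ?d 3 t / fact 3 * h ^ 3"
        using t(3) d1 d2 by (simp add: d0[of 0] d0[of h] u(2)[symmetric] numeral_3_eq_3 numeral_2_eq_2)
      moreover have "y \<bullet> (hessian (V e) a *v y) = (u \<bullet> (hessian (V e) a *v u)) * h\<^sup>2"
        by (simp add: u(2) matrix_vector_mult_scaleR power2_eq_square)
      ultimately have "V e (a + y) - V e a - (1/2) * (y \<bullet> (hessian (V e) a *v y)) = ?d 3 t / fact 3 * h ^ 3" by simp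
      moreover have "\<bar>?d 3 t / fact 3\<bar> \<le> \<bar>K\<bar>"
      proof -
        have "\<bar>?d 3 t\<bar> \<le> K" by (rule K) (use e a u t h in auto)
        then show ?thesis by (simp add: fact_numeral)
      qed
      ultimately show ?thesis
        using mult_right_mono[of "\<bar>?d 3 t / fact 3\<bar>" "\<bar>K\<bar>" "h ^ 3"] h by (simp add: abs_mult h_def)
    qed simp
  qed simp
qed

lemma tempered_of_growth:
  fixes f :: "real^'n \<Rightarrow> real"
  assumes f: "smooth_on UNIV f"
    and growth: "\<And>N::nat. \<exists>C. \<forall>vs x. set vs \<subseteq> Basis \<and> length vs \<le> N \<longrightarrow> \<bar>pderivs vs f x\<bar> \<le> C * (1 + (norm x)\<^sup>2) powr (m / 2)"
  shows "tempered f"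
  unfolding tempered_def all_hereditary_iff
proof (intro allI impI conjI)
  fix vs :: "(real^'n) list" assume vs: "set vs \<subseteq> Basis"
  show "\<forall>x\<in>UNIV. pderivs vs f differentiable at x" using f vs by (simp add: smooth_on_def)
  obtain C where C: "\<And>x. \<bar>pderivs vs f x\<bar> \<le> C * (1 + (norm x)\<^sup>2) powr (m / 2)"
    using growth[of "length vs"] vs by blast
  \<comment> \<open>The exponent \<open>m\<close> is real and may be negative; rounding up its
    absolute value gives a natural power that dominates.\<close>
  define k where "k = nat \<lceil>\<bar>m\<bar>\<rceil>"
  have "norm (pderivs vs f x) \<le> \<bar>C\<bar> * (1 + norm x) ^ k" for x
  proof -
    have "(1 + (norm x)\<^sup>2) powr (m / 2) \<le> (1 + (norm x)\<^sup>2) powr (\<bar>m\<bar> / 2)" by (intro powr_mono) auto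
    also have "\<dots> \<le> ((1 + norm x)\<^sup>2) powr (\<bar>m\<bar> / 2)" by (intro powr_mono2) (auto simp: power2_sum)
    also have "\<dots> = (1 + norm x) powr \<bar>m\<bar>"
    proof -
      have "(1 + norm x)\<^sup>2 = (1 + norm x) powr 2" using one_add_norm_pos[of x] by simp
      then show ?thesis by (simp only: powr_powr) simp
    qed
    also have "\<dots> \<le> (1 + norm x) powr (real k)" by (intro powr_mono) (auto simp: k_def)
    also have "\<dots> = (1 + norm x) ^ k" using one_add_norm_pos[of x] by (rule powr_realpow)
    finally have "\<bar>C\<bar> * (1 + (norm x)\<^sup>2) powr (m / 2) \<le> \<bar>C\<bar> * (1 + norm x) ^ k" by (rule mult_left_mono) simp
    moreover have "C * (1 + (norm x)\<^sup>2) powr (m / 2) \<le> \<bar>C\<bar> * (1 + (norm x)\<^sup>2) powr (m / 2)"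
      by (intro mult_right_mono) auto
    ultimately show ?thesis using C[of x] by simp
  qed
  then show "polynomially_bounded (pderivs vs f)" unfolding polynomially_bounded_def by blast
qed

section \<open>The minimum point\<close>

text \<open>Away from 0, on the compact set \<open>K\<close>, \<open>V 0\<close> is at least some
  \<mu> > 0. For small \<open>e\<close>, uniform continuity keeps \<open>V e\<close> above \<mu> / 2
  there, while the minimum value is at most \<open>V e 0\<close>, which is below \<mu> / 2.\<close>

lemma minimizer_tendsto:
  fixes V :: "real \<Rightarrow> real^'n \<Rightarrow> real"
  assumes cont: "continuous_on UNIV (\<lambda>(e, x). V e x)"
    and r: "r > 0" and E: "E > 0" and bdd: "bounded (\<Union>e\<in>{-r..r}. V e -` {..<E})"
    and min: "\<And>e z. \<bar>e\<bar> \<le> r \<Longrightarrow> V e (xmin e) \<le> V e z"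
    and V0: "V 0 0 = 0" and pos: "\<And>x. x \<noteq> 0 \<Longrightarrow> V 0 x > 0" and \<eta>: "\<eta> > 0"
  obtains d where "d > 0" "d \<le> r" "\<And>e. \<bar>e\<bar> < d \<Longrightarrow> norm (xmin e) < \<eta>"
proof -
  obtain \<rho> where \<rho>: "\<And>e x. \<bar>e\<bar> \<le> r \<Longrightarrow> V e x < E \<Longrightarrow> norm x \<le> \<rho>"
    using bdd unfolding bounded_iff by fastforce
  define K where "K = cball 0 \<rho> - ball (0 :: real^'n) \<eta>"
  have cV: "continuous_on S (V e)" for S e
  proof -
    have "continuous_on S (\<lambda>x. (e, x))" by (intro continuous_intros)
    from continuous_on_compose2[OF cont this] show ?thesis by simp
  qed
  \<comment> \<open>The condition \<open>\<mu> \<le> E\<close> puts \<open>xmin e\<close> into the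
    sublevel set below \<open>E\<close>, hence into the ball of radius \<open>\<rho>\<close>; it
    also supplies a value when \<open>K\<close> is empty.\<close>
  have "\<exists>\<mu>>0. \<mu> \<le> E \<and> (\<forall>x\<in>K. \<mu> \<le> V 0 x)"
  proof (cases "K = {}")
    case False
    have "compact K" unfolding K_def by (intro compact_diff) auto
    then obtain x0 where x0: "x0 \<in> K" "\<And>x. x \<in> K \<Longrightarrow> V 0 x0 \<le> V 0 x"
      using continuous_attains_inf[OF _ False cV] by metis
    have "x0 \<noteq> 0" using x0(1) \<eta> by (auto simp: K_def)
    then have "V 0 x0 > 0" by (rule pos)
    moreover have "min E (V 0 x0) \<le> V 0 x" if "x \<in> K" for x using x0(2)[OF that] by simp
    ultimately show ?thesis using E by (intro exI[of _ "min E (V 0 x0)"]) auto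
  qed (use E in auto)
  then obtain \<mu> where \<mu>: "\<mu> > 0" "\<mu> \<le> E" "\<And>x. x \<in> K \<Longrightarrow> \<mu> \<le> V 0 x" by blast
  have "compact ({-r..r} \<times> cball (0 :: real^'n) \<bar>\<rho>\<bar>)" by (intro compact_Times) auto
  moreover have "continuous_on ({-r..r} \<times> cball (0 :: real^'n) \<bar>\<rho>\<bar>) (\<lambda>(e, x). V e x)"
    by (rule continuous_on_subset[OF cont]) auto
  ultimately have "uniformly_continuous_on ({-r..r} \<times> cball (0 :: real^'n) \<bar>\<rho>\<bar>) (\<lambda>(e, x). V e x)"
    by (rule compact_uniformly_continuous[rotated])
  then obtain d where d: "d > 0" "\<And>p q. p \<in> {-r..r} \<times> cball (0 :: real^'n) \<bar>\<rho>\<bar> \<Longrightarrow> q \<in> {-r..r} \<times> cball 0 \<bar>\<rho>\<bar> \<Longrightarrow>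
      dist q p < d \<Longrightarrow> dist ((\<lambda>(e, x). V e x) q) ((\<lambda>(e, x). V e x) p) < \<mu> / 2"
    using \<mu>(1) unfolding uniformly_continuous_on_def by (metis half_gt_zero)
  have close: "\<bar>V e x - V 0 x\<bar> < \<mu> / 2" if "\<bar>e\<bar> < min d r" "norm x \<le> \<bar>\<rho>\<bar>" for e x
  proof -
    have "(e, x) \<in> {-r..r} \<times> cball 0 \<bar>\<rho>\<bar>" "(0, x) \<in> {-r..r} \<times> cball 0 \<bar>\<rho>\<bar>" "dist (e, x) (0, x) < d"
      using that r by (auto simp: dist_Pair_Pair)
    from d(2)[OF this(2,1,3)] show ?thesis by (simp add: dist_real_def)
  qed
  show ?thesis
  proof (rule that[of "min d r"])
    fix e assume e: "\<bar>e\<bar> < min d r"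
    have Ve0: "V e 0 < \<mu> / 2" using close[OF e, of 0] V0 by simp
    have le: "V e (xmin e) < \<mu> / 2" using min[of e 0] Ve0 e by simp
    then have "norm (xmin e) \<le> \<rho>" using \<rho>[of e "xmin e"] \<mu> e by simp
    moreover have "xmin e \<notin> K"
    proof
      assume "xmin e \<in> K"
      have "norm (xmin e) \<le> \<bar>\<rho>\<bar>" using \<open>norm (xmin e) \<le> \<rho>\<close> by linarith
      from close[OF e this] \<mu>(3)[OF \<open>xmin e \<in> K\<close>] le show False by linarith
    qed
    ultimately show "norm (xmin e) < \<eta>" by (auto simp: K_def)
  qed (use d r in auto)
qed

text \<open>The implicit function theorem is applied to the gradient \<open>F\<close>, whose
  derivative in \<open>x\<close> at the origin is the positive definite Hessian. Its uniqueness
  statement holds only in \<open>U\<close>, so critical points elsewhere have to be excluded: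
  \<open>minimizer_tendsto\<close> brings \<open>(e, xmin e)\<close> into \<open>U\<close>.\<close>

lemma minimizer_smooth:
  fixes V :: "real \<Rightarrow> real^'n \<Rightarrow> real"
  assumes V: "smooth_on UNIV (\<lambda>(e, x). V e x)"
    and r: "r > 0" and E: "E > 0" and bdd: "bounded (\<Union>e\<in>{-r..r}. V e -` {..<E})"
    and min: "\<And>e z. \<bar>e\<bar> \<le> r \<Longrightarrow> V e (xmin e) \<le> V e z"
    and V0: "V 0 0 = 0" and pos: "\<And>x. x \<noteq> 0 \<Longrightarrow> V 0 x > 0" and xmin0: "xmin 0 = 0"
    and hess: "\<And>v. v \<noteq> 0 \<Longrightarrow> v \<bullet> (hessian (V 0) 0 *v v) > 0"
  obtains s where "s > 0" "s \<le> r" "smooth_on {-s<..<s} xmin"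
proof -
  let ?W = "\<lambda>(e, x). V e x"
  define F :: "real \<times> (real^'n) \<Rightarrow> real^'n" where
    "F p = (\<chi> i. frechet_derivative ?W (at p) (0, axis i 1))" for p
  have F: "smooth_on UNIV F"
    unfolding F_def by (rule smooth_on_vec) (auto intro!: smooth_on_directional V)
  have slice: "frechet_derivative (V e) (at x) (axis i 1) = F (e, x) $ i" for e x i
    using pderivs_slice[OF V, of "[axis i 1]" e x] by (simp add: F_def)
  have sm: "smooth_on UNIV (V e)" for e by (rule smooth_on_slice[OF V])
  have F_min: "F (e, xmin e) = 0" if e: "\<bar>e\<bar> \<le> r" for e
  proof -
    have "F (e, xmin e) $ i = 0" for i
    proof -
      have "((\<lambda>t. V e (xmin e + t *\<^sub>R axis i 1)) has_real_derivative frechet_derivative (V e) (at (xmin e + 0 *\<^sub>R axis i 1)) (axis i 1)) (at 0)"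
        unfolding has_real_derivative_iff_has_vector_derivative
        by (intro has_derivative_along_line smooth_onD(1)[OF sm]) simp
      from DERIV_local_min[OF this, of 1] min[OF e] show ?thesis by (simp add: slice)
    qed
    then show ?thesis by (simp add: vec_eq_iff)
  qed
  have inj: "v = 0" if v: "frechet_derivative F (at (0, 0)) (0, v) = 0" for v
  proof (rule ccontr)
    assume "v \<noteq> 0"
    have "((\<lambda>x. (0 :: real, x)) has_derivative (\<lambda>v. (0, v))) (at (0 :: real^'n))" by (auto intro!: derivative_eq_intros)
    from diff_chain_at[OF this smooth_onD(2)[OF F, of "(0, 0)"]]
    have "((\<lambda>x. F (0, x)) has_derivative (\<lambda>v. frechet_derivative F (at (0, 0)) (0, v))) (at 0)" by (simp add: o_def)
    from bounded_linear.has_derivative[OF bounded_linear_vec_nth this]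
    have D: "((\<lambda>z. frechet_derivative (V 0) (at z) (axis i 1)) has_derivative (\<lambda>v. frechet_derivative F (at (0, 0)) (0, v) $ i)) (at 0)" for i
      unfolding slice by simp
    have "v \<bullet> (hessian (V 0) 0 *v axis i 1) = 0" for i
      using hessian_form[OF sm[of 0], of "axis i 1" 0 v] frechet_derivative_eqI[OF D] v by simp
    then have "(\<Sum>i\<in>UNIV. v $ i *\<^sub>R (v \<bullet> (hessian (V 0) 0 *v axis i 1))) = 0" by simp
    moreover have "linear (\<lambda>u. v \<bullet> (hessian (V 0) 0 *v u))"
      by (auto simp: linear_iff matrix_vector_right_distrib inner_add_right matrix_vector_mult_scaleR)
    ultimately have "v \<bullet> (hessian (V 0) 0 *v v) = 0" using linear_axis_expansion[of "\<lambda>u. v \<bullet> (hessian (V 0) 0 *v u)" v] by simp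
    with hess[OF \<open>v \<noteq> 0\<close>] show False by simp
  qed
  have F0: "F (0, 0) = 0" using F_min[of 0] r xmin0 by simp
  obtain s0 U y where s0: "s0 > 0" and U: "open U" "(0, 0) \<in> U" and y: "smooth_on {-s0<..<s0} y"
    and uniq: "\<And>e z. \<bar>e\<bar> < s0 \<Longrightarrow> (e, z) \<in> U \<Longrightarrow> F (e, z) = 0 \<Longrightarrow> z = y e"
    by (rule smooth_implicit_function[OF open_UNIV UNIV_I F F0 inj], assumption) (rule that)
  obtain \<eta> where \<eta>: "\<eta> > 0" "ball (0, 0) \<eta> \<subseteq> U" using U open_contains_ball by metis
  then have "\<eta> / 2 > 0" by simp
  from minimizer_tendsto[OF smooth_on_imp_continuous_on[OF V] r E bdd min V0 pos this]
  obtain d where d: "d > 0" "d \<le> r" "\<And>e. \<bar>e\<bar> < d \<Longrightarrow> norm (xmin e) < \<eta> / 2" by blast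
  define s where "s = Min {s0, d, \<eta> / 2}"
  have s: "s > 0" "s \<le> s0" "s \<le> d" "s \<le> \<eta> / 2" using s0 d \<eta> by (auto simp: s_def)
  have eq: "xmin e = y e" if e: "\<bar>e\<bar> < s" for e
  proof (rule uniq)
    have "norm (e, xmin e) \<le> norm e + norm (xmin e)" by (rule norm_Pair_le)
    also have "\<dots> < \<eta>" using d(3)[of e] e s by simp
    finally have "(e, xmin e) \<in> ball (0, 0) \<eta>" by (simp add: dist_Pair_Pair norm_Pair)
    then show "(e, xmin e) \<in> U" using \<eta>(2) by blast
    show "F (e, xmin e) = 0" using F_min[of e] e s d by simp
  qed (use e s in simp)
  show ?thesis
  proof (rule that[of s])
    have "smooth_on {-s<..<s} y" by (rule smooth_on_subset[OF y]) (use s in auto)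
    then show "smooth_on {-s<..<s} xmin" by (rule smooth_on_cong) (use eq in auto)
  qed (use s d in auto)
qed

section \<open>Estimates for smooth functions of the parameter\<close>

text \<open>Hadamard's lemma twice; the coefficient \<open>a\<close> is the value at 0 of the first
  quotient.\<close>

lemma smooth_second_order_expansion:
  fixes f :: "real \<Rightarrow> real"
  assumes "smooth_on {-s<..<s} f"
  shows "\<exists>a g. smooth_on {-s<..<s} g \<and> (\<forall>e. \<bar>e\<bar> < s \<longrightarrow> f e = f 0 + e * a + e\<^sup>2 * g e)"
proof -
  have 1: "smooth_on {-s<..<s} (\<lambda>e. f e - f 0)" by (intro smooth_on_diff assms) auto
  obtain g where g: "smooth_on {-s<..<s} g" "\<And>e. \<bar>e\<bar> < s \<Longrightarrow> f e - f 0 = e * g e"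
    by (rule smooth_divide_by_argument[OF 1]) auto
  have 2: "smooth_on {-s<..<s} (\<lambda>e. g e - g 0)" by (intro smooth_on_diff g) auto
  obtain k where k: "smooth_on {-s<..<s} k" "\<And>e. \<bar>e\<bar> < s \<Longrightarrow> g e - g 0 = e * k e"
    by (rule smooth_divide_by_argument[OF 2]) auto
  have "f e = f 0 + e * g 0 + e\<^sup>2 * k e" if "\<bar>e\<bar> < s" for e
  proof -
    have "f e = f 0 + e * g e" using g(2)[OF that] by simp
    also have "g e = g 0 + e * k e" using k(2)[OF that] by simp
    finally show ?thesis by (simp add: power2_eq_square algebra_simps)
  qed
  with k(1) show ?thesis by blast
qed

lemma smooth_on_bounded_half:
  fixes f :: "real \<Rightarrow> 'b::real_normed_vector"
  assumes "smooth_on {-s<..<s} f" "s > 0"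
  shows "\<exists>C\<ge>0. \<forall>e. \<bar>e\<bar> \<le> s / 2 \<longrightarrow> norm (f e) \<le> C"
proof -
  have "continuous_on {-(s/2)..s/2} f"
    by (rule continuous_on_subset[OF smooth_on_imp_continuous_on[OF assms(1)]]) (use assms(2) in auto)
  then have "bounded (f ` {-(s/2)..s/2})" by (intro compact_imp_bounded compact_continuous_image) auto
  then obtain C where C: "\<And>e. e \<in> {-(s/2)..s/2} \<Longrightarrow> norm (f e) \<le> C" unfolding bounded_iff by (metis imageI)
  have "norm (f 0) \<le> C" by (rule C) (use assms(2) in auto)
  then have "C \<ge> 0" using norm_ge_zero order_trans by blast
  moreover have "norm (f e) \<le> C" if "\<bar>e\<bar> \<le> s / 2" for e
    using C[of e] abs_le_D1[OF that] abs_le_D2[OF that] by (simp add: minus_le_iff)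
  ultimately show ?thesis by blast
qed

lemma smooth_on_positive_half:
  fixes f :: "'i::finite \<Rightarrow> real \<Rightarrow> real"
  assumes "\<And>i. smooth_on {-s<..<s} (f i)" "s > 0" "\<And>i e. \<bar>e\<bar> < s \<Longrightarrow> f i e > 0"
  shows "\<exists>b>0. \<forall>i e. \<bar>e\<bar> \<le> s / 2 \<longrightarrow> b \<le> f i e"
proof -
  have "\<exists>b>0. \<forall>e. \<bar>e\<bar> \<le> s / 2 \<longrightarrow> b \<le> f i e" for i
  proof -
    have "continuous_on {-(s/2)..s/2} (f i)"
      by (rule continuous_on_subset[OF smooth_on_imp_continuous_on[OF assms(1)]]) (use assms(2) in auto)
    then obtain e0 where e0: "e0 \<in> {-(s/2)..s/2}" "\<And>e. e \<in> {-(s/2)..s/2} \<Longrightarrow> f i e0 \<le> f i e"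
      using continuous_attains_inf[of "{-(s/2)..s/2}" "f i"] assms(2) by auto
    moreover have "f i e0 > 0" by (rule assms(3)) (use e0 assms(2) in auto)
    moreover have "f i e0 \<le> f i e" if "\<bar>e\<bar> \<le> s / 2" for e
      using e0(2)[of e] abs_le_D1[OF that] abs_le_D2[OF that] by (simp add: minus_le_iff)
    ultimately show ?thesis by blast
  qed
  then obtain b where b: "\<And>i. b i > 0" "\<And>i e. \<bar>e\<bar> \<le> s / 2 \<Longrightarrow> b i \<le> f i e" by metis
  have "Min (range b) > 0" using b(1) by (subst Min_gr_iff) auto
  moreover have "Min (range b) \<le> f i e" if "\<bar>e\<bar> \<le> s / 2" for i e
  proof -
    have "Min (range b) \<le> b i" by (rule Min_le) auto
    with b(2)[OF that, of i] show ?thesis by linarith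
  qed
  ultimately show ?thesis by blast
qed

lemma O_eps_infinity_matrix:
  fixes M :: "real \<Rightarrow> real^'n^'m"
  assumes "\<And>i j. O_eps_infinity s (\<lambda>e. M e $ i $ j)"
  shows "O_eps_infinity s M"
  unfolding O_eps_infinity_def
proof
  fix N
  have "\<exists>C. \<forall>e. \<bar>e\<bar> < s \<longrightarrow> norm (M e $ i $ j) \<le> C * \<bar>e\<bar> ^ N" for i j
    using assms[of i j] unfolding O_eps_infinity_def by blast
  then obtain C where C: "\<And>i j e. \<bar>e\<bar> < s \<Longrightarrow> norm (M e $ i $ j) \<le> C i j * \<bar>e\<bar> ^ N" by metis
  have "norm (M e) \<le> (\<Sum>i\<in>UNIV. \<Sum>j\<in>UNIV. C i j) * \<bar>e\<bar> ^ N" if "\<bar>e\<bar> < s" for e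
  proof -
    have "norm (M e) \<le> (\<Sum>i\<in>UNIV. norm (M e $ i))" unfolding norm_vec_def[of "M e"] by (rule L2_set_le_sum) simp
    also have "\<dots> \<le> (\<Sum>i\<in>UNIV. \<Sum>j\<in>UNIV. norm (M e $ i $ j))"
      using norm_le_l1_cart by (intro sum_mono) simp
    also have "\<dots> \<le> (\<Sum>i\<in>UNIV. \<Sum>j\<in>UNIV. C i j * \<bar>e\<bar> ^ N)" by (intro sum_mono C that)
    finally show ?thesis by (simp add: sum_distrib_right)
  qed
  then show "\<exists>C. \<forall>e. \<bar>e\<bar> < s \<longrightarrow> norm (M e) \<le> C * \<bar>e\<bar> ^ N" by blast
qed

lemma conjugate_quadratic_form:
  fixes A Q :: "real^'n^'n"
  shows "(Q *v z) \<bullet> (A *v (Q *v z)) = (\<Sum>i\<in>UNIV. \<Sum>j\<in>UNIV. (transpose Q ** A ** Q) $ i $ j * (z $ i * z $ j))"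
proof -
  have "(Q *v z) \<bullet> (A *v (Q *v z)) = z \<bullet> (transpose Q *v (A *v (Q *v z)))"
    using dot_lmul_matrix[of z "transpose Q" "A *v (Q *v z)"] unfolding vector_transpose_matrix .
  also have "\<dots> = z \<bullet> ((transpose Q ** A ** Q) *v z)" by (simp only: matrix_vector_mul_assoc matrix_mul_assoc)
  also have "\<dots> = (\<Sum>i\<in>UNIV. \<Sum>j\<in>UNIV. (transpose Q ** A ** Q) $ i $ j * (z $ i * z $ j))"
    by (simp add: inner_vec_def matrix_vector_mult_def[of "transpose Q ** A ** Q"] sum_distrib_left mult_ac)
  finally show ?thesis .
qed

lemma oscillator_smooth:
  assumes "\<And>j. smooth_on S (c j)" "smooth_on S f" "smooth_on S g" "open S"
  shows "smooth_on S (\<lambda>p. oscillator (\<lambda>j. c j p) (f p) (g p))"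
proof -
  have "smooth_on S (\<lambda>p. c j p / 2)" for j
    using smooth_on_mult[OF assms(1) smooth_on_const assms(4), of j "1/2"] by simp
  then show ?thesis
    unfolding oscillator_def
    by (intro smooth_on_sum smooth_on_mult smooth_on_add smooth_on_power smooth_on_nth assms)
qed

lemma oscillator_bound:
  assumes "\<And>j. \<bar>c j\<bar> \<le> C" "norm x \<le> n" "norm \<xi> \<le> n"
  shows "\<bar>oscillator c x (\<xi> :: real^'n)\<bar> \<le> real CARD('n) * C * n\<^sup>2"
proof -
  have "\<bar>oscillator c x \<xi>\<bar> \<le> (\<Sum>j\<in>(UNIV::'n set). \<bar>c j / 2 * ((\<xi> $ j)\<^sup>2 + (x $ j)\<^sup>2)\<bar>)"
    unfolding oscillator_def by (rule sum_abs)
  also have "\<dots> \<le> (\<Sum>j\<in>(UNIV::'n set). C * n\<^sup>2)"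
  proof (rule sum_mono)
    fix j
    have "\<bar>\<xi> $ j\<bar> \<le> n" "\<bar>x $ j\<bar> \<le> n"
      using component_le_norm_cart[of \<xi> j] component_le_norm_cart[of x j] assms by auto
    then have "(\<xi> $ j)\<^sup>2 \<le> n\<^sup>2" "(x $ j)\<^sup>2 \<le> n\<^sup>2" using power_mono[OF _ abs_ge_zero, of _ n 2] by fastforce+
    then have "(\<xi> $ j)\<^sup>2 + (x $ j)\<^sup>2 \<le> 2 * n\<^sup>2" by simp
    moreover have "C \<ge> 0" using assms(1)[of j] by linarith
    ultimately have "\<bar>c j\<bar> * ((\<xi> $ j)\<^sup>2 + (x $ j)\<^sup>2) \<le> C * (2 * n\<^sup>2)"
      using assms(1)[of j] by (intro mult_mono) auto
    then show "\<bar>c j / 2 * ((\<xi> $ j)\<^sup>2 + (x $ j)\<^sup>2)\<bar> \<le> C * n\<^sup>2" by (simp add: abs_mult)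
  qed
  finally show ?thesis by simp
qed

lemma oscillator_belongs_to_D2:
  fixes c :: "'n::finite \<Rightarrow> real"
  shows "belongs_to (\<lambda>(x, \<xi>, e :: real, h :: real). complex_of_real (oscillator c x \<xi>)) (D_space 2)"
proof -
  define \<beta> :: "'n point \<Rightarrow> 'n point \<Rightarrow> real" where
    "\<beta> p q = (\<Sum>j\<in>UNIV. c j / 2 * (fst (snd p) $ j * fst (snd q) $ j + fst p $ j * fst q $ j))" for p q
  have sym: "\<beta> p q = \<beta> q p" for p q by (simp add: \<beta>_def mult.commute)
  have lin: "linear (\<beta> p)" for p
    by (auto simp: linear_iff \<beta>_def algebra_simps sum.distrib sum_distrib_left)
  moreover have "(\<lambda>p. \<beta> p q) = \<beta> q" for q using sym by (intro ext) simp
  ultimately have "bilinear \<beta>" unfolding bilinear_def by simp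
  then have "bounded_bilinear \<beta>" by (simp add: bilinear_conv_bounded_bilinear)
  from belongs_to_D2[OF this sym] have "belongs_to (\<lambda>p. complex_of_real (\<beta> p p)) (D_space 2)"
    by (simp add: \<beta>_def)
  moreover have "(\<lambda>p. complex_of_real (\<beta> p p)) = (\<lambda>(x, \<xi>, e, h). complex_of_real (oscillator c x \<xi>))"
    by (auto simp: fun_eq_iff \<beta>_def oscillator_def power2_eq_square)
  ultimately show ?thesis by simp
qed

theorem proposition3p1:
  fixes V :: "real \<Rightarrow> real^'n \<Rightarrow> real"
    and xmin :: "real \<Rightarrow> real^'n"
    and E_inf \<epsilon>\<^sub>0 m :: real
  assumes V_smooth: "smooth_on UNIV (\<lambda>(\<epsilon>, x). V \<epsilon> x)"
    and E_inf_pos: "E_inf > 0"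
    and eps0_pos: "\<epsilon>\<^sub>0 > 0"
    and confining: "\<And>E. E < E_inf \<Longrightarrow> bounded (\<Union>\<epsilon>\<in>{-\<epsilon>\<^sub>0..\<epsilon>\<^sub>0}. V \<epsilon> -` {..<E})"
    and growth: "\<And>N::nat. \<exists>C. \<forall>\<epsilon> vs x. \<bar>\<epsilon>\<bar> \<le> \<epsilon>\<^sub>0 \<and> set vs \<subseteq> Basis \<and> length vs \<le> N \<longrightarrow>
                   \<bar>pderivs vs (V \<epsilon>) x\<bar> \<le> C * (1 + (norm x)\<^sup>2) powr (m / 2)"
    and unique_minimum: "\<And>\<epsilon> x. \<bar>\<epsilon>\<bar> \<le> \<epsilon>\<^sub>0 \<Longrightarrow> is_arg_min (V \<epsilon>) (\<lambda>_. True) x \<longleftrightarrow> x = xmin \<epsilon>"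
    and nondegenerate: "\<And>\<epsilon>. \<bar>\<epsilon>\<bar> \<le> \<epsilon>\<^sub>0 \<Longrightarrow> invertible (hessian (V \<epsilon>) (xmin \<epsilon>))"
    and xmin_0: "xmin 0 = 0"
    and V_0: "V 0 0 = 0"
    and V'_0: "(V 0 has_derivative (\<lambda>_. 0)) (at 0)"
    and V''_0: "\<And>v. v \<noteq> 0 \<Longrightarrow> v \<bullet> (hessian (V 0) 0 *v v) > 0"
  shows "\<exists>\<epsilon>\<^sub>1>0. \<epsilon>\<^sub>1 \<le> \<epsilon>\<^sub>0 \<and>
    (\<exists>(\<omega> :: 'n \<Rightarrow> real \<Rightarrow> real) (\<omega>1 :: 'n \<Rightarrow> real) (\<omega>2 :: 'n \<Rightarrow> real \<Rightarrow> real) (Q :: real \<Rightarrow> real^'n^'n)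
        (R :: real \<Rightarrow> real^'n \<Rightarrow> real) (\<rho> :: real \<Rightarrow> real^'n \<Rightarrow> real).
      (\<forall>j. smooth_on {-\<epsilon>\<^sub>1<..<\<epsilon>\<^sub>1} (\<omega> j)) \<and>
      (\<forall>j \<epsilon>. \<bar>\<epsilon>\<bar> < \<epsilon>\<^sub>1 \<longrightarrow> \<omega> j \<epsilon> > 0) \<and>
      smooth_on {-\<epsilon>\<^sub>1<..<\<epsilon>\<^sub>1} Q \<and>
      (\<forall>\<epsilon>. \<bar>\<epsilon>\<bar> < \<epsilon>\<^sub>1 \<longrightarrow> orthogonal_matrix (Q \<epsilon>)) \<and>
      O_eps_infinity \<epsilon>\<^sub>1
        (\<lambda>\<epsilon>. matrix_inv (Q \<epsilon>) ** hessian (V \<epsilon>) (xmin \<epsilon>) ** Q \<epsilon> - diag (\<lambda>j. (\<omega> j \<epsilon>)\<^sup>2)) \<and>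
      (\<forall>j. smooth_on {-\<epsilon>\<^sub>1<..<\<epsilon>\<^sub>1} (\<omega>2 j)) \<and>
      (\<forall>j \<epsilon>. \<bar>\<epsilon>\<bar> < \<epsilon>\<^sub>1 \<longrightarrow> \<omega> j \<epsilon> = \<omega> j 0 + \<epsilon> * \<omega>1 j + \<epsilon>\<^sup>2 * \<omega>2 j \<epsilon>) \<and>
      smooth_on ({-\<epsilon>\<^sub>1<..<\<epsilon>\<^sub>1} \<times> UNIV) (\<lambda>(\<epsilon>, x). R \<epsilon> x) \<and>
      O_cubic_uniformly \<epsilon>\<^sub>1 R \<and>
      smooth_on ({-\<epsilon>\<^sub>1<..<\<epsilon>\<^sub>1} \<times> UNIV) (\<lambda>(\<epsilon>, x). \<rho> \<epsilon> x) \<and>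
      O_eps_infinity_norm2 \<epsilon>\<^sub>1 \<rho> \<and>
      (let H20 = oscillator (\<lambda>j. \<omega> j 0);
           L2' = oscillator \<omega>1;
           M2 = (\<lambda>\<epsilon>. oscillator (\<lambda>j. \<omega>2 j \<epsilon>));
           L' = (\<lambda>\<epsilon> x \<xi>. \<epsilon>\<^sup>2 * M2 \<epsilon> x \<xi> + R \<epsilon> x + \<rho> \<epsilon> x);
           L = (\<lambda>\<epsilon> x \<xi>. \<epsilon> * L2' x \<xi> + L' \<epsilon> x \<xi>);
           U = (\<lambda>\<epsilon>. scaling (\<lambda>j. \<omega> j \<epsilon>) \<circ> change_of_variables (Q \<epsilon>) \<circ> translation (xmin \<epsilon>))
       in belongs_to (\<lambda>(x, \<xi>, \<epsilon>, h). complex_of_real (L2' x \<xi>)) (D_space 2) \<and>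
          belongs_to (\<lambda>(x, \<xi>, \<epsilon>, h). complex_of_real (L' \<epsilon> x \<xi>)) (O_space 3) \<and>
          belongs_to (\<lambda>(x, \<xi>, \<epsilon>, h). complex_of_real (L \<epsilon> x \<xi>)) (O_space 3) \<and>
          (\<forall>\<epsilon>. \<bar>\<epsilon>\<bar> < \<epsilon>\<^sub>1 \<longrightarrow>
            unitary_L2 (U \<epsilon>) \<and>
            (\<exists>Ustar. adjoint_L2 (U \<epsilon>) Ustar \<and> (\<forall>u\<in>schwartz. Ustar u \<in> schwartz) \<and>
              (\<forall>h>0.
                has_weyl_symbol h (\<lambda>u. U \<epsilon> (schroedinger h (V \<epsilon>) (Ustar u)))
                  (\<lambda>x \<xi> _. complex_of_real
                     ((INF z. V \<epsilon> z) + H20 x \<xi> + \<epsilon> * L2' x \<xi> + L' \<epsilon> x \<xi>)) \<and>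
                has_weyl_symbol h (\<lambda>u. U \<epsilon> (schroedinger h (V \<epsilon>) (Ustar u)))
                  (\<lambda>x \<xi> _. complex_of_real
                     ((INF z. V \<epsilon> z) + H20 x \<xi> + L \<epsilon> x \<xi>)))))))"
proof -

  \<comment> \<open>The minimum point as a smooth function of \<epsilon>\<close>
  let ?W = "\<lambda>(\<epsilon>, x). V \<epsilon> x"
  have V_min: "V \<epsilon> (xmin \<epsilon>) \<le> V \<epsilon> z" if "\<bar>\<epsilon>\<bar> \<le> \<epsilon>\<^sub>0" for \<epsilon> z
    using unique_minimum[OF that, of "xmin \<epsilon>"] by (auto simp: is_arg_min_def not_less)
  \<comment> \<open>A point with \<open>V 0 x \<le> 0\<close> would be a second minimizer, since the
    minimum value is \<open>V 0 0 = 0\<close>.\<close>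
  have V_pos: "V 0 x > 0" if "x \<noteq> 0" for x
  proof (rule ccontr)
    assume "\<not> V 0 x > 0"
    then have "is_arg_min (V 0) (\<lambda>_. True) x"
      using V_min[of 0] eps0_pos xmin_0 V_0 by (simp add: is_arg_min_def not_less) (meson order_trans)
    with that unique_minimum[of 0 x] eps0_pos xmin_0 show False by simp
  qed
  \<comment> \<open>The sublevel sets are bounded for energies strictly below \<open>E_inf\<close>;
    half of it is positive and admissible.\<close>
  have E2: "E_inf / 2 > 0" "E_inf / 2 < E_inf" using E_inf_pos by auto
  obtain s1 where s1: "s1 > 0" "s1 \<le> \<epsilon>\<^sub>0" and xs: "smooth_on {-s1<..<s1} xmin"
    using minimizer_smooth[OF V_smooth eps0_pos E2(1) confining[OF E2(2)] V_min V_0 V_pos xmin_0 V''_0] by blast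
  have smV: "smooth_on UNIV (V \<epsilon>)" for \<epsilon> by (rule smooth_on_slice[OF V_smooth])

  \<comment> \<open>The Hessian along the minimum point\<close>
  define A where "A \<epsilon> = hessian (V \<epsilon>) (xmin \<epsilon>)" for \<epsilon>
  have A: "smooth_on {-s1<..<s1} A"
  proof (rule smooth_on_matrix)
    fix i j :: 'n
    let ?vs = "map (Pair (0::real)) [axis i (1::real), axis j 1]"
    have "smooth_on UNIV (pderivs ?vs ?W)"
      by (rule smooth_on_pderivs[OF V_smooth]) (auto simp: Basis_prod_def axis_in_Basis_iff)
    then have "smooth_on {-s1<..<s1} (\<lambda>\<epsilon>. pderivs ?vs ?W (\<epsilon>, xmin \<epsilon>))"
      by (rule smooth_on_compose) (auto intro!: smooth_on_Pair xs)
    moreover have "A \<epsilon> $ i $ j = pderivs ?vs ?W (\<epsilon>, xmin \<epsilon>)" for \<epsilon>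
      using pderivs_slice[OF V_smooth, of "[axis i 1, axis j 1]" \<epsilon> "xmin \<epsilon>"]
      by (simp add: A_def hessian_def axis_in_Basis_iff)
    ultimately show "smooth_on {-s1<..<s1} (\<lambda>\<epsilon>. A \<epsilon> $ i $ j)" by simp
  qed auto
  have Asym: "transpose (A \<epsilon>) = A \<epsilon>" for \<epsilon> unfolding A_def by (rule hessian_symmetric[OF smV])

  \<comment> \<open>Approximate diagonalization, frequencies and their expansion\<close>
  obtain s2 Q where s2: "0 < s2" "s2 \<le> s1" and Q: "smooth_on {-s2<..<s2} Q"
    "\<And>\<epsilon>. \<bar>\<epsilon>\<bar> < s2 \<Longrightarrow> orthogonal_matrix (Q \<epsilon>)"
    "\<And>i j. i \<noteq> j \<Longrightarrow> O_eps_infinity s2 (\<lambda>\<epsilon>. (transpose (Q \<epsilon>) ** A \<epsilon> ** Q \<epsilon>) $ i $ j)"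
    by (rule smooth_approximate_diagonalization[OF s1(1) A Asym]) (rule that)
  define B where "B \<epsilon> = transpose (Q \<epsilon>) ** A \<epsilon> ** Q \<epsilon>" for \<epsilon>
  have B: "smooth_on {-s2<..<s2} (\<lambda>\<epsilon>. B \<epsilon> $ i $ j)" for i j
    unfolding B_def
    by (intro smooth_on_entry smooth_on_matrix_mult smooth_on_transpose Q smooth_on_subset[OF A]) (use s2 in auto)
  have B0: "B 0 $ j $ j > 0" for j
  proof -
    have "norm (column j (Q 0)) = 1"
      using Q(2)[of 0] s2(1) by (simp add: orthogonal_matrix_orthonormal_columns)
    then have "column j (Q 0) \<noteq> 0" by auto
    from V''_0[OF this] show ?thesis by (simp add: B_def A_def xmin_0 conjugate_entry_column)
  qed
  obtain s where s: "0 < s" "s \<le> s2" and Bpos: "\<And>j \<epsilon>. \<bar>\<epsilon>\<bar> < s \<Longrightarrow> B \<epsilon> $ j $ j > 0"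
  proof -
    have "\<forall>\<^sub>F \<epsilon> in nhds 0. B \<epsilon> $ j $ j > 0" for j
    proof -
      have "isCont (\<lambda>\<epsilon>. B \<epsilon> $ j $ j) 0"
        by (rule differentiable_imp_continuous_within, rule smooth_onD(1)[OF B]) (use s2(1) in simp)
      then have "((\<lambda>\<epsilon>. B \<epsilon> $ j $ j) \<longlongrightarrow> B 0 $ j $ j) (nhds 0)" 
        using tendsto_at_iff_tendsto_nhds[of "\<lambda>\<epsilon>. B \<epsilon> $ j $ j" 0] by (simp add: isCont_def)
      then show ?thesis using B0 by (rule order_tendstoD)
    qed
    then have "\<forall>\<^sub>F \<epsilon> in nhds 0. \<forall>j. B \<epsilon> $ j $ j > 0" by (rule eventually_all_finite)
    then obtain d where "d > 0" "\<And>\<epsilon>. dist \<epsilon> 0 < d \<Longrightarrow> \<forall>j. B \<epsilon> $ j $ j > 0"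
      unfolding eventually_nhds_metric by blast
    then show ?thesis using s2(1) by (intro that[of "min d s2"]) auto
  qed

  \<comment> \<open>The square of \<omega> is the diagonal entry of \<open>B\<close> itself, not an
    approximation of it, so the diagonal of \<open>off\<close> vanishes for small
    \<epsilon>.\<close>
  define \<omega> where "\<omega> j \<epsilon> = sqrt (B \<epsilon> $ j $ j)" for j \<epsilon>
  have \<omega>: "smooth_on {-s<..<s} (\<omega> j)" for j
    unfolding \<omega>_def by (intro smooth_on_sqrt smooth_on_subset[OF B]) (use s Bpos in auto)
  have \<omega>_pos: "\<omega> j \<epsilon> > 0" and \<omega>_sq: "(\<omega> j \<epsilon>)\<^sup>2 = B \<epsilon> $ j $ j" if "\<bar>\<epsilon>\<bar> < s" for j \<epsilon>
    using Bpos[OF that, of j] by (auto simp: \<omega>_def)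
  have "\<exists>a g. smooth_on {-s<..<s} g \<and> (\<forall>\<epsilon>. \<bar>\<epsilon>\<bar> < s \<longrightarrow> \<omega> j \<epsilon> = \<omega> j 0 + \<epsilon> * a + \<epsilon>\<^sup>2 * g \<epsilon>)" for j
    by (rule smooth_second_order_expansion[OF \<omega>])
  then obtain \<omega>1 \<omega>2 where \<omega>2: "\<And>j. smooth_on {-s<..<s} (\<omega>2 j)"
    and \<omega>_eq: "\<And>j \<epsilon>. \<bar>\<epsilon>\<bar> < s \<Longrightarrow> \<omega> j \<epsilon> = \<omega> j 0 + \<epsilon> * \<omega>1 j + \<epsilon>\<^sup>2 * \<omega>2 j \<epsilon>"
    by metis

  \<comment> \<open>Halving leaves a compact interval inside the domain of smoothness. On it the
    frequencies have a common positive lower bound \<open>b\<close>, and the functions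
    \<open>\<omega>2 j\<close> and \<open>xmin\<close> are bounded.\<close>
  define \<epsilon>\<^sub>1 where "\<epsilon>\<^sub>1 = s / 2"
  have e1: "\<epsilon>\<^sub>1 > 0" "\<epsilon>\<^sub>1 < s" "\<epsilon>\<^sub>1 \<le> \<epsilon>\<^sub>0" using s s2 s1 by (auto simp: \<epsilon>\<^sub>1_def)
  let ?I = "{-\<epsilon>\<^sub>1<..<\<epsilon>\<^sub>1}"
  have sub: "?I \<subseteq> {-s<..<s}" "?I \<subseteq> {-s2<..<s2}" "?I \<subseteq> {-s1<..<s1}" using e1 s s2 by auto
  have lt: "\<bar>\<epsilon>\<bar> < s" "\<bar>\<epsilon>\<bar> < s2" "\<bar>\<epsilon>\<bar> \<le> \<epsilon>\<^sub>0" if "\<bar>\<epsilon>\<bar> < \<epsilon>\<^sub>1" for \<epsilon> using that e1 s by auto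
  obtain b where b: "b > 0" "\<And>j \<epsilon>. \<bar>\<epsilon>\<bar> \<le> s / 2 \<Longrightarrow> b \<le> \<omega> j \<epsilon>"
    using smooth_on_positive_half[of s \<omega>, OF \<omega> s(1) \<omega>_pos] by blast
  have "\<exists>C\<ge>0. \<forall>\<epsilon>. \<bar>\<epsilon>\<bar> \<le> s / 2 \<longrightarrow> norm (\<omega>2 j \<epsilon>) \<le> C" for j
    by (rule smooth_on_bounded_half[OF \<omega>2 s(1)])
  then obtain c2 where c2: "\<And>j \<epsilon>. \<bar>\<epsilon>\<bar> \<le> s / 2 \<Longrightarrow> norm (\<omega>2 j \<epsilon>) \<le> c2 j" by metis
  obtain rx where rx: "\<And>\<epsilon>. \<bar>\<epsilon>\<bar> \<le> s / 2 \<Longrightarrow> norm (xmin \<epsilon>) \<le> rx"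
  proof -
    have "smooth_on {-s<..<s} xmin" by (rule smooth_on_subset[OF xs]) (use s s2 in auto)
    from smooth_on_bounded_half[OF this s(1)] show ?thesis using that by blast
  qed

  \<comment> \<open>Rescaled coordinates and the two remainders\<close>
  define Z :: "real \<Rightarrow> real^'n \<Rightarrow> real^'n" where "Z \<epsilon> x = (\<chi> j. x $ j / sqrt (\<omega> j \<epsilon>))" for \<epsilon> x
  define E where "E \<epsilon> x = Q \<epsilon> *v Z \<epsilon> x" for \<epsilon> x
  define off where "off \<epsilon> = B \<epsilon> - diag (\<lambda>j. (\<omega> j \<epsilon>)\<^sup>2)" for \<epsilon>
  \<comment> \<open>The factor 1/2 is that of the quadratic Taylor term; \<open>\<rho>\<close> is
    its off-diagonal part.\<close>
  define \<rho> where "\<rho> \<epsilon> x = (1/2) * (\<Sum>i\<in>UNIV. \<Sum>j\<in>UNIV. off \<epsilon> $ i $ j * (Z \<epsilon> x $ i * Z \<epsilon> x $ j))" for \<epsilon> x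
  define R where "R \<epsilon> x = V \<epsilon> (xmin \<epsilon> + E \<epsilon> x) - V \<epsilon> (xmin \<epsilon>) - (1/2) * (E \<epsilon> x \<bullet> (A \<epsilon> *v E \<epsilon> x))" for \<epsilon> x

  have off: "O_eps_infinity \<epsilon>\<^sub>1 (\<lambda>\<epsilon>. off \<epsilon> $ i $ j)" for i j
  proof (cases "i = j")
    case True
    then have "off \<epsilon> $ i $ j = 0" if "\<bar>\<epsilon>\<bar> < \<epsilon>\<^sub>1" for \<epsilon>
      using \<omega>_sq[OF lt(1)[OF that]] by (simp add: off_def diag_def)
    then show ?thesis unfolding O_eps_infinity_def by (auto intro!: exI[of _ 0])
  next
    case False
    then have "off \<epsilon> $ i $ j = (transpose (Q \<epsilon>) ** A \<epsilon> ** Q \<epsilon>) $ i $ j" for \<epsilon>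
      by (simp add: off_def diag_def B_def)
    with O_eps_infinity_subset[OF Q(3)[OF False], of \<epsilon>\<^sub>1] e1 s show ?thesis by simp
  qed
  have Z_le: "norm (Z \<epsilon> x) \<le> norm x / sqrt b" if "\<bar>\<epsilon>\<bar> < \<epsilon>\<^sub>1" for \<epsilon> x
  proof -
    have "norm (Z \<epsilon> x) \<le> norm ((1 / sqrt b) *\<^sub>R x)"
    proof (rule norm_le_componentwise_cart)
      fix j
      have "b \<le> \<omega> j \<epsilon>" using b(2)[of \<epsilon> j] that by (simp add: \<epsilon>\<^sub>1_def)
      then have "\<bar>x $ j\<bar> / sqrt (\<omega> j \<epsilon>) \<le> \<bar>x $ j\<bar> / sqrt b" using b(1) by (intro divide_left_mono) auto
      then show "norm (Z \<epsilon> x $ j) \<le> norm (((1 / sqrt b) *\<^sub>R x) $ j)"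
        using b(1) \<omega>_pos[OF lt(1)[OF that], of j] by (simp add: Z_def abs_mult less_imp_le)
    qed
    then show ?thesis using b(1) by simp
  qed
  have E_le: "norm (E \<epsilon> x) \<le> norm x / sqrt b" if "\<bar>\<epsilon>\<bar> < \<epsilon>\<^sub>1" for \<epsilon> x
  proof -
    have "orthogonal_transformation ((*v) (Q \<epsilon>))"
      using Q(2)[OF lt(2)[OF that]] by (simp add: orthogonal_transformation_matrix)
    then have "norm (E \<epsilon> x) = norm (Z \<epsilon> x)" unfolding E_def by (simp add: orthogonal_transformation)
    with Z_le[OF that] show ?thesis by simp
  qed
  \<comment> \<open>In the coordinates \<open>Z\<close> the diagonal entry
    \<open>(\<omega> i \<epsilon>)\<^sup>2\<close> loses one power of the frequency to the scaling.
    So \<open>x $ i\<close> carries the same coefficient as the momentum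
    \<open>\<xi> $ i\<close>.\<close>
  have V_expansion: "V \<epsilon> (E \<epsilon> x + xmin \<epsilon>) = V \<epsilon> (xmin \<epsilon>) + (\<Sum>j\<in>UNIV. \<omega> j \<epsilon> / 2 * (x $ j)\<^sup>2) + R \<epsilon> x + \<rho> \<epsilon> x"
    if "\<bar>\<epsilon>\<bar> < \<epsilon>\<^sub>1" for \<epsilon> x
  proof -
    have B_eq: "B \<epsilon> $ i $ j * (Z \<epsilon> x $ i * Z \<epsilon> x $ j) =
        (if i = j then (\<omega> i \<epsilon>)\<^sup>2 * (Z \<epsilon> x $ i * Z \<epsilon> x $ i) else 0) + off \<epsilon> $ i $ j * (Z \<epsilon> x $ i * Z \<epsilon> x $ j)" for i j
      by (simp add: off_def diag_def algebra_simps)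
    have Zsq: "(\<omega> i \<epsilon>)\<^sup>2 * (Z \<epsilon> x $ i * Z \<epsilon> x $ i) = \<omega> i \<epsilon> * (x $ i)\<^sup>2" for i
      using \<omega>_pos[OF lt(1)[OF that], of i] by (simp add: Z_def power2_eq_square)
    have "E \<epsilon> x \<bullet> (A \<epsilon> *v E \<epsilon> x) = (\<Sum>i\<in>UNIV. \<Sum>j\<in>UNIV. B \<epsilon> $ i $ j * (Z \<epsilon> x $ i * Z \<epsilon> x $ j))"
      unfolding E_def B_def by (rule conjugate_quadratic_form)
    also have "\<dots> = (\<Sum>i\<in>UNIV. \<omega> i \<epsilon> * (x $ i)\<^sup>2) + 2 * \<rho> \<epsilon> x"
      by (simp add: B_eq sum.distrib Zsq \<rho>_def)
    finally have "E \<epsilon> x \<bullet> (A \<epsilon> *v E \<epsilon> x) = (\<Sum>i\<in>UNIV. \<omega> i \<epsilon> * (x $ i)\<^sup>2) + 2 * \<rho> \<epsilon> x" .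
    moreover have "(\<Sum>j\<in>UNIV. \<omega> j \<epsilon> / 2 * (x $ j)\<^sup>2) = (\<Sum>i\<in>UNIV. \<omega> i \<epsilon> * (x $ i)\<^sup>2) / 2"
      by (simp add: sum_divide_distrib)
    ultimately show ?thesis unfolding R_def add.commute[of "xmin \<epsilon>"] by argo
  qed

  \<comment> \<open>Joint smoothness of the remainders in \<epsilon> and x\<close>
  let ?D = "?I \<times> (UNIV :: (real^'n) set)"
  have opD: "open ?D" by (intro open_Times) auto
  have par: "smooth_on ?D (\<lambda>p. f (fst p))" if "smooth_on ?I f" for f :: "real \<Rightarrow> 'c::real_normed_vector"
    by (rule smooth_on_compose[OF that]) (auto intro!: smooth_on_fst opD)
  have \<omega>I: "smooth_on ?I (\<omega> j)" and \<omega>2I: "smooth_on ?I (\<omega>2 j)" for j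
    using smooth_on_subset[OF \<omega> sub(1)] smooth_on_subset[OF \<omega>2 sub(1)] by auto
  have QI: "smooth_on ?I Q" and xI: "smooth_on ?I xmin" and AI: "smooth_on ?I A"
    using smooth_on_subset[OF Q(1) sub(2)] smooth_on_subset[OF xs sub(3)] smooth_on_subset[OF A sub(3)] by auto
  have offI: "smooth_on ?I (\<lambda>\<epsilon>. off \<epsilon> $ i $ j)" for i j
  proof (cases "i = j")
    case True
    have "smooth_on ?I (\<lambda>\<epsilon>. B \<epsilon> $ i $ j - (\<omega> i \<epsilon>)\<^sup>2)"
      by (intro smooth_on_diff smooth_on_power \<omega>I smooth_on_subset[OF B sub(2)]) auto
    with True show ?thesis by (simp add: off_def diag_def)
  next
    case False
    with smooth_on_subset[OF B sub(2)] show ?thesis by (simp add: off_def diag_def)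
  qed
  have Zsm: "smooth_on ?D (\<lambda>p. Z (fst p) (snd p) $ j)" for j
  proof -
    have sq: "smooth_on ?I (\<lambda>\<epsilon>. sqrt (\<omega> j \<epsilon>))"
      using \<omega>_pos lt by (intro smooth_on_sqrt \<omega>I) auto
    have "smooth_on ?D (\<lambda>p. snd p $ j / sqrt (\<omega> j (fst p)))"
      using \<omega>_pos[OF lt(1)]
      by (intro smooth_on_divide smooth_on_nth smooth_on_snd smooth_on_id par[OF sq] opD)
         (auto simp: less_imp_neq[THEN not_sym])
    then show ?thesis by (simp add: Z_def)
  qed
  have Esm: "smooth_on ?D (\<lambda>p. E (fst p) (snd p))"
  proof (rule smooth_on_vec)
    show "smooth_on ?D (\<lambda>p. E (fst p) (snd p) $ i)" for i
      unfolding E_def matrix_vector_mult_def vec_lambda_beta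
      by (intro smooth_on_sum smooth_on_mult Zsm par[OF smooth_on_entry[OF QI]] opD) auto
  qed (rule opD)
  have \<rho>sm: "smooth_on ?D (\<lambda>(\<epsilon>, x). \<rho> \<epsilon> x)"
    unfolding \<rho>_def case_prod_beta'
    by (intro smooth_on_mult smooth_on_const smooth_on_sum par[OF offI] Zsm opD)
  have Rsm: "smooth_on ?D (\<lambda>(\<epsilon>, x). R \<epsilon> x)"
  proof -
    have W: "smooth_on ?D (\<lambda>p. ?W (fst p, f p))" if "smooth_on ?D f" for f
      by (rule smooth_on_compose[OF V_smooth]) (auto intro!: smooth_on_Pair that smooth_on_fst opD)
    have 1: "smooth_on ?D (\<lambda>p. ?W (fst p, xmin (fst p) + E (fst p) (snd p)))"
      by (intro W smooth_on_add par[OF xI] Esm opD)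
    have 2: "smooth_on ?D (\<lambda>p. ?W (fst p, xmin (fst p)))" by (intro W par[OF xI])
    have 3: "smooth_on ?D (\<lambda>p. A (fst p) *v E (fst p) (snd p))"
    proof (rule smooth_on_vec)
      show "smooth_on ?D (\<lambda>p. (A (fst p) *v E (fst p) (snd p)) $ i)" for i
        unfolding matrix_vector_mult_def vec_lambda_beta
        by (intro smooth_on_sum smooth_on_mult smooth_on_nth[OF Esm] par[OF smooth_on_entry[OF AI]] opD) auto
    qed (rule opD)
    have "smooth_on ?D (\<lambda>p. ?W (fst p, xmin (fst p) + E (fst p) (snd p)) - ?W (fst p, xmin (fst p))
        - (1/2) * (E (fst p) (snd p) \<bullet> (A (fst p) *v E (fst p) (snd p))))"
      by (intro smooth_on_diff smooth_on_mult smooth_on_inner smooth_on_const 1 2 3 Esm opD)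
    then show ?thesis by (simp only: R_def case_prod_beta' fst_conv snd_conv)
  qed

  \<comment> \<open>Uniform bounds on the remainders\<close>
  obtain K where K: "K \<ge> 0" and taylor: "\<And>\<epsilon> a y. \<bar>\<epsilon>\<bar> \<le> s / 2 \<Longrightarrow> norm a \<le> rx \<Longrightarrow> norm y \<le> 1 \<Longrightarrow> \<forall>z. V \<epsilon> a \<le> V \<epsilon> z \<Longrightarrow>
      \<bar>V \<epsilon> (a + y) - V \<epsilon> a - (1/2) * (y \<bullet> (hessian (V \<epsilon>) a *v y))\<bar> \<le> K * norm y ^ 3"
    by (rule uniform_taylor_at_minimum[OF V_smooth, of "s / 2" rx]) (rule that)
  define CR where "CR = K / sqrt b ^ 3"
  have CR: "CR \<ge> 0" using K b by (simp add: CR_def)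
  \<comment> \<open>Below \<open>sqrt b\<close> the displacement \<open>E \<epsilon> x\<close> has
    norm at most 1, the range of the uniform Taylor estimate.\<close>
  have R_le: "\<bar>R \<epsilon> x\<bar> \<le> CR * norm x ^ 3" if "\<bar>\<epsilon>\<bar> < \<epsilon>\<^sub>1" "norm x < sqrt b" for \<epsilon> x
  proof -
    have "norm (E \<epsilon> x) \<le> 1" using E_le[OF that(1), of x] that(2) b(1) by (auto intro: order_trans)
    then have "\<bar>R \<epsilon> x\<bar> \<le> K * norm (E \<epsilon> x) ^ 3"
      unfolding R_def A_def using that(1) V_min[OF lt(3)[OF that(1)]]
      by (intro taylor rx) (auto simp: \<epsilon>\<^sub>1_def)
    also have "\<dots> \<le> K * (norm x / sqrt b) ^ 3" by (intro mult_left_mono power_mono E_le that K) auto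
    finally show ?thesis by (simp add: CR_def power_divide)
  qed
  have R_cubic: "O_cubic_uniformly \<epsilon>\<^sub>1 R"
    unfolding O_cubic_uniformly_def using R_le b(1) by (intro exI[of _ CR] exI[of _ "sqrt b"]) auto
  have \<rho>_flat: "O_eps_infinity_norm2 \<epsilon>\<^sub>1 \<rho>"
    unfolding O_eps_infinity_norm2_def
  proof
    fix N
    have "\<exists>C. \<forall>\<epsilon>. \<bar>\<epsilon>\<bar> < \<epsilon>\<^sub>1 \<longrightarrow> norm (off \<epsilon> $ i $ j) \<le> C * \<bar>\<epsilon>\<bar> ^ N" for i j
      using off[of i j] unfolding O_eps_infinity_def by blast
    then obtain C where C: "\<And>i j \<epsilon>. \<bar>\<epsilon>\<bar> < \<epsilon>\<^sub>1 \<Longrightarrow> norm (off \<epsilon> $ i $ j) \<le> C i j * \<bar>\<epsilon>\<bar> ^ N" by metis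
    have "\<bar>\<rho> \<epsilon> x\<bar> \<le> ((1/2) * (\<Sum>i\<in>UNIV. \<Sum>j\<in>UNIV. C i j) / b) * \<bar>\<epsilon>\<bar> ^ N * (norm x)\<^sup>2" if e: "\<bar>\<epsilon>\<bar> < \<epsilon>\<^sub>1" for \<epsilon> x
    proof -
      have z: "\<bar>Z \<epsilon> x $ i\<bar> \<le> norm x / sqrt b" for i
        using component_le_norm_cart[of "Z \<epsilon> x" i] Z_le[OF e, of x] by simp
      have zz: "\<bar>Z \<epsilon> x $ i * Z \<epsilon> x $ j\<bar> \<le> (norm x)\<^sup>2 / b" for i j
      proof -
        have "\<bar>Z \<epsilon> x $ i * Z \<epsilon> x $ j\<bar> \<le> (norm x / sqrt b) * (norm x / sqrt b)"
          unfolding abs_mult using b(1) by (intro mult_mono z) auto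
        then show ?thesis using b(1) by (simp add: power2_eq_square)
      qed
      have "\<bar>\<rho> \<epsilon> x\<bar> \<le> (1/2) * (\<Sum>i\<in>UNIV. \<Sum>j\<in>UNIV. \<bar>off \<epsilon> $ i $ j * (Z \<epsilon> x $ i * Z \<epsilon> x $ j)\<bar>)"
        unfolding \<rho>_def abs_mult[of "1/2"]
        by (simp add: order_trans[OF sum_abs sum_mono[OF sum_abs]])
      also have "\<dots> \<le> (1/2) * (\<Sum>i\<in>UNIV. \<Sum>j\<in>UNIV. (C i j * \<bar>\<epsilon>\<bar> ^ N) * ((norm x)\<^sup>2 / b))"
      proof (intro mult_left_mono sum_mono)
        fix i j
        have "0 \<le> C i j * \<bar>\<epsilon>\<bar> ^ N" using C[OF e, of i j] norm_ge_zero order_trans by blast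
        then show "\<bar>off \<epsilon> $ i $ j * (Z \<epsilon> x $ i * Z \<epsilon> x $ j)\<bar> \<le> (C i j * \<bar>\<epsilon>\<bar> ^ N) * ((norm x)\<^sup>2 / b)"
          unfolding abs_mult[of "off \<epsilon> $ i $ j"] using C[OF e, of i j] by (intro mult_mono zz) auto
      qed simp
      finally show ?thesis by (simp add: sum_distrib_right sum_distrib_left sum_divide_distrib mult_ac)
    qed
    then show "\<exists>C. \<forall>\<epsilon> x. \<bar>\<epsilon>\<bar> < \<epsilon>\<^sub>1 \<longrightarrow> \<bar>\<rho> \<epsilon> x\<bar> \<le> C * \<bar>\<epsilon>\<bar> ^ N * (norm x)\<^sup>2" by blast
  qed

  \<comment> \<open>Weighted order of the perturbation terms\<close>
  define L' where "L' \<epsilon> x \<xi> = \<epsilon>\<^sup>2 * oscillator (\<lambda>j. \<omega>2 j \<epsilon>) x \<xi> + R \<epsilon> x + \<rho> \<epsilon> x" for \<epsilon> and x \<xi> :: "real^'n"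
  define L where "L \<epsilon> x \<xi> = \<epsilon> * oscillator \<omega>1 x \<xi> + L' \<epsilon> x \<xi>" for \<epsilon> and x \<xi> :: "real^'n"
  let ?P = "{p :: 'n point. fst (snd (snd p)) \<in> ?I}"
  have P: "open ?P" "0 \<in> ?P"
  proof -
    have "?P = (UNIV :: (real^'n) set) \<times> (UNIV :: (real^'n) set) \<times> ?I \<times> (UNIV :: real set)" by auto
    also have "open \<dots>" by (intro open_Times) auto
    finally show "open ?P" .
  qed (use e1 in simp)
  let ?x = "\<lambda>p :: 'n point. fst p" and ?\<xi> = "\<lambda>p :: 'n point. fst (snd p)" and ?e = "\<lambda>p :: 'n point. fst (snd (snd p))"
  have proj: "smooth_on ?P ?x" "smooth_on ?P ?\<xi>" "smooth_on ?P ?e"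
    by (intro smooth_on_fst smooth_on_snd smooth_on_id P)+
  have L'sm: "smooth_on ?P (\<lambda>p. L' (?e p) (?x p) (?\<xi> p))"
  proof -
    have ex: "smooth_on ?P (\<lambda>p. (?e p, ?x p))" by (intro smooth_on_Pair proj P)
    have "smooth_on ?P (\<lambda>p. (\<lambda>(\<epsilon>, x). R \<epsilon> x) (?e p, ?x p))"
      by (rule smooth_on_compose[OF Rsm ex P(1)]) auto
    then have 1: "smooth_on ?P (\<lambda>p. R (?e p) (?x p))" by simp
    have "smooth_on ?P (\<lambda>p. (\<lambda>(\<epsilon>, x). \<rho> \<epsilon> x) (?e p, ?x p))"
      by (rule smooth_on_compose[OF \<rho>sm ex P(1)]) auto
    then have 2: "smooth_on ?P (\<lambda>p. \<rho> (?e p) (?x p))" by simp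
    have 3: "smooth_on ?P (\<lambda>p. \<omega>2 j (?e p))" for j
      by (rule smooth_on_compose[OF \<omega>2I proj(3) P(1)]) auto
    show ?thesis
      unfolding L'_def by (intro smooth_on_add smooth_on_mult smooth_on_power oscillator_smooth 1 2 3 proj P)
  qed
  have Lsm: "smooth_on ?P (\<lambda>p. L (?e p) (?x p) (?\<xi> p))"
    unfolding L_def by (intro smooth_on_add smooth_on_mult oscillator_smooth smooth_on_const proj P L'sm)
  \<comment> \<open>Flatness enters with \<open>N = 1\<close>: one factor \<epsilon> and two factors
    from x give the cubic bound.\<close>
  obtain C\<rho> where C\<rho>: "\<And>\<epsilon> x. \<bar>\<epsilon>\<bar> < \<epsilon>\<^sub>1 \<Longrightarrow> \<bar>\<rho> \<epsilon> x\<bar> \<le> C\<rho> * \<bar>\<epsilon>\<bar> ^ 1 * (norm x)\<^sup>2"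
    using \<rho>_flat unfolding O_eps_infinity_norm2_def by blast
  define C1 where "C1 = Max (range (\<lambda>j. \<bar>\<omega>1 j\<bar>))"
  define C2 where "C2 = Max (range c2)"
  have C1: "\<bar>\<omega>1 j\<bar> \<le> C1" for j unfolding C1_def by (rule Max_ge) auto
  have C2: "\<bar>\<omega>2 j \<epsilon>\<bar> \<le> C2" if "\<bar>\<epsilon>\<bar> < \<epsilon>\<^sub>1" for j \<epsilon>
  proof -
    have "\<bar>\<omega>2 j \<epsilon>\<bar> \<le> c2 j" using c2[of \<epsilon> j] that by (simp add: \<epsilon>\<^sub>1_def)
    also have "c2 j \<le> C2" unfolding C2_def by (rule Max_ge) auto
    finally show ?thesis .
  qed
  \<comment> \<open>The bound 1 allows powers of the norm to be lowered,
    \<open>\<epsilon>\<^sub>1\<close> keeps the parameter in range, and \<open>sqrt b\<close> is the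
    radius of the estimate for \<open>R\<close>.\<close>
  define d where "d = Min {1, \<epsilon>\<^sub>1, sqrt b}"
  have d: "d > 0" "d \<le> 1" "d \<le> \<epsilon>\<^sub>1" "d \<le> sqrt b" using e1 b by (auto simp: d_def)
  let ?N = "real CARD('n)"
  have comp: "norm (?x p) \<le> norm p" "norm (?\<xi> p) \<le> norm p" "\<bar>?e p\<bar> \<le> norm p" for p :: "'n point"
  proof -
    show "norm (?x p) \<le> norm p" by (rule norm_fst_le[of "fst p" "snd p", simplified])
    have 1: "norm (snd p) \<le> norm p" by (rule norm_snd_le[of "snd p" "fst p", simplified])
    have "norm (?\<xi> p) \<le> norm (snd p)" by (rule norm_fst_le[of "fst (snd p)" "snd (snd p)", simplified])
    with 1 show "norm (?\<xi> p) \<le> norm p" by simp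
    have "norm (snd (snd p)) \<le> norm (snd p)" by (rule norm_snd_le[of "snd (snd p)" "fst (snd p)", simplified])
    moreover have "norm (?e p) \<le> norm (snd (snd p))" using norm_fst_le[of "?e p" "snd (snd (snd p))"] by simp
    ultimately show "\<bar>?e p\<bar> \<le> norm p" using 1 by simp
  qed
  have L'_le: "\<bar>L' (?e p) (?x p) (?\<xi> p)\<bar> \<le> (?N * C2 + CR + \<bar>C\<rho>\<bar>) * norm p ^ 3" if p: "norm p < d" for p :: "'n point"
  proof -
    let ?n = "norm p"
    have e: "\<bar>?e p\<bar> < \<epsilon>\<^sub>1" and n1: "?n \<le> 1" using comp(3)[of p] p d by auto
    have o: "\<bar>oscillator (\<lambda>j. \<omega>2 j (?e p)) (?x p) (?\<xi> p)\<bar> \<le> ?N * C2 * ?n\<^sup>2"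
      by (intro oscillator_bound C2 e comp)
    have NC: "0 \<le> ?N * C2" using C2[OF e] abs_ge_zero order_trans by (intro mult_nonneg_nonneg) (simp, blast)
    \<comment> \<open>The oscillator supplies two orders, so a single order from the square of
      \<epsilon> completes the cubic bound.\<close>
    have "(?e p)\<^sup>2 \<le> ?n" 
    proof -
      have "(?e p)\<^sup>2 = \<bar>?e p\<bar> * \<bar>?e p\<bar>" by (simp add: power2_eq_square)
      also have "\<dots> \<le> ?n * 1" using comp(3)[of p] n1 by (intro mult_mono) auto
      finally show ?thesis by simp
    qed
    then have "\<bar>(?e p)\<^sup>2 * oscillator (\<lambda>j. \<omega>2 j (?e p)) (?x p) (?\<xi> p)\<bar> \<le> ?n * (?N * C2 * ?n\<^sup>2)"
      unfolding abs_mult using o by (intro mult_mono) auto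
    moreover have "\<bar>R (?e p) (?x p)\<bar> \<le> CR * ?n ^ 3"
    proof -
      have "\<bar>R (?e p) (?x p)\<bar> \<le> CR * norm (?x p) ^ 3"
        by (rule R_le[OF e]) (use comp(1)[of p] p d in simp)
      also have "\<dots> \<le> CR * ?n ^ 3" by (intro mult_left_mono power_mono comp CR) auto
      finally show ?thesis .
    qed
    moreover have "\<bar>\<rho> (?e p) (?x p)\<bar> \<le> \<bar>C\<rho>\<bar> * ?n ^ 3"
    proof -
      have "\<bar>\<rho> (?e p) (?x p)\<bar> \<le> C\<rho> * (\<bar>?e p\<bar> ^ 1 * (norm (?x p))\<^sup>2)" using C\<rho>[OF e] by (simp add: mult.assoc)
      also have "\<dots> \<le> \<bar>C\<rho>\<bar> * (\<bar>?e p\<bar> ^ 1 * (norm (?x p))\<^sup>2)" by (intro mult_right_mono) auto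
      also have "\<dots> \<le> \<bar>C\<rho>\<bar> * (?n ^ 1 * ?n\<^sup>2)" by (intro mult_left_mono mult_mono power_mono comp) auto
      finally show ?thesis by (simp add: power3_eq_cube power2_eq_square mult.assoc)
    qed
    ultimately show ?thesis unfolding L'_def by (simp add: power3_eq_cube power2_eq_square algebra_simps)
  qed
  have L_le: "\<bar>L (?e p) (?x p) (?\<xi> p)\<bar> \<le> (?N * C1 + (?N * C2 + CR + \<bar>C\<rho>\<bar>)) * norm p ^ 3" if p: "norm p < d" for p :: "'n point"
  proof -
    have "\<bar>oscillator \<omega>1 (?x p) (?\<xi> p)\<bar> \<le> ?N * C1 * (norm p)\<^sup>2" by (intro oscillator_bound C1 comp)
    then have "\<bar>?e p * oscillator \<omega>1 (?x p) (?\<xi> p)\<bar> \<le> norm p * (?N * C1 * (norm p)\<^sup>2)"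
      unfolding abs_mult by (intro mult_mono comp) auto
    with L'_le[OF p] show ?thesis unfolding L_def by (simp add: power3_eq_cube power2_eq_square algebra_simps)
  qed
  have belongs: "belongs_to (\<lambda>(x, \<xi>, \<epsilon>, h). complex_of_real (L' \<epsilon> x \<xi>)) (O_space 3)"
    "belongs_to (\<lambda>(x, \<xi>, \<epsilon>, h). complex_of_real (L \<epsilon> x \<xi>)) (O_space 3)"
    using belongs_to_O3[OF L'sm P d(1) L'_le] belongs_to_O3[OF Lsm P d(1) L_le] by (simp_all add: case_prod_beta')

  \<comment> \<open>Unitarity and the Weyl symbol for fixed \<epsilon>\<close>
  have operator: "unitary_L2 (scaling (\<lambda>j. \<omega> j \<epsilon>) \<circ> change_of_variables (Q \<epsilon>) \<circ> translation (xmin \<epsilon>)) \<and>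
      (\<exists>Ustar. adjoint_L2 (scaling (\<lambda>j. \<omega> j \<epsilon>) \<circ> change_of_variables (Q \<epsilon>) \<circ> translation (xmin \<epsilon>)) Ustar \<and>
        (\<forall>u\<in>schwartz. Ustar u \<in> schwartz) \<and>
        (\<forall>h>0. has_weyl_symbol h (\<lambda>u. (scaling (\<lambda>j. \<omega> j \<epsilon>) \<circ> change_of_variables (Q \<epsilon>) \<circ> translation (xmin \<epsilon>)) (schroedinger h (V \<epsilon>) (Ustar u)))
             (\<lambda>x \<xi> _. complex_of_real ((INF z. V \<epsilon> z) + oscillator (\<lambda>j. \<omega> j 0) x \<xi> + \<epsilon> * oscillator \<omega>1 x \<xi> + L' \<epsilon> x \<xi>)) \<and>
           has_weyl_symbol h (\<lambda>u. (scaling (\<lambda>j. \<omega> j \<epsilon>) \<circ> change_of_variables (Q \<epsilon>) \<circ> translation (xmin \<epsilon>)) (schroedinger h (V \<epsilon>) (Ustar u)))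
             (\<lambda>x \<xi> _. complex_of_real ((INF z. V \<epsilon> z) + oscillator (\<lambda>j. \<omega> j 0) x \<xi> + L \<epsilon> x \<xi>))))"
    if e: "\<bar>\<epsilon>\<bar> < \<epsilon>\<^sub>1" for \<epsilon>
  proof -
    interpret U: affine_unitary "\<lambda>j. \<omega> j \<epsilon>" "Q \<epsilon>" "xmin \<epsilon>"
      by unfold_locales (use \<omega>_pos Q(2) lt[OF e] in auto)
    have T: "tempered (V \<epsilon>)"
    proof (rule tempered_of_growth[OF smV])
      fix N :: nat
      show "\<exists>C. \<forall>vs x. set vs \<subseteq> Basis \<and> length vs \<le> N \<longrightarrow> \<bar>pderivs vs (V \<epsilon>) x\<bar> \<le> C * (1 + (norm x)\<^sup>2) powr (m / 2)"
        using growth[of N] lt(3)[OF e] by blast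
    qed
    have inf: "(INF z. V \<epsilon> z) = V \<epsilon> (xmin \<epsilon>)"
      by (rule cInf_eq_minimum) (use V_min[OF lt(3)[OF e]] in auto)
    have osc: "oscillator (\<lambda>j. \<omega> j 0) x \<xi> + \<epsilon> * oscillator \<omega>1 x \<xi> + \<epsilon>\<^sup>2 * oscillator (\<lambda>j. \<omega>2 j \<epsilon>) x \<xi> =
        (\<Sum>j\<in>UNIV. \<omega> j \<epsilon> / 2 * (\<xi> $ j)\<^sup>2) + (\<Sum>j\<in>UNIV. \<omega> j \<epsilon> / 2 * (x $ j)\<^sup>2)" for x \<xi>
      unfolding oscillator_def sum_distrib_left sum.distrib[symmetric]
      by (intro sum.cong refl, subst (1 2) \<omega>_eq[OF lt(1)[OF e]]) (simp add: algebra_simps add_divide_distrib)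
    have symbol: "(INF z. V \<epsilon> z) + oscillator (\<lambda>j. \<omega> j 0) x \<xi> + \<epsilon> * oscillator \<omega>1 x \<xi> + L' \<epsilon> x \<xi> =
        (\<Sum>j\<in>UNIV. \<omega> j \<epsilon> / 2 * (\<xi> $ j)\<^sup>2) + V \<epsilon> (U.expand x + xmin \<epsilon>)"
      "(INF z. V \<epsilon> z) + oscillator (\<lambda>j. \<omega> j 0) x \<xi> + L \<epsilon> x \<xi> =
        (\<Sum>j\<in>UNIV. \<omega> j \<epsilon> / 2 * (\<xi> $ j)\<^sup>2) + V \<epsilon> (U.expand x + xmin \<epsilon>)" for x \<xi>
    proof -
      have "U.expand x = E \<epsilon> x" by (simp add: U.expand_def E_def Z_def)
      then show 1: "(INF z. V \<epsilon> z) + oscillator (\<lambda>j. \<omega> j 0) x \<xi> + \<epsilon> * oscillator \<omega>1 x \<xi> + L' \<epsilon> x \<xi> =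
        (\<Sum>j\<in>UNIV. \<omega> j \<epsilon> / 2 * (\<xi> $ j)\<^sup>2) + V \<epsilon> (U.expand x + xmin \<epsilon>)"
        using osc[of x \<xi>] V_expansion[OF e, of x] unfolding inf L'_def by simp
      then show "(INF z. V \<epsilon> z) + oscillator (\<lambda>j. \<omega> j 0) x \<xi> + L \<epsilon> x \<xi> =
        (\<Sum>j\<in>UNIV. \<omega> j \<epsilon> / 2 * (\<xi> $ j)\<^sup>2) + V \<epsilon> (U.expand x + xmin \<epsilon>)"
        unfolding L_def by simp
    qed
    show ?thesis
      unfolding U.U_eq
      by (intro conjI exI[of _ U.Ustar] ballI allI impI U.unitary_U U.adjoint_U U.Ustar_schwartz
           U.conjugated_weyl_symbol[OF _ T]) (simp_all only: symbol)
  qed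

  \<comment> \<open>The diagonalization in terms of the inverse of \<open>Q\<close>\<close>
  have Qinv: "matrix_inv (Q \<epsilon>) = transpose (Q \<epsilon>)" if "\<bar>\<epsilon>\<bar> < \<epsilon>\<^sub>1" for \<epsilon>
  proof -
    have QQ: "transpose (Q \<epsilon>) ** Q \<epsilon> = mat 1" "Q \<epsilon> ** transpose (Q \<epsilon>) = mat 1"
      using Q(2)[OF lt(2)[OF that]] by (simp_all add: orthogonal_matrix_def)
    have "\<exists>X. Q \<epsilon> ** X = mat 1 \<and> X ** Q \<epsilon> = mat 1" using QQ by blast
    then have "matrix_inv (Q \<epsilon>) ** Q \<epsilon> = mat 1" unfolding matrix_inv_def by (rule someI2_ex) simp
    then have "matrix_inv (Q \<epsilon>) ** Q \<epsilon> ** transpose (Q \<epsilon>) = transpose (Q \<epsilon>)" by (simp only: matrix_mul_lid)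
    then show ?thesis by (simp only: matrix_mul_assoc[symmetric] QQ matrix_mul_rid)
  qed
  have diagonal: "O_eps_infinity \<epsilon>\<^sub>1 (\<lambda>\<epsilon>. matrix_inv (Q \<epsilon>) ** hessian (V \<epsilon>) (xmin \<epsilon>) ** Q \<epsilon> - diag (\<lambda>j. (\<omega> j \<epsilon>)\<^sup>2))"
  proof -
    have "O_eps_infinity \<epsilon>\<^sub>1 off" by (rule O_eps_infinity_matrix[OF off])
    then show ?thesis unfolding O_eps_infinity_def by (simp add: Qinv off_def B_def A_def)
  qed
  show ?thesis
    unfolding Let_def
    by (rule exI[of _ \<epsilon>\<^sub>1], intro conjI e1(1,3), rule exI[of _ \<omega>], rule exI[of _ \<omega>1], rule exI[of _ \<omega>2],
        rule exI[of _ Q], rule exI[of _ R], rule exI[of _ \<rho>])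
       (intro conjI allI impI \<omega>I \<omega>2I \<omega>_pos[OF lt(1)] QI Q(2)[OF lt(2)] diagonal \<omega>_eq[OF lt(1)] Rsm R_cubic \<rho>sm \<rho>_flat
          oscillator_belongs_to_D2 belongs[unfolded L_def L'_def]
          operator[THEN conjunct1] operator[THEN conjunct2, unfolded L_def L'_def]; assumption)
qed

end
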